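(* Let $\mathfrak a=\langle f_1,\dots,f_r\rangle\subset\mathbb C[\boldsymbol x]=\mathbb C[x_1,\dots,x_n]$ be an ideal with system of generators $\boldsymbol f=(f_1,\dots,f_r)$, and let $g\in\mathbb C[\boldsymbol x]$ be nonzero. Let $$\tilde I_{\boldsymbol f}=\langle t_i-f_i\mid1\le i\le r\rangle+\Big\langle\partial_{x_j}+\sum_{i=1}^r\partial_{x_j}(f_i)\,\partial_{t_i}\ \Big|\ 1\le j\le n\Big\rangle\subset D_Y,$$ and define successively 0. $\tilde I_{(\boldsymbol f;g),0}=\tilde I_{\boldsymbol f}\cap D_Yg=D_Y[u]\,(u\tilde I_{\boldsymbol f}+(1-u)g)\cap D_Y$, 1. $\tilde I_{(\boldsymbol f;g),1}=\mathrm{in}(\tilde I_{(\boldsymbol f;g),0})$, 2. $\tilde I_{(\boldsymbol f;g),2}=(\tilde I_{(\boldsymbol f;g),1}+\langle s-\sigma\rangle)\cap\mathbb C[\boldsymbol x,s]$ (the sum being the left ideal generated in $D_Y[s]$), 3. $\tilde I_{(\boldsymbol f;g),3}=\tilde I_{(\boldsymbol f;g),2}:g=\tilde I_{(\boldsymbol f;g),2}\cdot g^{-1}$, 4. $\tilde I_{(\boldsymbol f;g),4}=\tilde I_{(\boldsymbol f;g),3}\cap\mathbb C[s]$. Then the global generalized Bernstein–Sato polynomial $b_{\mathfrak a,g}(s)$ is the (monic) generator of the ideal $\tilde I_{(\boldsymbol f;g),4}$ of $\mathbb C[s]$.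
   Context: Rings. $D_X=\mathbb C\langle x_1,\dots,x_n,\partial_{x_1},\dots,\partial_{x_n}\rangle$ and $D_Y=\mathbb C\langle x_1,\dots,x_n,t_1,\dots,t_r,\partial_{x_1},\dots,\partial_{x_n},\partial_{t_1},\dots,\partial_{t_r}\rangle$ are the Weyl algebras in $n$ and $n+r$ variables. The letters $u,s$ denote new variables commuting with everything; $\langle\cdots\rangle$ denotes the left ideal generated. $D_Y[u](u\tilde I_{\boldsymbol f}+(1-u)g)$ is the left ideal of $D_Y[u]$ generated by $uP$ ($P\in\tilde I_{\boldsymbol f}$) and $(1-u)g$. Put $\sigma=-\sum_{i=1}^r\partial_{t_i}t_i\in D_Y$. For an ideal $I$ of $\mathbb C[\boldsymbol x,s]$, $I:g=\{h\in\mathbb C[\boldsymbol x,s]\mid hg\in I\}$. Grading and initial ideals. $D_Y=\bigoplus_{m\in\mathbb Z}[D_Y]_m$ is graded by giving each $\partial_{t_j}$ degree $1$, each $t_j$ degree $-1$, and all $x_i$, $\partial_{x_i}$ degree $0$. For nonzero $P=\sum_mP_m$ with $P_m\in[D_Y]_m$, $\mathrm{in}(P)=P_{m_0}$ where $m_0$ is the largest $m$ with $P_m\ne0$. For a left ideal $I\subset D_Y$, $\mathrm{in}(I)$ is the left ideal of $D_Y$ generated by all $\mathrm{in}(P)$, $0\ne P\in I$ (the associated graded ring of $D_Y$ for the corresponding filtration is identified with $D_Y$). The module $N_{\boldsymbol f}$. The $f_i$ are nonzero. Let $s_1,\dots,s_r$ be independent variables and $N_{\boldsymbol f}=\mathbb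 C[\boldsymbol x][\prod_if_i^{-1},s_1,\dots,s_r]\prod_if_i^{s_i}$, where $\prod_if_i^{s_i}$ is a formal symbol (free module of rank one). It is a left $D_Y$-module: $\mathbb C[\boldsymbol x]$ acts by multiplication, and for $h\in\mathbb C[\boldsymbol x][\prod_i f_i^{-1},s_1,\dots,s_r]$, $$\partial_{x_j}\Big(h\prod_if_i^{s_i}\Big)=\Big(\partial_{x_j}(h)+h\sum_{k=1}^rs_k\frac{\partial_{x_j}(f_k)}{f_k}\Big)\prod_if_i^{s_i},$$ $$t_j\Big(h(x,s_1,\dots,s_r)\prod_if_i^{s_i}\Big)=h(x,s_1,\dots,s_j+1,\dots,s_r)f_j\prod_if_i^{s_i},$$ $$\partial_{t_j}\Big(h(x,s_1,\dots,s_r)\prod_if_i^{s_i}\Big)=-s_jh(x,s_1,\dots,s_j-1,\dots,s_r)f_j^{-1}\prod_if_i^{s_i}.$$ Definition of $b_{\mathfrak a,g}$. The global generalized Bernstein–Sato polynomial $b_{\mathfrak a,g}(s)\in\mathbb C[s]$ is the monic polynomial $b(s)$ of minimal degree satisfying $$b(\sigma)\,g\prod_if_i^{s_i}=\sum_{j=1}^rP_j\,g f_j\prod_if_i^{s_i}$$ for some $P_1,\dots,P_r\in D_X\langle-\partial_{t_j}t_k\mid1\le j,k\le r\rangle$ (the subalgebra of $D_Y$ generated by $D_X$ and the elements $-\partial_{t_j}t_k$). It is known (Budur–Mustaţă–Saito) that $b_{\mathfrak a,g}$ exists and does not depend on the choice of generators of $\mathfrak a$. *)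

theory Defs
  imports
    "HOL-Library.Poly_Mapping"
    "HOL-Computational_Algebra.Computational_Algebra"
begin

type_synonym 'v cpoly = "('v \<Rightarrow>\<^sub>0 nat) \<Rightarrow>\<^sub>0 complex"

definition mvar :: "'v \<Rightarrow> ('v \<Rightarrow>\<^sub>0 nat) \<Rightarrow>\<^sub>0 'a::zero_neq_one"
  where "mvar i = Poly_Mapping.single (Poly_Mapping.single i 1) 1"

definition mconst :: "'a::zero \<Rightarrow> ('v \<Rightarrow>\<^sub>0 nat) \<Rightarrow>\<^sub>0 'a"
  where "mconst c = Poly_Mapping.single 0 c"

definition meval :: "('a::zero \<Rightarrow> 'b) \<Rightarrow> ('v::finite \<Rightarrow> 'b) \<Rightarrow> (('v \<Rightarrow>\<^sub>0 nat) \<Rightarrow>\<^sub>0 'a) \<Rightarrow> 'b::comm_semiring_1"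
  where "meval \<phi> v p =
    (\<Sum>m\<in>Poly_Mapping.keys p. \<phi> (Poly_Mapping.lookup p m) * (\<Prod>i\<in>UNIV. v i ^ Poly_Mapping.lookup m i))"

text \<open>The coefficient of \<open>m\<close> in \<open>\<partial>p / \<partial>x\<^sub>i\<close> comes from the monomial \<open>m x\<^sub>i\<close> of \<open>p\<close>.\<close>

lift_definition mderiv :: "'v \<Rightarrow> (('v \<Rightarrow>\<^sub>0 nat) \<Rightarrow>\<^sub>0 'a::semiring_1) \<Rightarrow> (('v \<Rightarrow>\<^sub>0 nat) \<Rightarrow>\<^sub>0 'a)"
  is "\<lambda>i p m. of_nat (Poly_Mapping.lookup m i + 1) * p (m + Poly_Mapping.single i 1)"
proof -
  fix i :: 'v and p :: "('v \<Rightarrow>\<^sub>0 nat) \<Rightarrow> 'a"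
  assume fin: "finite {m. p m \<noteq> 0}"
  have "inj (\<lambda>m. m + Poly_Mapping.single i (1::nat))"
    by (auto intro: injI)
  then have "finite ((\<lambda>m. m + Poly_Mapping.single i 1) -` {m. p m \<noteq> 0})"
    using fin by (rule finite_vimageI[rotated])
  then show "finite {m. of_nat (Poly_Mapping.lookup m i + 1) * p (m + Poly_Mapping.single i 1) \<noteq> 0}"
    by (rule rev_finite_subset) auto
qed

lemma mderiv_add: "mderiv i (p + q) = mderiv i p + mderiv i q"
  by transfer (auto simp: fun_eq_iff distrib_left)

lemma mderiv_zero [simp]: "mderiv i 0 = 0"
  by transfer auto

lemma mderiv_single:
  "mderiv i (Poly_Mapping.single m a) =
     Poly_Mapping.single (m - Poly_Mapping.single i 1) (of_nat (Poly_Mapping.lookup m i) * a)"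
proof (rule poly_mapping_eqI)
  fix k
  let ?e = "Poly_Mapping.single i (1::nat)"
  have *: "Poly_Mapping.lookup m i = 0" if "m \<noteq> k + ?e" "m - ?e = k"
  proof (rule ccontr)
    assume "Poly_Mapping.lookup m i \<noteq> 0"
    then have "m = (m - ?e) + ?e"
      by (intro poly_mapping_eqI) (auto simp: lookup_add lookup_minus lookup_single when_def)
    with that show False by simp
  qed
  show "Poly_Mapping.lookup (mderiv i (Poly_Mapping.single m a)) k =
     Poly_Mapping.lookup (Poly_Mapping.single (m - ?e) (of_nat (Poly_Mapping.lookup m i) * a)) k"
    using * by (auto simp: mderiv.rep_eq lookup_single when_def lookup_add)
qed

lemma mpoly_induct [case_names zero add]:
  assumes "P 0" "\<And>p m a. P p \<Longrightarrow> P (p + Poly_Mapping.single m a)"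
  shows "P (p :: 'b \<Rightarrow>\<^sub>0 'a::monoid_add)"
proof (induction p rule: update_induct)
  case const then show ?case by (rule assms(1))
next
  case (update f a b)
  then have "Poly_Mapping.update a b f = f + Poly_Mapping.single a b"
    by (intro poly_mapping_eqI)
      (auto simp: lookup_add lookup_single when_def lookup_update in_keys_iff)
  with update assms(2) show ?case by metis
qed

lemma mderiv_mult:
  fixes p q :: "('v \<Rightarrow>\<^sub>0 nat) \<Rightarrow>\<^sub>0 'a::comm_semiring_1"
  shows "mderiv i (p * q) = mderiv i p * q + p * mderiv i q"
proof (induction p rule: mpoly_induct)
  case (add p m a)
  let ?e = "Poly_Mapping.single i (1::nat)"
  have "mderiv i (Poly_Mapping.single m a * q) =
      mderiv i (Poly_Mapping.single m a) * q + Poly_Mapping.single m a * mderiv i q"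
  proof (induction q rule: mpoly_induct)
    case (add q k b)
    have 1: "m + k - ?e = m - ?e + k" if "Poly_Mapping.lookup m i \<noteq> 0"
      using that by (intro poly_mapping_eqI) (auto simp: lookup_add lookup_minus lookup_single when_def)
    have 2: "m + k - ?e = m + (k - ?e)" if "Poly_Mapping.lookup k i \<noteq> 0"
      using that by (intro poly_mapping_eqI) (auto simp: lookup_add lookup_minus lookup_single when_def)
    have shift_m: "Poly_Mapping.single (m + k - ?e) (of_nat (Poly_Mapping.lookup m i) * a * b) =
              Poly_Mapping.single (m - ?e + k) (of_nat (Poly_Mapping.lookup m i) * a * b)"
      using 1 by (cases "Poly_Mapping.lookup m i = 0") auto
    have shift_k: "Poly_Mapping.single (m + k - ?e) (a * (of_nat (Poly_Mapping.lookup k i) * b)) =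
              Poly_Mapping.single (m + (k - ?e)) (a * (of_nat (Poly_Mapping.lookup k i) * b))"
      using 2 by (cases "Poly_Mapping.lookup k i = 0") auto
    have "mderiv i (Poly_Mapping.single m a * Poly_Mapping.single k b) =
      mderiv i (Poly_Mapping.single m a) * Poly_Mapping.single k b +
      Poly_Mapping.single m a * mderiv i (Poly_Mapping.single k b)"
      unfolding mderiv_single mult_single shift_m[symmetric] shift_k[symmetric] single_add[symmetric]
      by (simp add: lookup_add algebra_simps)
    with add show ?case by (simp add: mderiv_add algebra_simps)
  qed simp
  with add show ?case by (simp add: mderiv_add algebra_simps)
qed simp

definition fract_deriv :: "'v::linorder \<Rightarrow> 'v cpoly fract \<Rightarrow> 'v cpoly fract"
  where "fract_deriv i q =
    (let (a, b) = (SOME (a, b). b \<noteq> 0 \<and> q = Fract a b)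
     in Fract (mderiv i a * b - a * mderiv i b) (b ^ 2))"

lemma fract_deriv_Fract:
  assumes "b \<noteq> 0"
  shows "fract_deriv i (Fract a b) = Fract (mderiv i a * b - a * mderiv i b) (b ^ 2)"
proof -
  obtain c d where cd: "(SOME (c, d). d \<noteq> 0 \<and> Fract a b = Fract c d) = (c, d)"
    by fastforce
  have "case (SOME (c, d). d \<noteq> 0 \<and> Fract a b = Fract c d) of (c, d) \<Rightarrow> d \<noteq> 0 \<and> Fract a b = Fract c d"
    by (rule someI[where x = "(a, b)"]) (use assms in simp)
  then have d: "d \<noteq> 0" and "Fract a b = Fract c d"
    by (simp_all add: cd)
  with assms have eq: "a * d = c * b"
    by (simp add: eq_fract)
  from arg_cong[OF eq, of "mderiv i"]
  have "mderiv i a * d + a * mderiv i d = mderiv i c * b + c * mderiv i b"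
    by (simp add: mderiv_mult)
  with eq have "(mderiv i a * b - a * mderiv i b) * d\<^sup>2 = (mderiv i c * d - c * mderiv i d) * b\<^sup>2"
    by algebra
  with assms d show ?thesis
    by (simp add: fract_deriv_def cd eq_fract)
qed

definition left_ideal :: "'a::ring_1 set \<Rightarrow> bool"
  where "left_ideal J \<longleftrightarrow> 0 \<in> J \<and> (\<forall>a\<in>J. \<forall>b\<in>J. a + b \<in> J) \<and> (\<forall>r. \<forall>a\<in>J. r * a \<in> J)"

text \<open>The Weyl algebra is realized as a subalgebra of the endomorphisms of the polynomial ring; in
  characteristic zero this representation is faithful.\<close>

inductive_set diff_ops :: "('v cpoly \<Rightarrow> 'v cpoly) set"
  where
    mult: "(\<lambda>q. p * q) \<in> diff_ops"
  | deriv: "mderiv i \<in> diff_ops"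
  | add: "P \<in> diff_ops \<Longrightarrow> Q \<in> diff_ops \<Longrightarrow> (\<lambda>q. P q + Q q) \<in> diff_ops"
  | comp: "P \<in> diff_ops \<Longrightarrow> Q \<in> diff_ops \<Longrightarrow> (\<lambda>q. P (Q q)) \<in> diff_ops"

typedef 'v weyl = "diff_ops :: ('v cpoly \<Rightarrow> 'v cpoly) set"
  morphisms weyl_op Abs_weyl
  by (blast intro: diff_ops.mult)

setup_lifting type_definition_weyl

lemma diff_ops_additive: "P \<in> diff_ops \<Longrightarrow> P (p + q) = P p + P q"
  by (induction arbitrary: p q rule: diff_ops.induct) (auto simp: mderiv_add algebra_simps)

lemma diff_ops_multI: "(\<And>q. P q = p * q) \<Longrightarrow> P \<in> diff_ops"
  using diff_ops.mult[of p] by (metis ext)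

instantiation weyl :: (type) ring_1
begin

lift_definition zero_weyl :: "'v weyl" is "\<lambda>q. 0"
  by (rule diff_ops_multI[of _ 0]) simp

lift_definition one_weyl :: "'v weyl" is "\<lambda>q. q"
  by (rule diff_ops_multI[of _ 1]) simp

lift_definition plus_weyl :: "'v weyl \<Rightarrow> 'v weyl \<Rightarrow> 'v weyl" is "\<lambda>P Q q. P q + Q q"
  by (rule diff_ops.add)

lift_definition uminus_weyl :: "'v weyl \<Rightarrow> 'v weyl" is "\<lambda>P q. - P q"
  using diff_ops.comp[OF diff_ops.mult[of "- 1"]] by simp

lift_definition minus_weyl :: "'v weyl \<Rightarrow> 'v weyl \<Rightarrow> 'v weyl" is "\<lambda>P Q q. P q - Q q"
  using diff_ops.add[OF _ diff_ops.comp[OF diff_ops.mult[of "- 1"]]] by simp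

lift_definition times_weyl :: "'v weyl \<Rightarrow> 'v weyl \<Rightarrow> 'v weyl" is "\<lambda>P Q q. P (Q q)"
  by (rule diff_ops.comp)

instance
proof
  show "(0 :: 'v weyl) \<noteq> 1"
    by transfer (metis one_neq_zero)
qed (transfer; simp add: algebra_simps diff_ops_additive fun_eq_iff)+

end

definition weyl_poly :: "'v cpoly \<Rightarrow> 'v weyl"
  where "weyl_poly p = Abs_weyl (\<lambda>q. p * q)"

definition weyl_deriv :: "'v \<Rightarrow> 'v weyl"
  where "weyl_deriv i = Abs_weyl (mderiv i)"

lemma weyl_op_poly [simp]: "weyl_op (weyl_poly p) = (\<lambda>q. p * q)"
  by (simp add: weyl_poly_def Abs_weyl_inverse diff_ops.mult)

lemma weyl_op_deriv [simp]: "weyl_op (weyl_deriv i) = mderiv i"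
  by (simp add: weyl_deriv_def Abs_weyl_inverse diff_ops.deriv)

lemma weyl_deriv_poly:
  "weyl_deriv i * weyl_poly p = weyl_poly p * weyl_deriv i + weyl_poly (mderiv i p)"
  by (simp add: weyl_op_inject [symmetric] times_weyl.rep_eq plus_weyl.rep_eq mderiv_mult
      fun_eq_iff algebra_simps)

text \<open>The ring \<open>D\<^sub>Y\<close> is the type \<^typ>\<open>('n + 'r) weyl\<close>, where \<open>Inl i\<close> indexes \<open>x\<^sub>i\<close> and
  \<open>Inr j\<close> indexes \<open>t\<^sub>j\<close>.\<close>

type_synonym ('n, 'r) dy = "('n + 'r) weyl"

definition polyX :: "'n::finite cpoly \<Rightarrow> ('n, 'r) dy"
  where "polyX p = weyl_poly (meval mconst (\<lambda>i. mvar (Inl i)) p)"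

definition dX :: "'n \<Rightarrow> ('n, 'r) dy"
  where "dX i = weyl_deriv (Inl i)"

definition tY :: "'r \<Rightarrow> ('n, 'r) dy"
  where "tY j = weyl_poly (mvar (Inr j))"

definition dT :: "'r \<Rightarrow> ('n, 'r) dy"
  where "dT j = weyl_deriv (Inr j)"

definition \<sigma> :: "('n, 'r::finite) dy"
  where "\<sigma> = - (\<Sum>j\<in>UNIV. dT j * tY j)"

definition subalgebra :: "('n, 'r) dy set \<Rightarrow> bool"
  where "subalgebra A \<longleftrightarrow> (\<forall>c. weyl_poly (mconst c) \<in> A) \<and> (\<forall>P\<in>A. \<forall>Q\<in>A. P + Q \<in> A \<and> P * Q \<in> A)"

definition DX :: "('n::finite, 'r) dy set"
  where "DX = subalgebra hull (range polyX \<union> range dX)"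

inductive graded_piece :: "int \<Rightarrow> ('n::finite, 'r) dy \<Rightarrow> bool"
  where
    poly: "graded_piece 0 (polyX p)"
  | dX: "graded_piece 0 (dX i)"
  | t: "graded_piece (- 1) (tY j)"
  | dT: "graded_piece 1 (dT j)"
  | zero: "graded_piece m 0"
  | add: "graded_piece m P \<Longrightarrow> graded_piece m Q \<Longrightarrow> graded_piece m (P + Q)"
  | mult: "graded_piece m P \<Longrightarrow> graded_piece k Q \<Longrightarrow> graded_piece (m + k) (P * Q)"

definition graded_parts :: "('n::finite, 'r) dy \<Rightarrow> int \<Rightarrow>\<^sub>0 ('n, 'r) dy"
  where "graded_parts P = (THE c. (\<forall>m. graded_piece m (Poly_Mapping.lookup c m)) \<and>
    P = (\<Sum>m\<in>Poly_Mapping.keys c. Poly_Mapping.lookup c m))"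

definition initial_form :: "('n::finite, 'r) dy \<Rightarrow> ('n, 'r) dy"
  where "initial_form P =
    (let c = graded_parts P in Poly_Mapping.lookup c (Max (Poly_Mapping.keys c)))"

definition initial_ideal :: "('n::finite, 'r) dy set \<Rightarrow> ('n, 'r) dy set"
  where "initial_ideal I = left_ideal hull {initial_form P | P. P \<in> I \<and> P \<noteq> 0}"

text \<open>An element \<open>h\<close> of the rank one module \<open>N\<^sub>f\<close>, with the formal symbol omitted, is a polynomial
  in \<open>s\<^sub>1, \<dots>, s\<^sub>r\<close> with coefficients in the localization of \<open>\<complex>[x]\<close> at \<open>\<Prod>\<^sub>i f\<^sub>i\<close>.  As the latter
  depends on \<open>f\<close>, it is taken inside the fraction field, and \<open>N\<^sub>f\<close> is a carrier set.\<close>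

type_synonym ('n, 'r) smod = "('r \<Rightarrow>\<^sub>0 nat) \<Rightarrow>\<^sub>0 'n cpoly fract"

definition localization :: "('r::finite \<Rightarrow> 'n::linorder cpoly) \<Rightarrow> 'n cpoly fract set"
  where "localization f = {to_fract p / to_fract (\<Prod>i\<in>UNIV. f i) ^ k | p k. True}"

definition N_mod :: "('r::finite \<Rightarrow> 'n::linorder cpoly) \<Rightarrow> ('n, 'r) smod set"
  where "N_mod f = {h. \<forall>m. Poly_Mapping.lookup h m \<in> localization f}"

definition s_shift :: "'r::finite \<Rightarrow> int \<Rightarrow> ('n::linorder, 'r) smod \<Rightarrow> ('n, 'r) smod"
  where "s_shift j c = meval mconst (\<lambda>k. if k = j then mvar k + of_int c else mvar k)"

definition is_N_action :: "('r::finite \<Rightarrow> 'n::{finite,linorder} cpoly) \<Rightarrow>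
    (('n, 'r) dy \<Rightarrow> ('n, 'r) smod \<Rightarrow> ('n, 'r) smod) \<Rightarrow> bool"
  where "is_N_action f \<phi> \<longleftrightarrow> (\<forall>h\<in>N_mod f.
    (\<forall>P. \<phi> P h \<in> N_mod f) \<and>
    (\<forall>P. \<forall>h'\<in>N_mod f. \<phi> P (h + h') = \<phi> P h + \<phi> P h') \<and>
    (\<forall>P Q. \<phi> (P + Q) h = \<phi> P h + \<phi> Q h) \<and>
    (\<forall>P Q. \<phi> (P * Q) h = \<phi> P (\<phi> Q h)) \<and>
    (\<forall>p. \<phi> (polyX p) h = mconst (to_fract p) * h) \<and>
    (\<forall>j. \<phi> (dX j) h = Poly_Mapping.map (fract_deriv j) h +
        h * (\<Sum>k\<in>UNIV. mvar k * mconst (to_fract (mderiv j (f k)) / to_fract (f k)))) \<and>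
    (\<forall>j. \<phi> (tY j) h = s_shift j 1 h * mconst (to_fract (f j))) \<and>
    (\<forall>j. \<phi> (dT j) h = - (mvar j * s_shift j (- 1) h * mconst (inverse (to_fract (f j))))))"

text \<open>These conditions determine the action on \<^term>\<open>N_mod f\<close> uniquely, since the listed operators
  generate \<open>D\<^sub>Y\<close>; values outside \<^term>\<open>N_mod f\<close> are unspecified and never used.\<close>

definition N_act :: "('r::finite \<Rightarrow> 'n::{finite,linorder} cpoly) \<Rightarrow>
    ('n, 'r) dy \<Rightarrow> ('n, 'r) smod \<Rightarrow> ('n, 'r) smod"
  where "N_act f = (SOME \<phi>. is_N_action f \<phi>)"

definition poly_weyl :: "complex poly \<Rightarrow> 'v weyl \<Rightarrow> 'v weyl"
  where "poly_weyl b P = (\<Sum>k\<le>degree b. weyl_poly (mconst (coeff b k)) * P ^ k)"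

definition bs_equation :: "('r::finite \<Rightarrow> 'n::{finite,linorder} cpoly) \<Rightarrow> 'n cpoly \<Rightarrow> complex poly \<Rightarrow> bool"
  where "bs_equation f g b \<longleftrightarrow>
    (\<exists>P. (\<forall>j. P j \<in> subalgebra hull (DX \<union> {- (dT j * tY k) | j k. True})) \<and>
      N_act f (poly_weyl b \<sigma>) (mconst (to_fract g)) =
        (\<Sum>j\<in>UNIV. N_act f (P j) (mconst (to_fract (g * f j)))))"

definition is_bernstein_sato :: "('r::finite \<Rightarrow> 'n::{finite,linorder} cpoly) \<Rightarrow> 'n cpoly \<Rightarrow> complex poly \<Rightarrow> bool"
  where "is_bernstein_sato f g b \<longleftrightarrow> lead_coeff b = 1 \<and> bs_equation f g b \<and>
    (\<forall>b'. lead_coeff b' = 1 \<and> bs_equation f g b' \<longrightarrow> degree b \<le> degree b')"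

text \<open>Adjoining a central variable to a ring \<open>D\<close> gives \<^typ>\<open>nat \<Rightarrow>\<^sub>0 'd\<close> (the library type
  \<^typ>\<open>'d poly\<close> only multiplies over commutative rings).\<close>

definition cvar :: "nat \<Rightarrow>\<^sub>0 'd::zero_neq_one"
  where "cvar = Poly_Mapping.single 1 1"

definition cconst :: "'d::zero \<Rightarrow> nat \<Rightarrow>\<^sub>0 'd"
  where "cconst P = Poly_Mapping.single 0 P"

text \<open>\<open>\<complex>[x, s]\<close> is \<^typ>\<open>'n cpoly poly\<close>, which \<open>polyXs\<close> embeds into \<open>D\<^sub>Y[s]\<close>; an intersection
  with a subring is the preimage under the embedding.\<close>

definition polyXs :: "'n::finite cpoly poly \<Rightarrow> nat \<Rightarrow>\<^sub>0 ('n, 'r) dy"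
  where "polyXs p = (\<Sum>k\<le>degree p. cconst (polyX (coeff p k)) * cvar ^ k)"

definition I_tilde :: "('r::finite \<Rightarrow> 'n::finite cpoly) \<Rightarrow> ('n, 'r) dy set"
  where "I_tilde f = left_ideal hull
    (range (\<lambda>i. tY i - polyX (f i)) \<union>
     range (\<lambda>j. dX j + (\<Sum>i\<in>UNIV. polyX (mderiv j (f i)) * dT i)))"

definition I0 :: "('r::finite \<Rightarrow> 'n::finite cpoly) \<Rightarrow> 'n cpoly \<Rightarrow> ('n, 'r) dy set"
  where "I0 f g = I_tilde f \<inter> left_ideal hull {polyX g}"

definition I0_elim :: "('r::finite \<Rightarrow> 'n::finite cpoly) \<Rightarrow> 'n cpoly \<Rightarrow> ('n, 'r) dy set"
  where "I0_elim f g = {P. cconst P \<in> left_ideal hull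
    ({cvar * cconst Q | Q. Q \<in> I_tilde f} \<union> {(1 - cvar) * cconst (polyX g)})}"

definition I1 :: "('r::finite \<Rightarrow> 'n::finite cpoly) \<Rightarrow> 'n cpoly \<Rightarrow> ('n, 'r) dy set"
  where "I1 f g = initial_ideal (I0 f g)"

definition I2 :: "('r::finite \<Rightarrow> 'n::finite cpoly) \<Rightarrow> 'n cpoly \<Rightarrow> 'n cpoly poly set"
  where "I2 f g = {p. polyXs p \<in> left_ideal hull (cconst ` I1 f g \<union> {cvar - cconst \<sigma>})}"

definition ideal_quotient :: "'a::comm_ring_1 set \<Rightarrow> 'a \<Rightarrow> 'a set"
  where "ideal_quotient I g = {h. h * g \<in> I}"

definition I3 :: "('r::finite \<Rightarrow> 'n::finite cpoly) \<Rightarrow> 'n cpoly \<Rightarrow> 'n cpoly poly set"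
  where "I3 f g = ideal_quotient (I2 f g) [:g:]"

definition I4 :: "('r::finite \<Rightarrow> 'n::finite cpoly) \<Rightarrow> 'n cpoly \<Rightarrow> complex poly set"
  where "I4 f g = {q. map_poly mconst q \<in> I3 f g}"

end

theory Submission
  imports Defs
begin

text \<open>
  Let \<open>u\<close> be the formal symbol \<open>\<Prod>\<^sub>i f\<^sub>i^s\<^sub>i\<close>.  Since \<open>t\<^sub>j (h u) = h f\<^sub>j u\<close> for a polynomial \<open>h\<close> in
  the \<open>x\<close> alone, the functional equation \<open>b(\<sigma>) g u = \<Sum>\<^sub>j P\<^sub>j g f\<^sub>j u\<close> says that
  \<open>(b(\<sigma>) - \<Sum>\<^sub>j P\<^sub>j t\<^sub>j) g\<close> annihilates \<open>u\<close>.  The annihilator of \<open>u\<close> is exactly \<^const>\<open>I_tilde\<close>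
  (\<open>I_tilde_iff_annihilates\<close>), and the \<open>P\<^sub>j\<close> have degree \<open>0\<close>.  So the equation provides an element of
  \<^const>\<open>I0\<close> whose degree \<open>0\<close> part is \<open>b(\<sigma>) g\<close> and whose other part has degree \<open>- 1\<close>; hence
  \<open>b(\<sigma>) g\<close> lies in the initial ideal.  Conversely, if \<open>b(\<sigma>) g\<close> lies in the initial ideal, then it
  is the degree \<open>0\<close> part of an element of \<^const>\<open>I0\<close> without terms of positive degree, and the
  terms of negative degree can be rewritten: an operator of negative degree is a combination of
  words in the \<open>t\<^sub>j\<close> with coefficients of degree \<open>0\<close> on the left (\<open>graded_piece_nonpos\<close>), and on
  \<open>g u\<close> each \<open>t\<^sub>j\<close> acts as \<open>f\<^sub>j\<close>.  All but one letter of a word can therefore be moved into the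
  coefficient, which gives the shape
  \<open>\<Sum>\<^sub>j P\<^sub>j g f\<^sub>j u\<close> (\<open>I4_iff_bs_equation\<close>).

  On the side of the ideals, working modulo \<open>s - \<sigma>\<close> means evaluating \<open>s\<close> at \<open>\<sigma>\<close>.  As
  \<open>\<sigma>\<close> is not central, this needs that the initial ideal is stable under right multiplication by
  \<open>\<sigma>\<close>, which holds because \<open>[\<sigma>, P] = m P\<close> for \<open>P\<close> of degree \<open>m\<close>.  The same relation makes the
  homogeneous parts of an operator eigenvectors for distinct eigenvalues, hence unique.  So
  \<^const>\<open>I4\<close> is the set of all \<open>b\<close> that satisfy a functional equation, and in \<open>\<complex>[s]\<close> a monic
  element of least degree of an ideal is the same as a monic generator.

  Two points rest on the structure of the Weyl algebra: that the formulas for \<open>\<partial>\<^sub>x, t, \<partial>\<^sub>t\<close> define an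
  action on \<open>N\<close> at all (the operators are given as endomorphisms of a polynomial ring, so this is
  the universal property \<open>weyl_universal\<close>), and that nothing outside \<^const>\<open>I_tilde\<close> kills \<open>u\<close>.  Both
  are proved without bases and multi-indices, by one device: commutators with the generators lower the order of
  an operator, and an Euler-type sum of commutators multiplies an operator of order \<open>k\<close> by \<open>k\<close>, up
  to lower order.  So an operator that has order \<open>k > 0\<close> and all commutators zero has lower order.

  The description of \<^const>\<open>I0\<close> by elimination follows by evaluating the auxiliary variable at \<open>1\<close> and
  at \<open>0\<close>.
  The quotient \<open>I2 / g\<close> consists of polynomials because every element of \<^const>\<open>I2\<close> is divisible by
  \<open>g\<close>: if \<open>h(x, \<sigma>) = Q g\<close> as operators, then \<open>h(x, \<sigma>)\<close> maps \<open>1 / g\<close> to \<open>Q 1\<close>, which has no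
  denominators (\<open>I2_imp_dvd\<close>).
\<close>

section \<open>Generators of polynomial rings and of the Weyl algebra\<close>

lemma mconst_add: "mconst (a + b) = mconst a + mconst b"
  by (simp add: mconst_def single_add)

lemma mconst_mult: "mconst (a * b :: 'a::semiring_0) = mconst a * mconst b"
  by (simp add: mconst_def mult_single)

lemma mconst_0 [simp]: "mconst 0 = 0"
  by (simp add: mconst_def)

lemma mconst_1 [simp]: "mconst 1 = 1"
  by (simp add: mconst_def)

lemma mconst_eq_iff [simp]: "mconst a = mconst b \<longleftrightarrow> a = b"
  unfolding mconst_def by (metis lookup_single_eq)

lemma mconst_uminus: "mconst (- a :: 'a::ring_1) = - mconst a"
  by (simp add: mconst_def single_uminus)

lemma lookup_mconst_mult [simp]:
  fixes p :: "('v \<Rightarrow>\<^sub>0 nat) \<Rightarrow>\<^sub>0 'a::comm_semiring_1"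
  shows "Poly_Mapping.lookup (mconst c * p) m = c * Poly_Mapping.lookup p m"
proof (induction p rule: mpoly_induct)
  case (add p k a)
  then show ?case
    by (simp add: distrib_left lookup_add mconst_def mult_single lookup_single when_def)
qed simp

lemma mpoly_gen_induct [case_names const var add mult]:
  fixes p :: "('v \<Rightarrow>\<^sub>0 nat) \<Rightarrow>\<^sub>0 'a::comm_semiring_1"
  assumes const: "\<And>c. P (mconst c)" and var: "\<And>i. P (mvar i)"
    and add: "\<And>p q. P p \<Longrightarrow> P q \<Longrightarrow> P (p + q)" and mult: "\<And>p q. P p \<Longrightarrow> P q \<Longrightarrow> P (p * q)"
  shows "P p"
proof (induction p rule: mpoly_induct)
  case zero
  show ?case using const[of 0] by simp
next
  case (add p m a)
  have "P (Poly_Mapping.single m a)"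
  proof (induction m rule: mpoly_induct)
    case zero
    show ?case using const[of a] by (simp add: mconst_def)
  next
    case (add m i n)
    show ?case
    proof (induction n)
      case 0
      show ?case using add by simp
    next
      case (Suc n)
      have "Poly_Mapping.single (m + Poly_Mapping.single i (Suc n)) a =
          Poly_Mapping.single (m + Poly_Mapping.single i n) a * mvar i"
        by (simp add: mvar_def mult_single add.assoc flip: single_add)
      with Suc var mult show ?case by metis
    qed
  qed
  with add assms(3) show ?case by blast
qed

context
  fixes v :: "'v::finite \<Rightarrow> ('w \<Rightarrow>\<^sub>0 nat) \<Rightarrow>\<^sub>0 'a::comm_semiring_1"
begin

lemma meval_superset:
  assumes "finite S" "Poly_Mapping.keys p \<subseteq> S"
  shows "meval mconst v p = (\<Sum>m\<in>S. mconst (Poly_Mapping.lookup p m) * (\<Prod>i\<in>UNIV. v i ^ Poly_Mapping.lookup m i))"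
  unfolding meval_def using assms by (intro sum.mono_neutral_left) (auto simp: in_keys_iff)

lemma meval_add: "meval mconst v (p + q) = meval mconst v p + meval mconst v q"
proof -
  let ?S = "Poly_Mapping.keys p \<union> Poly_Mapping.keys q"
  have "Poly_Mapping.keys (p + q) \<subseteq> ?S" by (rule Poly_Mapping.keys_add)
  then show ?thesis
    by (simp add: meval_superset[of ?S] lookup_add mconst_add distrib_right sum.distrib)
qed

lemma meval_single: "meval mconst v (Poly_Mapping.single m a) = mconst a * (\<Prod>i\<in>UNIV. v i ^ Poly_Mapping.lookup m i)"
  by (simp add: meval_superset[of "{m}"])

lemma meval_0 [simp]: "meval mconst v 0 = 0"
  by (simp add: meval_def)

lemma meval_mult: "meval mconst v (p * q) = meval mconst v p * meval mconst v q"
proof (induction p rule: mpoly_induct)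
  case (add p m a)
  have "meval mconst v (Poly_Mapping.single m a * q) = meval mconst v (Poly_Mapping.single m a) * meval mconst v q"
  proof (induction q rule: mpoly_induct)
    case (add q k b)
    then show ?case
      by (simp add: distrib_left meval_add mult_single meval_single lookup_add power_add prod.distrib
          mconst_mult algebra_simps)
  qed simp
  with add show ?case by (simp add: distrib_right meval_add)
qed simp

lemma meval_mconst [simp]: "meval mconst v (mconst c) = mconst c"
  using meval_single[of 0 c] by (simp add: mconst_def)

lemma meval_1 [simp]: "meval mconst v 1 = 1"
  using meval_mconst[of 1] by simp

lemma meval_mvar [simp]: "meval mconst v (mvar i) = v i"
proof -
  have "(\<Prod>k\<in>UNIV. v k ^ Poly_Mapping.lookup (Poly_Mapping.single i (1::nat)) k) = (\<Prod>k\<in>UNIV. if k = i then v k else 1)"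
    by (intro prod.cong) (auto simp: lookup_single when_def)
  then show ?thesis by (simp add: mvar_def meval_single)
qed

end

abbreviation wconst :: "complex \<Rightarrow> 'v weyl"
  where "wconst c \<equiv> weyl_poly (mconst c)"

abbreviation wvar :: "'v \<Rightarrow> 'v weyl"
  where "wvar i \<equiv> weyl_poly (mvar i)"

lemma weyl_eqI: "(\<And>q. weyl_op P q = weyl_op Q q) \<Longrightarrow> P = Q"
  by (simp add: fun_eq_iff flip: weyl_op_inject)

lemma weyl_poly_add: "weyl_poly (p + q) = weyl_poly p + weyl_poly q"
  by (rule weyl_eqI) (simp add: plus_weyl.rep_eq distrib_right)

lemma weyl_poly_mult: "weyl_poly (p * q) = weyl_poly p * weyl_poly q"
  by (rule weyl_eqI) (simp add: times_weyl.rep_eq mult.assoc)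

lemma weyl_poly_0 [simp]: "weyl_poly 0 = 0"
  by (rule weyl_eqI) (simp add: zero_weyl.rep_eq)

lemma weyl_poly_1 [simp]: "weyl_poly 1 = 1"
  by (rule weyl_eqI) (simp add: one_weyl.rep_eq)

lemma weyl_poly_uminus: "weyl_poly (- p) = - weyl_poly p"
  by (rule weyl_eqI) (simp add: uminus_weyl.rep_eq)

lemma weyl_poly_commute: "weyl_poly p * weyl_poly q = weyl_poly q * weyl_poly p"
  by (metis mult.commute weyl_poly_mult)

lemma weyl_poly_eq_iff [simp]: "weyl_poly p = weyl_poly q \<longleftrightarrow> p = q"
  by (metis mult.right_neutral weyl_op_poly)

lemma mderiv_mconst [simp]: "mderiv i (mconst c) = 0"
  by (simp add: mconst_def mderiv_single)

lemma mderiv_mvar: "mderiv i (mvar j :: ('v \<Rightarrow>\<^sub>0 nat) \<Rightarrow>\<^sub>0 'a::comm_semiring_1) = (if i = j then 1 else 0)"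
  by (auto simp: mvar_def mderiv_single lookup_single when_def)

lemma mderiv_mderiv: "mderiv i (mderiv j p :: ('v \<Rightarrow>\<^sub>0 nat) \<Rightarrow>\<^sub>0 'a::comm_semiring_1) = mderiv j (mderiv i p)"
proof (induction p rule: mpoly_gen_induct)
  case (var k)
  then show ?case by (auto simp: mderiv_mvar) (metis mconst_1 mderiv_mconst mderiv_zero)+
next
  case (mult p q)
  then show ?case by (simp add: mderiv_mult mderiv_add algebra_simps)
qed (simp_all add: mderiv_add)

lemma weyl_deriv_commute: "weyl_deriv i * weyl_deriv j = weyl_deriv j * weyl_deriv i"
  by (rule weyl_eqI) (simp add: times_weyl.rep_eq mderiv_mderiv)

lemma weyl_deriv_var: "weyl_deriv i * wvar j = wvar j * weyl_deriv i + (if i = j then 1 else 0)"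
  by (auto simp: weyl_deriv_poly mderiv_mvar)

lemma weyl_deriv_const: "weyl_deriv i * wconst c = wconst c * weyl_deriv i"
  by (simp add: weyl_deriv_poly)

lemma weyl_induct [case_names const var deriv add mult]:
  assumes const: "\<And>c. Q (wconst c)" and var: "\<And>i. Q (wvar i)" and deriv: "\<And>i. Q (weyl_deriv i)"
    and add: "\<And>P R. Q P \<Longrightarrow> Q R \<Longrightarrow> Q (P + R)" and mult: "\<And>P R. Q P \<Longrightarrow> Q R \<Longrightarrow> Q (P * R)"
  shows "Q (P :: 'v weyl)"
proof -
  have poly: "Q (weyl_poly p)" for p
    by (induction p rule: mpoly_gen_induct) (simp_all add: weyl_poly_add weyl_poly_mult assms)
  have "Q (Abs_weyl F)" if "F \<in> diff_ops" for F
    using that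
  proof (induction rule: diff_ops.induct)
    case (mult p)
    show ?case using poly[of p] by (simp add: weyl_poly_def)
  next
    case (deriv i)
    show ?case using assms(3) by (simp add: weyl_deriv_def)
  next
    case (add F G)
    then have "Abs_weyl (\<lambda>q. F q + G q) = Abs_weyl F + Abs_weyl G"
      by (simp add: plus_weyl_def Abs_weyl_inverse)
    with add assms(4) show ?case by simp
  next
    case (comp F G)
    then have "Abs_weyl (\<lambda>q. F (G q)) = Abs_weyl F * Abs_weyl G"
      by (simp add: times_weyl_def Abs_weyl_inverse)
    with comp assms(5) show ?case by simp
  qed
  from this[OF weyl_op[of P]] show ?thesis by (simp add: weyl_op_inverse)
qed

lemma wconst_central: "wconst c * P = P * wconst c"
proof (induction P rule: weyl_induct)
  case (mult P R)
  then show ?case by (metis mult.assoc)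
qed (simp_all add: weyl_poly_commute weyl_deriv_const distrib_left distrib_right)

lemma wconst_of_nat: "wconst (of_nat k) = of_nat k"
  by (induction k) (simp_all add: mconst_add weyl_poly_add)

section \<open>The universal property of the Weyl algebra\<close>

text \<open>A ring \<open>'e\<close> with elements that satisfy the relations of the Weyl algebra; the ring homomorphism
  \<open>c\<close> makes it a complex algebra as far as the generators are concerned.\<close>

locale weyl_rep =
  fixes c :: "complex \<Rightarrow> 'e::ring_1" and X D :: "'v::finite \<Rightarrow> 'e"
  assumes c_add: "c (a + b) = c a + c b" and c_mult: "c (a * b) = c a * c b" and c_1: "c 1 = 1"
    and c_X: "X i * c a = c a * X i" and c_D: "D i * c a = c a * D i"
    and X_X: "X i * X j = X j * X i" and D_D: "D i * D j = D j * D i"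
    and D_X: "D i * X j = X j * D i + (if i = j then 1 else 0)"
begin

lemma c_0 [simp]: "c 0 = 0"
  using c_add[of 0 0] by simp

lemma c_of_nat: "c (of_nat k) = of_nat k"
  by (induction k) (simp_all add: c_add c_1)

text \<open>On a word of length \<open>k\<close> in the \<open>X\<^sub>v\<close> and \<open>D\<^sub>v\<close> this gives \<open>k\<close> times the word, up to shorter words:
  the commutator with \<open>D\<^sub>v\<close> deletes the letters \<open>X\<^sub>v\<close> one at a time, the one with \<open>- X\<^sub>v\<close> the letters
  \<open>D\<^sub>v\<close>, and the deleted letter is put back on the right.\<close>

definition euler :: "'e \<Rightarrow> 'e"
  where "euler A = (\<Sum>v\<in>UNIV. (D v * A - A * D v) * X v - (X v * A - A * X v) * D v)"

lemma D_X_left: "D i * (X j * A) = X j * (D i * A) + (if i = j then A else 0)"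
  by (simp add: D_X distrib_right flip: mult.assoc)

lemma X_X_left: "X i * (X j * A) = X j * (X i * A)"
  by (metis X_X mult.assoc)

lemma D_D_left: "D i * (D j * A) = D j * (D i * A)"
  by (metis D_D mult.assoc)

lemma euler_X: "euler (X w * A) = X w * euler A + A * X w"
proof -
  have "(D v * (X w * A) - X w * A * D v) * X v - (X v * (X w * A) - X w * A * X v) * D v =
      X w * ((D v * A - A * D v) * X v - (X v * A - A * X v) * D v) + (if v = w then A * X v else 0)" for v
    unfolding D_X_left X_X_left[of v w] by (simp add: algebra_simps)
  then show ?thesis by (simp add: euler_def sum.distrib sum_distrib_left)
qed

lemma euler_D: "euler (D w * A) = D w * euler A + A * D w"
proof -
  have "(D v * (D w * A) - D w * A * D v) * X v - (X v * (D w * A) - D w * A * X v) * D v =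
      D w * ((D v * A - A * D v) * X v - (X v * A - A * X v) * D v) + (if v = w then A * D v else 0)" for v
    unfolding D_D_left[of v w] by (auto simp: algebra_simps D_X_left)
  then show ?thesis by (simp add: euler_def sum.distrib sum_distrib_left)
qed

lemma euler_add: "euler (A + B) = euler A + euler B"
  by (simp add: euler_def algebra_simps sum.distrib sum_subtractf)

lemma euler_0 [simp]: "euler 0 = 0"
  by (simp add: euler_def)

lemma euler_c [simp]: "euler (c a) = 0"
  by (simp add: euler_def c_X c_D)

lemma euler_eq_0: "(\<And>v. X v * A = A * X v) \<Longrightarrow> (\<And>v. D v * A = A * D v) \<Longrightarrow> euler A = 0"
  by (simp add: euler_def)

end

text \<open>The Weyl algebra represents itself, so the rules for \<open>euler\<close> are available on both sides of a
  relation between its elements and those of \<open>'e\<close>.\<close>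

interpretation weyl: weyl_rep wconst wvar weyl_deriv
  by unfold_locales
    (simp_all add: mconst_add weyl_poly_add mconst_mult weyl_poly_mult weyl_poly_commute
      weyl_deriv_const weyl_deriv_commute weyl_deriv_var)

context weyl_rep
begin

text \<open>Some expression of \<open>P\<close> as a sum of words of length less than \<open>k\<close> turns into \<open>A\<close> when the generators
  of the Weyl algebra are replaced by those of \<open>'e\<close>.  That \<open>A\<close> depends on \<open>P\<close> only is the content of
  the universal property.  The bound on the length is strict so that level \<open>0\<close> contains nothing but
  zero, and commutators with generators lower the level even for constants.\<close>

inductive lifts :: "nat \<Rightarrow> 'v weyl \<Rightarrow> 'e \<Rightarrow> bool"
  where
    zero: "lifts 0 0 0"
  | const: "lifts (Suc 0) (wconst a) (c a)"
  | var: "lifts k P A \<Longrightarrow> lifts (Suc k) (wvar i * P) (X i * A)"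
  | deriv: "lifts k P A \<Longrightarrow> lifts (Suc k) (weyl_deriv i * P) (D i * A)"
  | add: "lifts k P A \<Longrightarrow> lifts k Q B \<Longrightarrow> lifts k (P + Q) (A + B)"
  | mono: "lifts k P A \<Longrightarrow> lifts (Suc k) P A"

lemma lifts_0: "lifts k P A \<Longrightarrow> k = 0 \<Longrightarrow> P = 0 \<and> A = 0"
  by (induction rule: lifts.induct) auto

lemma lifts_1: "lifts k P A \<Longrightarrow> k = Suc 0 \<Longrightarrow> \<exists>a. P = wconst a \<and> A = c a"
proof (induction rule: lifts.induct)
  case (const a) show ?case by blast
next
  case (add k P A Q B) then show ?case by (metis c_add mconst_add weyl_poly_add)
qed (auto dest!: lifts_0 intro!: exI[of _ 0])

lemma lifts_scale: "lifts k P A \<Longrightarrow> lifts k (wconst a * P) (c a * A)"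
proof (induction rule: lifts.induct)
  case (const b)
  then show ?case using lifts.const[of "a * b"] by (simp add: c_mult mconst_mult weyl_poly_mult)
next
  case (var k P A i)
  then show ?case using lifts.var[of k "wconst a * P" "c a * A" i]
    by (metis c_X mult.assoc weyl_poly_commute)
next
  case (deriv k P A i)
  then show ?case using lifts.deriv[of k "wconst a * P" "c a * A" i]
    by (metis c_D mult.assoc weyl_deriv_const)
next
  case (add k P A Q B) then show ?case by (simp add: distrib_left lifts.add)
qed (simp_all add: lifts.intros)

lemma lifts_uminus: "lifts k P A \<Longrightarrow> lifts k (- P) (- A)"
  using lifts_scale[of k P A "-1"] c_add[of 1 "-1"]
  by (simp add: mconst_uminus weyl_poly_uminus c_1 add_eq_0_iff)

lemma lifts_diff: "lifts k P A \<Longrightarrow> lifts k Q B \<Longrightarrow> lifts k (P - Q) (A - B)"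
  using lifts.add[OF _ lifts_uminus] by fastforce

lemma lifts_zero: "lifts k 0 0"
  by (induction k) (auto intro: lifts.zero lifts.mono)

text \<open>In the inductions below the hypothesis concerns a commutator at level \<open>k - 1\<close>, and the letter
  put in front of it should lead back to level \<open>k\<close>.  The truncated subtraction spoils this for
  \<open>k = 0\<close>, where however the operator itself, and with it the commutator, is zero.\<close>

lemma lifts_varI:
  assumes "lifts (k - 1) P A" "lifts k Q B" "Q = 0 \<and> B = 0 \<Longrightarrow> P = 0 \<and> A = 0"
  shows "lifts k (wvar i * P) (X i * A)"
  using assms lifts.var[of "k - 1" P A i] lifts_0[of k Q B] by (cases "k = 0") (auto intro: lifts.zero)

lemma lifts_derivI:
  assumes "lifts (k - 1) P A" "lifts k Q B" "Q = 0 \<and> B = 0 \<Longrightarrow> P = 0 \<and> A = 0"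
  shows "lifts k (weyl_deriv i * P) (D i * A)"
  using assms lifts.deriv[of "k - 1" P A i] lifts_0[of k Q B] by (cases "k = 0") (auto intro: lifts.zero)

lemma lifts_monoI:
  assumes "lifts (k - 1) P A" "lifts k Q B" "Q = 0 \<and> B = 0 \<Longrightarrow> P = 0 \<and> A = 0"
  shows "lifts k P A"
  using assms lifts.mono[of "k - 1" P A] lifts_0[of k Q B] by (cases "k = 0") (auto intro: lifts.zero)

text \<open>By the Leibniz rule the commutator of a word with a generator is a sum of words with one letter
  deleted.\<close>

lemma lifts_comm_var:
  "lifts k P A \<Longrightarrow> lifts (k - 1) (wvar v * P - P * wvar v) (X v * A - A * X v)"
proof (induction rule: lifts.induct)
  case (const a) show ?case by (simp add: weyl_poly_commute c_X lifts.zero)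
next
  case (var k P A i)
  have "wvar v * (wvar i * P) - wvar i * P * wvar v = wvar i * (wvar v * P - P * wvar v)"
    by (simp add: right_diff_distrib weyl_poly_commute flip: mult.assoc)
  moreover have "X v * (X i * A) - X i * A * X v = X i * (X v * A - A * X v)"
    by (simp add: right_diff_distrib X_X flip: mult.assoc)
  moreover have "lifts k (wvar i * (wvar v * P - P * wvar v)) (X i * (X v * A - A * X v))"
    by (rule lifts_varI[OF var.IH var.hyps]) simp
  ultimately show ?case by simp
next
  case (deriv k P A i)
  have "wvar v * (weyl_deriv i * P) - weyl_deriv i * P * wvar v =
      weyl_deriv i * (wvar v * P - P * wvar v) + (if i = v then - P else 0)"
    by (simp add: right_diff_distrib weyl_deriv_var distrib_right flip: mult.assoc)
  moreover have "X v * (D i * A) - D i * A * X v = D i * (X v * A - A * X v) + (if i = v then - A else 0)"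
    by (simp add: right_diff_distrib D_X distrib_right flip: mult.assoc)
  moreover have "lifts k (weyl_deriv i * (wvar v * P - P * wvar v)) (D i * (X v * A - A * X v))"
    by (rule lifts_derivI[OF deriv.IH deriv.hyps]) simp
  ultimately show ?case using deriv.hyps lifts_zero by (auto intro!: lifts_diff)
next
  case (add k P A Q B)
  have "wvar v * (P + Q) - (P + Q) * wvar v = (wvar v * P - P * wvar v) + (wvar v * Q - Q * wvar v)"
    "X v * (A + B) - (A + B) * X v = (X v * A - A * X v) + (X v * B - B * X v)"
    by (simp_all add: algebra_simps)
  with add lifts.add show ?case by metis
next
  case (mono k P A)
  show ?case unfolding diff_Suc_1 by (rule lifts_monoI[OF mono.IH mono.hyps]) simp
qed (simp_all add: lifts.zero)

lemma lifts_comm_deriv: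
  "lifts k P A \<Longrightarrow> lifts (k - 1) (weyl_deriv v * P - P * weyl_deriv v) (D v * A - A * D v)"
proof (induction rule: lifts.induct)
  case (const a) show ?case by (simp add: weyl_deriv_const c_D lifts.zero)
next
  case (deriv k P A i)
  have "weyl_deriv v * (weyl_deriv i * P) - weyl_deriv i * P * weyl_deriv v =
      weyl_deriv i * (weyl_deriv v * P - P * weyl_deriv v)"
    by (simp add: right_diff_distrib weyl_deriv_commute flip: mult.assoc)
  moreover have "D v * (D i * A) - D i * A * D v = D i * (D v * A - A * D v)"
    by (simp add: right_diff_distrib D_D flip: mult.assoc)
  moreover have "lifts k (weyl_deriv i * (weyl_deriv v * P - P * weyl_deriv v)) (D i * (D v * A - A * D v))"
    by (rule lifts_derivI[OF deriv.IH deriv.hyps]) simp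
  ultimately show ?case by simp
next
  case (var k P A i)
  have "weyl_deriv v * (wvar i * P) - wvar i * P * weyl_deriv v =
      wvar i * (weyl_deriv v * P - P * weyl_deriv v) + (if v = i then P else 0)"
    by (simp add: right_diff_distrib weyl_deriv_var distrib_right flip: mult.assoc)
  moreover have "D v * (X i * A) - X i * A * D v = X i * (D v * A - A * D v) + (if v = i then A else 0)"
    by (simp add: right_diff_distrib D_X distrib_right flip: mult.assoc)
  moreover have "lifts k (wvar i * (weyl_deriv v * P - P * weyl_deriv v)) (X i * (D v * A - A * D v))"
    by (rule lifts_varI[OF var.IH var.hyps]) simp
  ultimately show ?case using var.hyps lifts_zero by (auto intro!: lifts.add)
next
  case (add k P A Q B)
  have "weyl_deriv v * (P + Q) - (P + Q) * weyl_deriv v =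
      (weyl_deriv v * P - P * weyl_deriv v) + (weyl_deriv v * Q - Q * weyl_deriv v)"
    "D v * (A + B) - (A + B) * D v = (D v * A - A * D v) + (D v * B - B * D v)"
    by (simp_all add: algebra_simps)
  with add lifts.add show ?case by metis
next
  case (mono k P A)
  show ?case unfolding diff_Suc_1 by (rule lifts_monoI[OF mono.IH mono.hyps]) simp
qed (simp_all add: lifts.zero)

lemma lifts_euler:
  "lifts k P A \<Longrightarrow> lifts (k - 1) (weyl.euler P - of_nat (k - 1) * P) (euler A - of_nat (k - 1) * A)"
proof (induction rule: lifts.induct)
  case (var k P A i)
  show ?case
  proof (cases k)
    case 0
    with lifts_0[OF var.hyps] show ?thesis by (simp add: lifts.zero)
  next
    case (Suc j)
    have *: "Y * E + B * Y - of_nat (Suc j) * (Y * B) = Y * (E - of_nat j * B) - (Y * B - B * Y)"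
      for Y E B :: "'z::ring_1"
      by (simp add: algebra_simps mult_of_nat_commute)
    show ?thesis
      unfolding euler_X weyl.euler_X Suc diff_Suc_1 *
      using lifts.var[OF var.IH, of i] lifts.mono[OF lifts_comm_var[OF var.hyps, of i]]
      by - (rule lifts_diff, simp_all only: Suc diff_Suc_1)
  qed
next
  case (deriv k P A i)
  show ?case
  proof (cases k)
    case 0
    with lifts_0[OF deriv.hyps] show ?thesis by (simp add: lifts.zero)
  next
    case (Suc j)
    have *: "Y * E + B * Y - of_nat (Suc j) * (Y * B) = Y * (E - of_nat j * B) - (Y * B - B * Y)"
      for Y E B :: "'z::ring_1"
      by (simp add: algebra_simps mult_of_nat_commute)
    show ?thesis
      unfolding euler_D weyl.euler_D Suc diff_Suc_1 *
      using lifts.deriv[OF deriv.IH, of i] lifts.mono[OF lifts_comm_deriv[OF deriv.hyps, of i]]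
      by - (rule lifts_diff, simp_all only: Suc diff_Suc_1)
  qed
next
  case (add k P A Q B)
  have *: "E + E' - n * (B + B') = (E - n * B) + (E' - n * B')" for n E E' B B' :: "'z::ring_1"
    by (simp add: algebra_simps)
  show ?case unfolding euler_add weyl.euler_add * using add.IH by (rule lifts.add)
next
  case (mono k P A)
  show ?case
  proof (cases k)
    case 0
    with lifts_0[OF mono.hyps] show ?thesis by (simp add: lifts.zero)
  next
    case (Suc j)
    have *: "E - of_nat (Suc j) * B = (E - of_nat j * B) - B" for E B :: "'z::ring_1"
      by (simp add: algebra_simps)
    show ?thesis
      unfolding Suc diff_Suc_1 *
      using lifts.mono[OF mono.IH] mono.hyps by - (rule lifts_diff, simp_all only: Suc diff_Suc_1)
  qed
qed (simp_all add: lifts.zero)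

text \<open>Replacing generators in an expression of zero yields zero.  By induction on the level the
  commutators of \<open>A\<close> with all generators vanish, since those of \<open>0\<close> do; so \<open>euler A = 0\<close>, and
  \<open>lifts_euler\<close> puts \<open>(k - 1) A\<close> one level lower.  In characteristic zero the factor can be removed.\<close>

lemma lifts_of_zero: "lifts k 0 A \<Longrightarrow> A = 0"
proof (induction k arbitrary: A rule: less_induct)
  case (less k)
  consider "k = 0" | "k = Suc 0" | j where "k = Suc (Suc j)"
    by (metis not0_implies_Suc)
  then show ?case
  proof cases
    case 1
    with lifts_0 less.prems show ?thesis by blast
  next
    case 2
    with lifts_1[OF less.prems] obtain a where "(0 :: 'v weyl) = wconst a" "A = c a" by blast
    then have "weyl_poly (mconst a) = weyl_poly (mconst 0 :: 'v cpoly)" by simp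
    with \<open>A = c a\<close> show ?thesis unfolding weyl_poly_eq_iff mconst_eq_iff by simp
  next
    case (3 j)
    have "X v * A - A * X v = 0" for v
      by (rule less.IH[of "k - 1"]) (use lifts_comm_var[OF less.prems, of v] 3 in simp_all)
    moreover have "D v * A - A * D v = 0" for v
      by (rule less.IH[of "k - 1"]) (use lifts_comm_deriv[OF less.prems, of v] 3 in simp_all)
    ultimately have "euler A = 0" by (intro euler_eq_0) simp_all
    with lifts_euler[OF less.prems] have "lifts (Suc j) 0 (- (of_nat (Suc j) * A))"
      using 3 by simp
    \<comment> \<open>This factor cancels the multiple of \<open>A\<close> that remains of \<open>euler A - (k - 1) A\<close>.\<close>
    from lifts_scale[OF this, of "- 1 / of_nat (Suc j)"]
    have "lifts (Suc j) 0 (c (- 1 / of_nat (Suc j)) * - (c (of_nat (Suc j)) * A))"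
      unfolding c_of_nat by simp
    moreover have "c (- 1 / of_nat (Suc j)) * - (c (of_nat (Suc j)) * A) =
        - (c (- 1 / of_nat (Suc j) * of_nat (Suc j)) * A)"
      by (simp only: c_mult mult.assoc mult_minus_right)
    moreover have "c (- 1 / of_nat (Suc j) * of_nat (Suc j)) = - 1"
      using c_add[of 1 "-1"] by (simp add: c_1 add_eq_0_iff del: of_nat_Suc)
    ultimately show ?thesis using less.IH[of "Suc j"] 3 by simp
  qed
qed

lemma lifts_unique: "lifts k P A \<Longrightarrow> lifts l P B \<Longrightarrow> A = B"
proof -
  have up: "lifts k P A \<Longrightarrow> lifts (k + l) P A" for k l P A
    by (induction l) (auto intro: lifts.mono)
  assume "lifts k P A" "lifts l P B"
  then have "lifts (k + l) (P - P) (A - B)"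
    using up[of k P A l] up[of l P B k] by (intro lifts_diff) (simp_all add: add.commute)
  with lifts_of_zero show ?thesis by fastforce
qed

lemma lifts_add: "lifts k P A \<Longrightarrow> lifts l Q B \<Longrightarrow> lifts (k + l) (P + Q) (A + B)"
proof -
  have up: "lifts k P A \<Longrightarrow> lifts (k + l) P A" for k l P A
    by (induction l) (auto intro: lifts.mono)
  assume "lifts k P A" "lifts l Q B"
  then show ?thesis
    using up[of k P A l] up[of l Q B k] by (intro lifts.add) (simp_all add: add.commute)
qed

lemma lifts_mult: "lifts k P A \<Longrightarrow> lifts l Q B \<Longrightarrow> \<exists>m. lifts m (P * Q) (A * B)"
proof (induction rule: lifts.induct)
  case zero
  then show ?case using lifts.zero by auto
next
  case (const a)
  then show ?case using lifts_scale by blast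
next
  case (var k P A i)
  then show ?case unfolding mult.assoc using lifts.var by blast
next
  case (deriv k P A i)
  then show ?case unfolding mult.assoc using lifts.deriv by blast
next
  case (add k P A Q B)
  then show ?case unfolding distrib_right using lifts_add by blast
qed

text \<open>The universal property of the Weyl algebra: every choice of elements that satisfy its relations
  extends to a homomorphism, although the elements of the algebra are given as endomorphisms and not
  by generators and relations.\<close>

theorem weyl_universal:
  obtains \<Phi> :: "'v weyl \<Rightarrow> 'e" where
    "\<And>P Q. \<Phi> (P + Q) = \<Phi> P + \<Phi> Q" "\<And>P Q. \<Phi> (P * Q) = \<Phi> P * \<Phi> Q"
    "\<And>a. \<Phi> (wconst a) = c a" "\<And>i. \<Phi> (wvar i) = X i" "\<And>i. \<Phi> (weyl_deriv i) = D i"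
proof -
  have c: "lifts (Suc 0) (wconst a) (c a)" for a by (rule lifts.const)
  have X: "lifts (Suc (Suc 0)) (wvar i) (X i)" for i using lifts.var[OF c[of 1], of i] by (simp add: c_1)
  have D: "lifts (Suc (Suc 0)) (weyl_deriv i) (D i)" for i using lifts.deriv[OF c[of 1], of i] by (simp add: c_1)
  have "\<exists>A k. lifts k P A" for P
  proof (induction P rule: weyl_induct)
    case (add P R) then show ?case using lifts_add by blast
  next
    case (mult P R) then show ?case using lifts_mult by blast
  qed (use c X D in blast)+
  then obtain \<Phi> where \<Phi>: "\<And>P. \<exists>k. lifts k P (\<Phi> P)" by metis
  then have eq: "\<Phi> P = A" if "lifts k P A" for k P A using that lifts_unique by blast
  show thesis
  proof (rule that[of \<Phi>])
    show "\<Phi> (P + Q) = \<Phi> P + \<Phi> Q" for P Q using \<Phi>[of P] \<Phi>[of Q] lifts_add eq by metis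
    show "\<Phi> (P * Q) = \<Phi> P * \<Phi> Q" for P Q using \<Phi>[of P] \<Phi>[of Q] lifts_mult eq by metis
  qed (use eq c X D in blast)+
qed

end

section \<open>The action on N\<close>

lemma mderiv_1 [simp]: "mderiv i 1 = 0"
  by (metis mconst_1 mderiv_mconst)

lemma fract_deriv_to_fract [simp]: "fract_deriv i (to_fract p) = to_fract (mderiv i p)"
proof -
  show ?thesis by (simp add: to_fract_def fract_deriv_Fract)
qed

lemma fract_deriv_0 [simp]: "fract_deriv i 0 = 0"
  using fract_deriv_to_fract[of i 0] by simp

lemma fract_deriv_add: "fract_deriv i (p + q) = fract_deriv i p + fract_deriv i q"
proof (cases p, cases q)
  fix a b c d assume "p = Fract a b" "b \<noteq> 0" "q = Fract c d" "d \<noteq> 0"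
  then show ?thesis
    by (simp add: fract_deriv_Fract eq_fract mderiv_add mderiv_mult power2_eq_square) (simp add: algebra_simps)
qed

lemma fract_deriv_mult: "fract_deriv i (p * q) = fract_deriv i p * q + p * fract_deriv i q"
proof (cases p, cases q)
  fix a b c d assume "p = Fract a b" "b \<noteq> 0" "q = Fract c d" "d \<noteq> 0"
  then show ?thesis
    by (simp add: fract_deriv_Fract eq_fract mderiv_add mderiv_mult power2_eq_square) (simp add: algebra_simps)
qed

lemma fract_deriv_1 [simp]: "fract_deriv i 1 = 0"
  using fract_deriv_to_fract[of i 1] by simp

lemma fract_deriv_uminus: "fract_deriv i (- p) = - fract_deriv i p"
  using fract_deriv_add[of i p "- p"] by (simp add: add_eq_0_iff)

lemma fract_deriv_of_int [simp]: "fract_deriv i (of_int c) = 0"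
proof -
  have "fract_deriv i (of_nat n) = 0" for n
    by (induction n) (simp_all add: fract_deriv_add)
  then show ?thesis by (cases c rule: int_diff_cases) (simp add: fract_deriv_add fract_deriv_uminus diff_conv_add_uminus del: add_uminus_conv_diff)
qed

lemma fract_deriv_divide:
  assumes "q \<noteq> 0"
  shows "fract_deriv i (p / q) = (fract_deriv i p * q - p * fract_deriv i q) / q\<^sup>2"
proof -
  have "fract_deriv i (p / q * q) = fract_deriv i (p / q) * q + p / q * fract_deriv i q"
    by (rule fract_deriv_mult)
  with assms show ?thesis by (simp add: field_simps power2_eq_square)
qed

text \<open>The two sides agree on polynomials; applied to the numerator \<open>a = p b\<close>, all terms except those with
  both derivatives on \<open>p\<close> cancel.\<close>

lemma fract_deriv_commute: "fract_deriv i (fract_deriv j p) = fract_deriv j (fract_deriv i p)"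
proof (cases p)
  fix a b assume p: "p = Fract a b" "b \<noteq> 0"
  then have a: "to_fract a = p * to_fract b" by (simp add: Fract_conv_to_fract)
  have "fract_deriv i (fract_deriv j (to_fract a)) = fract_deriv j (fract_deriv i (to_fract a))"
    by (simp add: mderiv_mderiv)
  then have "fract_deriv i (fract_deriv j p) * to_fract b = fract_deriv j (fract_deriv i p) * to_fract b"
    unfolding a fract_deriv_mult fract_deriv_add
    by (simp add: mderiv_mderiv[of i j] algebra_simps)
  with p show ?thesis by simp
qed

definition sderiv :: "'n::linorder \<Rightarrow> ('n, 'r) smod \<Rightarrow> ('n, 'r) smod"
  where "sderiv i = Poly_Mapping.map (fract_deriv i)"

lemma lookup_sderiv [simp]: "Poly_Mapping.lookup (sderiv i h) m = fract_deriv i (Poly_Mapping.lookup h m)"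
  by (simp add: sderiv_def map.rep_eq when_def)

lemma sderiv_add: "sderiv i (h + h') = sderiv i h + sderiv i h'"
  by (rule poly_mapping_eqI) (simp add: lookup_add fract_deriv_add)

lemma sderiv_0 [simp]: "sderiv i 0 = 0"
  by (rule poly_mapping_eqI) simp

lemma sderiv_single: "sderiv i (Poly_Mapping.single m a) = Poly_Mapping.single m (fract_deriv i a)"
  by (rule poly_mapping_eqI) (simp add: lookup_single when_def)

lemma sderiv_mult: "sderiv i (p * q) = sderiv i p * q + p * sderiv i q"
proof (induction p rule: mpoly_induct)
  case (add p m a)
  have "sderiv i (Poly_Mapping.single m a * q) =
      sderiv i (Poly_Mapping.single m a) * q + Poly_Mapping.single m a * sderiv i q"
    by (induction q rule: mpoly_induct)
      (simp_all add: distrib_left sderiv_add sderiv_single mult_single fract_deriv_mult single_add)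
  with add show ?case by (simp add: sderiv_add distrib_right)
qed simp

lemma sderiv_mconst [simp]: "sderiv i (mconst c) = mconst (fract_deriv i c)"
  by (simp add: mconst_def sderiv_single)

lemma sderiv_mvar [simp]: "sderiv i (mvar k) = 0"
  by (simp add: mvar_def sderiv_single)

lemma sderiv_uminus: "sderiv i (- h) = - sderiv i h"
  using sderiv_add[of i h "- h"] by (simp add: add_eq_0_iff)

lemma sderiv_sum: "sderiv i (sum h S) = (\<Sum>k\<in>S. sderiv i (h k))"
  by (induction S rule: infinite_finite_induct) (simp_all add: sderiv_add)

lemma sderiv_commute: "sderiv i (sderiv j h) = sderiv j (sderiv i h)"
  by (rule poly_mapping_eqI) (simp add: fract_deriv_commute)

lemma s_shift_add: "s_shift j c (p + q) = s_shift j c p + s_shift j c q"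
  by (simp add: s_shift_def meval_add)

lemma s_shift_mult: "s_shift j c (p * q) = s_shift j c p * s_shift j c q"
  by (simp add: s_shift_def meval_mult)

lemma s_shift_mconst [simp]: "s_shift j c (mconst a) = mconst a"
  by (simp add: s_shift_def)

lemma s_shift_0_right [simp]: "s_shift j c 0 = 0"
  by (simp add: s_shift_def)

lemma s_shift_1_right [simp]: "s_shift j c 1 = 1"
  by (simp add: s_shift_def)

lemma s_shift_mvar: "s_shift j c (mvar k) = mvar k + (if k = j then of_int c else 0)"
  by (simp add: s_shift_def)

lemma s_shift_uminus: "s_shift j c (- h) = - s_shift j c h"
  using s_shift_add[of j c h "- h"] by (simp add: add_eq_0_iff)

lemma s_shift_of_int [simp]: "s_shift j c (of_int a) = of_int a"
proof -
  have "(of_int a :: ('b, 'a) smod) = mconst (of_int a)" by (simp add: mconst_def)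
  then show ?thesis by (metis s_shift_mconst)
qed

lemma s_shift_sum: "s_shift j c (sum h S) = (\<Sum>k\<in>S. s_shift j c (h k))"
  by (induction S rule: infinite_finite_induct) (simp_all add: s_shift_add)

lemma s_shift_commute: "s_shift j a (s_shift k b h) = s_shift k b (s_shift j a h)"
proof (induction h rule: mpoly_gen_induct)
  case (var i)
  then show ?case by (auto simp: s_shift_mvar s_shift_add)
qed (simp_all add: s_shift_add s_shift_mult)

lemma s_shift_shift: "s_shift j a (s_shift j b h) = s_shift j (a + b) h"
proof (induction h rule: mpoly_gen_induct)
  case (var i)
  then show ?case by (auto simp: s_shift_mvar s_shift_add)
qed (simp_all add: s_shift_add s_shift_mult)

lemma s_shift_0_left [simp]: "s_shift j 0 h = h"
  by (induction h rule: mpoly_gen_induct) (simp_all add: s_shift_mvar s_shift_add s_shift_mult)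

lemma sderiv_s_shift: "sderiv i (s_shift j c h) = s_shift j c (sderiv i h)"
proof (induction h rule: mpoly_gen_induct)
  case (var k)
  have "(of_int c :: ('b, 'a) smod) = mconst (of_int c)" by (simp add: mconst_def)
  then show ?case by (simp add: s_shift_mvar sderiv_add)
qed (simp_all add: s_shift_add s_shift_mult sderiv_add sderiv_mult)

text \<open>The additive endomorphisms of a commutative ring, as a ring to which the universal property applies.\<close>

typedef (overloaded) 'a endo = "{F :: 'a::comm_ring_1 \<Rightarrow> 'a. \<forall>x y. F (x + y) = F x + F y}"
  morphisms endo_apply Endo
  by (rule exI[of _ "\<lambda>x. x"]) simp

setup_lifting type_definition_endo

lemma endo_apply_add: "endo_apply F (x + y) = endo_apply F x + endo_apply F y"
  using endo_apply[of F] by simp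

lemma endo_eqI: "(\<And>x. endo_apply F x = endo_apply G x) \<Longrightarrow> F = G"
  by (simp add: fun_eq_iff flip: endo_apply_inject)

instantiation endo :: (comm_ring_1) ring_1
begin

lift_definition zero_endo :: "'a endo" is "\<lambda>x. 0" by simp
lift_definition one_endo :: "'a endo" is "\<lambda>x. x" by simp
lift_definition plus_endo :: "'a endo \<Rightarrow> 'a endo \<Rightarrow> 'a endo" is "\<lambda>F G x. F x + G x" by simp
lift_definition uminus_endo :: "'a endo \<Rightarrow> 'a endo" is "\<lambda>F x. - F x" by simp
lift_definition minus_endo :: "'a endo \<Rightarrow> 'a endo \<Rightarrow> 'a endo" is "\<lambda>F G x. F x - G x" by simp
lift_definition times_endo :: "'a endo \<Rightarrow> 'a endo \<Rightarrow> 'a endo" is "\<lambda>F G x. F (G x)" by simp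

instance
proof
  show "(0 :: 'a endo) \<noteq> 1"
    by transfer (metis one_neq_zero)
qed (transfer; simp add: algebra_simps fun_eq_iff)+

end

lemma polyX_add: "polyX (p + q) = polyX p + polyX q"
  by (simp add: polyX_def meval_add weyl_poly_add)

lemma polyX_mult: "polyX (p * q) = polyX p * polyX q"
  by (simp add: polyX_def meval_mult weyl_poly_mult)

lemma polyX_mconst [simp]: "polyX (mconst c) = wconst c"
  by (simp add: polyX_def)

lemma polyX_mvar [simp]: "polyX (mvar i) = wvar (Inl i)"
  by (simp add: polyX_def)

lemma to_fract_power: "to_fract (p ^ k) = to_fract p ^ k"
  by (induction k) simp_all

lemma localization_0: "0 \<in> localization f"
  unfolding localization_def by (rule CollectI, rule exI[of _ 0]) simp

lemma to_fract_in_localization: "to_fract p \<in> localization f"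
  unfolding localization_def by (rule CollectI, rule exI[of _ p], rule exI[of _ 0]) simp

context
  fixes f :: "'r::finite \<Rightarrow> 'n::{finite,linorder} cpoly"
  assumes f_nonzero: "\<And>i. f i \<noteq> 0"
begin

text \<open>The logarithmic derivative of the formal symbol \<open>\<Prod>\<^sub>k f\<^sub>k^s\<^sub>k\<close> with respect to \<open>x\<^sub>i\<close>.\<close>

definition dlog :: "'n \<Rightarrow> ('n, 'r) smod"
  where "dlog i = (\<Sum>k\<in>UNIV. mvar k * mconst (to_fract (mderiv i (f k)) / to_fract (f k)))"

text \<open>The formulas for the action make sense on all polynomials in \<open>s\<^sub>1, \<dots>, s\<^sub>r\<close> over the fraction field,
  where the relations are checked; \<open>N\<close> is a stable subset (\<open>N_mod_act\<close>).  The larger module also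
  contains \<open>1 / g\<close>, which is what \<open>I2_imp_dvd\<close> needs.\<close>

definition act_dx :: "'n \<Rightarrow> ('n, 'r) smod \<Rightarrow> ('n, 'r) smod"
  where "act_dx i h = sderiv i h + h * dlog i"

definition act_t :: "'r \<Rightarrow> ('n, 'r) smod \<Rightarrow> ('n, 'r) smod"
  where "act_t j h = s_shift j 1 h * mconst (to_fract (f j))"

definition act_dt :: "'r \<Rightarrow> ('n, 'r) smod \<Rightarrow> ('n, 'r) smod"
  where "act_dt j h = - (mvar j * s_shift j (- 1) h * mconst (inverse (to_fract (f j))))"

lemma f_inverse: "mconst (to_fract (f j)) * mconst (inverse (to_fract (f j))) = 1"
  using f_nonzero[of j] by (simp flip: mconst_mult)

lemma dlog_commute: "sderiv i (dlog j) = sderiv j (dlog i)"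
proof -
  have "fract_deriv i (to_fract (mderiv j (f k)) / to_fract (f k)) =
      fract_deriv j (to_fract (mderiv i (f k)) / to_fract (f k))" for k
    using f_nonzero[of k] by (simp add: fract_deriv_divide mderiv_mderiv[of i j] mult.commute)
  then show ?thesis by (simp add: dlog_def sderiv_sum sderiv_mult)
qed

lemma s_shift_dlog:
  "s_shift j c (dlog i) = dlog i + of_int c * mconst (to_fract (mderiv i (f j)) / to_fract (f j))"
proof -
  have "s_shift j c (mvar k * mconst (to_fract (mderiv i (f k)) / to_fract (f k))) =
    mvar k * mconst (to_fract (mderiv i (f k)) / to_fract (f k)) +
    (if k = j then of_int c * mconst (to_fract (mderiv i (f k)) / to_fract (f k)) else 0)" for k
    by (simp add: s_shift_mult s_shift_mvar distrib_right)
  then show ?thesis by (simp add: dlog_def s_shift_sum sum.distrib)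
qed

lemma act_dx_commute: "act_dx i (act_dx j h) = act_dx j (act_dx i h)"
  by (simp add: act_dx_def sderiv_add sderiv_mult sderiv_commute[of i j] dlog_commute[of i j] algebra_simps)

lemma act_t_commute: "act_t i (act_t j h) = act_t j (act_t i h)"
  by (simp add: act_t_def s_shift_mult s_shift_commute[of i 1 j] mult_ac)

lemma act_dt_commute: "act_dt i (act_dt j h) = act_dt j (act_dt i h)"
  by (cases "i = j")
    (simp_all add: act_dt_def s_shift_mult s_shift_uminus s_shift_mvar s_shift_commute[of i "-1" j] mult_ac)

lemma act_dx_t: "act_dx i (act_t j h) = act_t j (act_dx i h)"
proof -
  have e: "mconst (to_fract (mderiv i (f j))) =
      mconst (to_fract (mderiv i (f j)) / to_fract (f j)) * mconst (to_fract (f j))"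
    using f_nonzero[of j] by (simp flip: mconst_mult)
  show ?thesis
    by (simp add: act_dx_def act_t_def s_shift_add s_shift_mult sderiv_mult sderiv_s_shift s_shift_dlog
        algebra_simps) (simp only: e mult_ac)
qed

lemma act_dx_dt: "act_dx i (act_dt j h) = act_dt j (act_dx i h)"
proof -
  let ?w = "to_fract (mderiv i (f j)) / to_fract (f j)"
  have "fract_deriv i (inverse (to_fract (f j))) = - (?w * inverse (to_fract (f j)))"
    using fract_deriv_divide[of "to_fract (f j)" i 1] f_nonzero[of j]
    by (simp add: field_simps power2_eq_square)
  then have e: "sderiv i (mconst (inverse (to_fract (f j)))) = - (mconst ?w * mconst (inverse (to_fract (f j))))"
    by (simp flip: mconst_mult mconst_uminus)
  show ?thesis
    by (simp add: act_dx_def act_dt_def s_shift_add s_shift_mult sderiv_mult sderiv_uminus sderiv_s_shift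
        s_shift_dlog algebra_simps del: sderiv_mconst) (simp add: e mult_ac del: sderiv_mconst)
qed

lemma act_dt_t: "act_dt i (act_t j h) = act_t j (act_dt i h) + (if i = j then h else 0)"
proof (cases "i = j")
  case True
  show ?thesis using True
    by (simp add: f_inverse act_dt_def act_t_def s_shift_mult s_shift_uminus s_shift_mvar s_shift_shift algebra_simps)
next
  case False
  then show ?thesis
    by (simp add: act_dt_def act_t_def s_shift_mult s_shift_uminus s_shift_mvar s_shift_commute[of i "-1" j] mult_ac)
qed


lemma act_additive:
  "act_dx i (h + h') = act_dx i h + act_dx i h'" "act_t j (h + h') = act_t j h + act_t j h'"
  "act_dt j (h + h') = act_dt j h + act_dt j h'"
  by (simp_all add: act_dx_def act_t_def act_dt_def sderiv_add s_shift_add algebra_simps)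

lemma prod_f_nonzero: "to_fract (\<Prod>i\<in>UNIV. f i) \<noteq> 0"
  using f_nonzero by simp

lemma localization_add:
  assumes "a \<in> localization f" "b \<in> localization f"
  shows "a + b \<in> localization f"
proof -
  let ?F = "\<Prod>i\<in>UNIV. f i"
  obtain p k q l where "a = to_fract p / to_fract ?F ^ k" "b = to_fract q / to_fract ?F ^ l"
    using assms unfolding localization_def by blast
  then have "a + b = to_fract (p * ?F ^ l + q * ?F ^ k) / to_fract ?F ^ (k + l)"
    using prod_f_nonzero by (simp add: add_frac_eq power_add to_fract_power)
  then show ?thesis unfolding localization_def by blast
qed

lemma localization_mult:
  assumes "a \<in> localization f" "b \<in> localization f"
  shows "a * b \<in> localization f"
proof -
  let ?F = "\<Prod>i\<in>UNIV. f i"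
  obtain p k q l where "a = to_fract p / to_fract ?F ^ k" "b = to_fract q / to_fract ?F ^ l"
    using assms unfolding localization_def by blast
  then have "a * b = to_fract (p * q) / to_fract ?F ^ (k + l)"
    by (simp add: power_add)
  then show ?thesis unfolding localization_def by blast
qed

lemma localization_inverse: "inverse (to_fract (f j)) \<in> localization f"
proof -
  let ?G = "\<Prod>i\<in>UNIV - {j}. f i"
  have "(\<Prod>i\<in>UNIV. f i) = f j * ?G"
    by (rule prod.remove) simp_all
  moreover have "?G \<noteq> 0" using f_nonzero by simp
  ultimately have "inverse (to_fract (f j)) = to_fract ?G / to_fract (\<Prod>i\<in>UNIV. f i) ^ 1"
    by (simp add: divide_simps)
  then show ?thesis unfolding localization_def by blast
qed

lemma localization_deriv:
  assumes "a \<in> localization f"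
  shows "fract_deriv i a \<in> localization f"
proof -
  let ?F = "\<Prod>i\<in>UNIV. f i"
  obtain p k where "a = to_fract p / to_fract ?F ^ k"
    using assms unfolding localization_def by blast
  then have a: "a = to_fract p / to_fract (?F ^ k)" by (simp add: to_fract_power)
  have "to_fract ?F ^ (k * 2) = (to_fract (?F ^ k))\<^sup>2"
    by (simp add: to_fract_power power_mult)
  moreover have "to_fract (?F ^ k) \<noteq> 0"
    using prod_f_nonzero by (simp add: to_fract_power)
  ultimately have "fract_deriv i a = to_fract (mderiv i p * ?F ^ k - p * mderiv i (?F ^ k)) / to_fract ?F ^ (k * 2)"
    unfolding a by (simp only: fract_deriv_divide fract_deriv_to_fract to_fract_mult to_fract_diff not_False_eq_True)
  then show ?thesis unfolding localization_def by blast
qed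

lemma N_mod_add: "h \<in> N_mod f \<Longrightarrow> h' \<in> N_mod f \<Longrightarrow> h + h' \<in> N_mod f"
  by (simp add: N_mod_def lookup_add localization_add)

lemma N_mod_mconst: "a \<in> localization f \<Longrightarrow> mconst a \<in> N_mod f"
  by (simp add: N_mod_def mconst_def lookup_single when_def localization_0)

lemma N_mod_mvar: "mvar k \<in> N_mod f"
  using to_fract_in_localization[of 1 f]
  by (simp add: N_mod_def mvar_def lookup_single when_def localization_0)

lemma N_mod_0: "0 \<in> N_mod f"
  by (simp add: N_mod_def localization_0)

lemma N_mod_sum: "(\<And>k. k \<in> S \<Longrightarrow> h k \<in> N_mod f) \<Longrightarrow> sum h S \<in> N_mod f"
  by (induction S rule: infinite_finite_induct) (simp_all add: N_mod_add N_mod_0)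

lemma N_mod_mult:
  assumes "h \<in> N_mod f" "h' \<in> N_mod f"
  shows "h * h' \<in> N_mod f"
proof -
  have sum: "Sum_any a \<in> localization f" if "\<And>k. a k \<in> localization f" for a :: "'z \<Rightarrow> 'n cpoly fract"
  proof -
    have "sum a S \<in> localization f" for S
      using that by (induction S rule: infinite_finite_induct) (auto simp: localization_0 localization_add)
    then show ?thesis by (simp add: Sum_any.expand_set)
  qed
  show ?thesis
    using assms unfolding N_mod_def
    by (auto simp: lookup_mult when_def localization_0 intro!: sum localization_mult)
qed

lemma N_mod_power: "h \<in> N_mod f \<Longrightarrow> h ^ k \<in> N_mod f"
  using N_mod_mconst[OF to_fract_in_localization[of 1]] by (induction k) (simp_all add: N_mod_mult)

lemma N_mod_uminus: "h \<in> N_mod f \<Longrightarrow> - h \<in> N_mod f"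
  using N_mod_mult[OF N_mod_mconst[OF to_fract_in_localization[of "-1"]], of h]
  by (simp add: mconst_uminus)

lemma N_mod_s_shift:
  assumes "h \<in> N_mod f"
  shows "s_shift j c h \<in> N_mod f"
proof -
  have "(of_int c :: ('n, 'r) smod) \<in> N_mod f"
  proof (induction c)
    case (nonneg n)
    show ?case
      using N_mod_mconst[OF to_fract_in_localization[of 1]] N_mod_mconst[OF localization_0]
      by (induction n) (simp_all add: N_mod_add)
  next
    case (neg n)
    have "(of_nat n :: ('n, 'r) smod) \<in> N_mod f" for n
      using N_mod_mconst[OF to_fract_in_localization[of 1]] N_mod_mconst[OF localization_0]
      by (induction n) (simp_all add: N_mod_add)
    from N_mod_uminus[OF this[of "Suc n"]] show ?case by simp
  qed
  then have "(\<Prod>i\<in>S. (if i = j then mvar i + of_int c else mvar i) ^ e i) \<in> N_mod f" for S e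
    using N_mod_mconst[OF to_fract_in_localization[of 1]]
    by (induction S rule: infinite_finite_induct) (auto simp: N_mod_mult N_mod_power N_mod_add N_mod_mvar)
  with assms show ?thesis
    unfolding s_shift_def meval_def by (intro N_mod_sum N_mod_mult N_mod_mconst) (simp_all add: N_mod_def)
qed

lemma N_mod_act:
  assumes "h \<in> N_mod f"
  shows "act_dx i h \<in> N_mod f" "act_t j h \<in> N_mod f" "act_dt j h \<in> N_mod f"
proof -
  have "sderiv i h \<in> N_mod f"
    using assms by (simp add: N_mod_def localization_deriv)
  then show "act_dx i h \<in> N_mod f"
    unfolding act_dx_def dlog_def using assms
    by (auto intro!: N_mod_add N_mod_mult N_mod_sum N_mod_mvar N_mod_mconst localization_mult
        localization_inverse to_fract_in_localization simp: divide_inverse)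
  show "act_t j h \<in> N_mod f"
    unfolding act_t_def using assms
    by (intro N_mod_mult N_mod_s_shift N_mod_mconst to_fract_in_localization)
  show "act_dt j h \<in> N_mod f"
    unfolding act_dt_def using assms
    by (intro N_mod_uminus N_mod_mult N_mod_s_shift N_mod_mconst N_mod_mvar localization_inverse)
qed

text \<open>The operators \<open>act_dx\<close>, \<open>act_t\<close>, \<open>act_dt\<close> and the multiplications by \<open>x\<^sub>i\<close> satisfy the relations of the
  Weyl algebra, so the universal property turns them into an action.\<close>

lemma action_exists:
  obtains \<Phi> :: "('n, 'r) dy \<Rightarrow> ('n, 'r) smod \<Rightarrow> ('n, 'r) smod" where
    "\<And>P h h'. \<Phi> P (h + h') = \<Phi> P h + \<Phi> P h'"
    "\<And>P Q h. \<Phi> (P + Q) h = \<Phi> P h + \<Phi> Q h" "\<And>P Q h. \<Phi> (P * Q) h = \<Phi> P (\<Phi> Q h)"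
    "\<And>p h. \<Phi> (polyX p) h = mconst (to_fract p) * h" "\<And>i h. \<Phi> (dX i) h = act_dx i h"
    "\<And>j h. \<Phi> (tY j) h = act_t j h" "\<And>j h. \<Phi> (dT j) h = act_dt j h"
    "\<And>P h. h \<in> N_mod f \<Longrightarrow> \<Phi> P h \<in> N_mod f"
proof -
  define m :: "'n cpoly \<Rightarrow> ('n, 'r) smod endo" where "m = (\<lambda>p. Endo (\<lambda>h. mconst (to_fract p) * h))"
  define X where "X = case_sum (\<lambda>i. m (mvar i)) (\<lambda>j. Endo (act_t j))"
  define D where "D = case_sum (\<lambda>i. Endo (act_dx i)) (\<lambda>j. Endo (act_dt j))"
  have m: "endo_apply (m p) = (\<lambda>h. mconst (to_fract p) * h)" for p
    unfolding m_def by (subst Endo_inverse) (simp_all add: distrib_left)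
  have t: "endo_apply (Endo (act_t j)) = act_t j" for j
    by (subst Endo_inverse) (simp_all add: act_additive)
  have dx: "endo_apply (Endo (act_dx i)) = act_dx i" for i
    by (subst Endo_inverse) (simp_all add: act_additive)
  have dt: "endo_apply (Endo (act_dt j)) = act_dt j" for j
    by (subst Endo_inverse) (simp_all add: act_additive)
  have m_add: "m (p + q) = m p + m q" and m_mult: "m (p * q) = m p * m q" for p q
    by (rule endo_eqI; simp add: m plus_endo.rep_eq times_endo.rep_eq mconst_add mconst_mult distrib_right mult.assoc)+
  have m_t: "Endo (act_t j) * m p = m p * Endo (act_t j)" for j p
    by (rule endo_eqI) (simp add: m t times_endo.rep_eq act_t_def s_shift_mult mult_ac)
  have m_dt: "Endo (act_dt j) * m p = m p * Endo (act_dt j)" for j p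
    by (rule endo_eqI) (simp add: m dt times_endo.rep_eq act_dt_def s_shift_mult mult_ac)
  have m_dx: "Endo (act_dx i) * m p = m p * Endo (act_dx i) + m (mderiv i p)" for i p
    by (rule endo_eqI) (simp add: m dx times_endo.rep_eq plus_endo.rep_eq act_dx_def
        sderiv_mult algebra_simps)
  have m_0: "m 0 = 0" by (rule endo_eqI) (simp add: m zero_endo.rep_eq)
  have m_1: "m 1 = 1" by (rule endo_eqI) (simp add: m one_endo.rep_eq)
  have rep: "weyl_rep (\<lambda>a. m (mconst a)) X D"
  proof
    show "X i * m (mconst a) = m (mconst a) * X i" for i a
      by (cases i) (simp_all add: X_def m_t mult.commute flip: m_mult)
    show "D i * m (mconst a) = m (mconst a) * D i" for i a
      by (cases i) (simp_all add: D_def m_dt m_dx m_0)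
    have "Endo (act_t i) * Endo (act_t j) = Endo (act_t j) * Endo (act_t i)" for i j
      by (rule endo_eqI) (simp add: t times_endo.rep_eq act_t_commute[of i j])
    then show "X i * X j = X j * X i" for i j
      by (cases i; cases j) (simp_all add: X_def m_t mult.commute flip: m_mult)
    have "Endo (act_dt i) * Endo (act_dt j) = Endo (act_dt j) * Endo (act_dt i)" for i j
      by (rule endo_eqI) (simp add: dt times_endo.rep_eq act_dt_commute[of i j])
    moreover have "Endo (act_dx i) * Endo (act_dx j) = Endo (act_dx j) * Endo (act_dx i)" for i j
      by (rule endo_eqI) (simp add: dx times_endo.rep_eq act_dx_commute[of i j])
    moreover have "Endo (act_dx i) * Endo (act_dt j) = Endo (act_dt j) * Endo (act_dx i)" for i j
      by (rule endo_eqI) (simp add: dx dt times_endo.rep_eq act_dx_dt[of i j])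
    ultimately show "D i * D j = D j * D i" for i j
      by (cases i; cases j) (simp_all add: D_def)
    have "Endo (act_dx i) * Endo (act_t j) = Endo (act_t j) * Endo (act_dx i)" for i j
      by (rule endo_eqI) (simp add: dx t times_endo.rep_eq act_dx_t[of i j])
    moreover have "Endo (act_dt i) * Endo (act_t j) =
        Endo (act_t j) * Endo (act_dt i) + (if i = j then 1 else 0)" for i j
      by (rule endo_eqI) (simp add: dt t times_endo.rep_eq plus_endo.rep_eq one_endo.rep_eq zero_endo.rep_eq
          act_dt_t[of i j])
    ultimately show "D i * X j = X j * D i + (if i = j then 1 else 0)" for i j
      by (cases i; cases j) (simp_all add: D_def X_def m_dx m_dt mderiv_mvar m_0 m_1)
  qed (simp_all add: mconst_add mconst_mult m_add m_mult m_1)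
  obtain \<Psi> :: "('n, 'r) dy \<Rightarrow> ('n, 'r) smod endo" where
    \<Psi>: "\<And>P Q. \<Psi> (P + Q) = \<Psi> P + \<Psi> Q" "\<And>P Q. \<Psi> (P * Q) = \<Psi> P * \<Psi> Q"
    "\<And>a. \<Psi> (wconst a) = m (mconst a)" "\<And>i. \<Psi> (wvar i) = X i" "\<And>i. \<Psi> (weyl_deriv i) = D i"
    by (rule weyl_rep.weyl_universal[OF rep]) (rule that)
  have \<Psi>_polyX: "\<Psi> (polyX p) = m p" for p
    by (induction p rule: mpoly_gen_induct)
      (simp_all add: polyX_add polyX_mult \<Psi> m_add m_mult X_def)
  show thesis
  proof (rule that[of "\<lambda>P. endo_apply (\<Psi> P)"])
    show "endo_apply (\<Psi> P) h \<in> N_mod f" if "h \<in> N_mod f" for P h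
      using that
    proof (induction P arbitrary: h rule: weyl_induct)
      case (const c)
      then show ?case by (simp add: \<Psi> m N_mod_mult N_mod_mconst to_fract_in_localization)
    next
      case (var i)
      then show ?case
        by (cases i) (simp_all add: \<Psi> X_def m t N_mod_mult N_mod_mconst to_fract_in_localization N_mod_act)
    next
      case (deriv i)
      then show ?case by (cases i) (simp_all add: \<Psi> D_def dx dt N_mod_act)
    qed (simp_all add: \<Psi> plus_endo.rep_eq times_endo.rep_eq N_mod_add)
  qed (simp_all add: endo_apply_add \<Psi> \<Psi>_polyX m plus_endo.rep_eq times_endo.rep_eq dX_def tY_def dT_def
      X_def D_def dx dt t)
qed

lemma is_N_action_N_act: "is_N_action f (N_act f)"
proof -
  obtain \<Phi> :: "('n, 'r) dy \<Rightarrow> ('n, 'r) smod \<Rightarrow> ('n, 'r) smod" where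
    "\<And>P h h'. \<Phi> P (h + h') = \<Phi> P h + \<Phi> P h'"
    "\<And>P Q h. \<Phi> (P + Q) h = \<Phi> P h + \<Phi> Q h" "\<And>P Q h. \<Phi> (P * Q) h = \<Phi> P (\<Phi> Q h)"
    "\<And>p h. \<Phi> (polyX p) h = mconst (to_fract p) * h" "\<And>i h. \<Phi> (dX i) h = act_dx i h"
    "\<And>j h. \<Phi> (tY j) h = act_t j h" "\<And>j h. \<Phi> (dT j) h = act_dt j h"
    "\<And>P h. h \<in> N_mod f \<Longrightarrow> \<Phi> P h \<in> N_mod f"
    by (rule action_exists) (rule that)
  then have "is_N_action f \<Phi>"
    by (simp add: is_N_action_def act_dx_def act_t_def act_dt_def
        dlog_def sderiv_def)
  then show ?thesis unfolding N_act_def by (rule someI[of "is_N_action f"])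
qed

end

section \<open>Left ideals and commutation relations\<close>

lemma left_ideal_hull: "left_ideal (left_ideal hull S)"
  by (rule hull_in) (auto simp: left_ideal_def)

lemma left_idealD:
  assumes "left_ideal J"
  shows "0 \<in> J" "a \<in> J \<Longrightarrow> b \<in> J \<Longrightarrow> a + b \<in> J" "a \<in> J \<Longrightarrow> r * a \<in> J"
    "a \<in> J \<Longrightarrow> - a \<in> J" "a \<in> J \<Longrightarrow> b \<in> J \<Longrightarrow> a - b \<in> J"
proof -
  show *: "0 \<in> J" "a \<in> J \<Longrightarrow> b \<in> J \<Longrightarrow> a + b \<in> J" "a \<in> J \<Longrightarrow> r * a \<in> J" for a b r
    using assms by (auto simp: left_ideal_def)
  show **: "a \<in> J \<Longrightarrow> - a \<in> J" for a using *(3)[of a "- 1"] by simp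
  show "a \<in> J \<Longrightarrow> b \<in> J \<Longrightarrow> a - b \<in> J"
    using *(2)[of a "- b"] **[of b] by simp
qed

lemma polyX_0 [simp]: "polyX 0 = 0"
  by (simp add: polyX_def)

lemma polyX_1 [simp]: "polyX 1 = 1"
  by (simp add: polyX_def)

lemma polyX_uminus: "polyX (- p) = - polyX p"
  using polyX_add[of p "- p"] by (simp add: add_eq_0_iff)

lemma polyX_commute: "polyX p * polyX q = polyX q * polyX p"
  by (metis mult.commute polyX_mult)

lemma tY_polyX: "tY j * polyX p = polyX p * tY j"
  by (simp add: tY_def polyX_def weyl_poly_commute)

lemma tY_tY: "tY i * tY j = tY j * tY i"
  by (simp add: tY_def weyl_poly_commute)

lemma mderiv_Inl_meval:
  "mderiv (Inl i) (meval mconst (\<lambda>i. mvar (Inl i)) p) = meval mconst (\<lambda>i. mvar (Inl i)) (mderiv i p)"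
proof (induction p rule: mpoly_gen_induct)
  case (var k)
  then show ?case by (simp add: mderiv_mvar)
qed (simp_all add: mderiv_add mderiv_mult meval_add meval_mult)

lemma mderiv_Inr_meval: "mderiv (Inr j) (meval mconst (\<lambda>i. mvar (Inl i)) p) = 0"
  by (induction p rule: mpoly_gen_induct)
    (simp_all add: mderiv_add mderiv_mult meval_add meval_mult mderiv_mvar)

lemma dX_polyX: "dX i * polyX p = polyX p * dX i + polyX (mderiv i p)"
  by (simp add: dX_def polyX_def weyl_deriv_poly mderiv_Inl_meval)

lemma dT_polyX: "dT j * polyX p = polyX p * dT j"
  by (simp add: dT_def polyX_def weyl_deriv_poly mderiv_Inr_meval)

lemma dX_tY: "dX i * tY j = tY j * dX i"
  by (simp add: dX_def tY_def weyl_deriv_var)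

lemma dX_dT: "dX i * dT j = dT j * dX i"
  by (simp add: dX_def dT_def weyl_deriv_commute)

lemma dT_dT: "dT i * dT j = dT j * dT i"
  by (simp add: dT_def weyl_deriv_commute)

lemma dT_tY: "dT i * tY j = tY j * dT i + (if i = j then 1 else 0)"
  by (simp add: dT_def tY_def weyl_deriv_var)

lemma dy_induct [case_names polyX dX tY dT add mult]:
  assumes "\<And>p. Q (polyX p)" "\<And>i. Q (dX i)" "\<And>j. Q (tY j)" "\<And>j. Q (dT j)"
    and "\<And>P R. Q P \<Longrightarrow> Q R \<Longrightarrow> Q (P + R)" "\<And>P R. Q P \<Longrightarrow> Q R \<Longrightarrow> Q (P * R)"
  shows "Q (P :: ('n::finite, 'r) dy)"
proof (induction P rule: weyl_induct)
  case (const c)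
  show ?case using assms(1)[of "mconst c"] by simp
next
  case (var i)
  show ?case using assms(1)[of "mvar _"] assms(3) by (cases i) (simp_all add: tY_def)
next
  case (deriv i)
  show ?case using assms(2,4) by (cases i) (simp_all add: dX_def dT_def)
qed (use assms(5,6) in blast)+

lemma of_int_mult_cancel:
  assumes "of_int k * P = (0 :: 'v weyl)" "k \<noteq> 0"
  shows "P = 0"
proof -
  have "wconst (of_int k) = (of_int k :: 'v weyl)"
    by (cases k rule: int_diff_cases)
      (simp add: mconst_add mconst_uminus weyl_poly_add weyl_poly_uminus wconst_of_nat
        diff_conv_add_uminus del: add_uminus_conv_diff)
  then have "P = wconst (1 / of_int k) * (of_int k * P)"
    using assms(2) by (simp flip: mult.assoc weyl_poly_mult mconst_mult)
      (metis assms(2) mconst_1 mconst_mult mult_1 nonzero_eq_divide_eq of_int_eq_0_iff weyl_poly_1 weyl_poly_mult)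
  with assms(1) show ?thesis by simp
qed

section \<open>The annihilator of the generator of N\<close>

text \<open>The operators \<open>\<Sum>\<^sub>\<beta> a\<^sub>\<beta>(x) \<partial>\<^sub>t^\<beta>\<close> with \<open>|\<beta>| < k\<close>; they are the normal forms modulo \<^const>\<open>I_tilde\<close>.  The
  strict bound has the same purpose as in \<open>lifts\<close>.\<close>

inductive vertical :: "nat \<Rightarrow> ('n::finite, 'r) dy \<Rightarrow> bool"
  where
    zero: "vertical 0 0"
  | polyX: "vertical (Suc 0) (polyX a)"
  | dT: "vertical k Q \<Longrightarrow> vertical (Suc k) (dT j * Q)"
  | add: "vertical k Q \<Longrightarrow> vertical k R \<Longrightarrow> vertical k (Q + R)"
  | mono: "vertical k Q \<Longrightarrow> vertical (Suc k) Q"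

lemma vertical_0: "vertical k Q \<Longrightarrow> k = 0 \<Longrightarrow> Q = 0"
  by (induction rule: vertical.induct) auto

lemma vertical_1: "vertical k Q \<Longrightarrow> k = Suc 0 \<Longrightarrow> \<exists>a. Q = polyX a"
proof (induction rule: vertical.induct)
  case (add k P Q) then show ?case by (metis polyX_add)
qed (auto dest!: vertical_0 intro: exI[of _ 0])

lemma vertical_zero: "vertical k 0"
  by (induction k) (auto intro: vertical.zero vertical.mono)

lemma vertical_mono: "vertical k Q \<Longrightarrow> k \<le> l \<Longrightarrow> vertical l Q"
  by (induction l) (auto simp: le_Suc_eq intro: vertical.mono)

lemma vertical_polyX_commute: "vertical k Q \<Longrightarrow> Q * polyX a = polyX a * Q"
proof (induction rule: vertical.induct)
  case (dT k Q j)
  then show ?case by (metis dT_polyX mult.assoc)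
qed (simp_all add: polyX_commute algebra_simps)

lemma vertical_dT_commute: "vertical k Q \<Longrightarrow> Q * dT j = dT j * Q"
proof (induction rule: vertical.induct)
  case (dT k Q i)
  then show ?case by (metis dT_dT mult.assoc)
qed (simp_all add: dT_polyX algebra_simps)

lemma vertical_polyX_mult: "vertical k Q \<Longrightarrow> vertical k (polyX a * Q)"
proof (induction rule: vertical.induct)
  case (polyX b)
  then show ?case using vertical.polyX[of "a * b"] by (simp add: polyX_mult)
next
  case (dT k Q j)
  then show ?case using vertical.dT[of k "polyX a * Q" j] by (metis dT_polyX mult.assoc)
next
  case (add k Q R)
  then show ?case by (simp add: distrib_left vertical.add)
qed (simp_all add: vertical.intros)

lemma vertical_uminus: "vertical k Q \<Longrightarrow> vertical k (- Q)"
  using vertical_polyX_mult[of k Q "- 1"] by (simp add: polyX_uminus)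

lemma vertical_diff: "vertical k Q \<Longrightarrow> vertical k R \<Longrightarrow> vertical k (Q - R)"
  using vertical.add[OF _ vertical_uminus] by fastforce

lemma vertical_sum: "(\<And>i. i \<in> S \<Longrightarrow> vertical k (Q i)) \<Longrightarrow> vertical k (sum Q S)"
  by (induction S rule: infinite_finite_induct) (auto intro: vertical_zero vertical.add)

lemma vertical_dTI: "vertical (k - 1) P \<Longrightarrow> vertical k Q \<Longrightarrow> (Q = 0 \<Longrightarrow> P = 0) \<Longrightarrow> vertical k (dT j * P)"
  using vertical.dT[of "k - 1" P j] vertical_0[of k Q] by (cases "k = 0") (auto intro: vertical.zero)

lemma vertical_monoI: "vertical (k - 1) P \<Longrightarrow> vertical k Q \<Longrightarrow> (Q = 0 \<Longrightarrow> P = 0) \<Longrightarrow> vertical k P"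
  using vertical.mono[of "k - 1" P] vertical_0[of k Q] by (cases "k = 0") (auto intro: vertical.zero)

lemma vertical_comm_dX: "vertical k Q \<Longrightarrow> vertical k (dX i * Q - Q * dX i)"
proof (induction rule: vertical.induct)
  case (polyX a)
  show ?case by (simp add: dX_polyX vertical.polyX)
next
  case (dT k Q j)
  have "dX i * (dT j * Q) - dT j * Q * dX i = dT j * (dX i * Q - Q * dX i)"
    by (simp add: right_diff_distrib dX_dT flip: mult.assoc)
  with vertical.dT[OF dT.IH] show ?case by simp
next
  case (add k Q R)
  have "dX i * (Q + R) - (Q + R) * dX i = (dX i * Q - Q * dX i) + (dX i * R - R * dX i)"
    by (simp add: algebra_simps)
  with vertical.add[OF add.IH] show ?case by simp
qed (simp_all add: vertical.intros)

lemma dT_comm_tY: "dT i * Q * tY j - tY j * (dT i * Q) = dT i * (Q * tY j - tY j * Q) + (if i = j then Q else 0)"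
proof -
  have "dT i * (tY j * Q) = tY j * (dT i * Q) + (if i = j then Q else 0)"
    by (simp add: dT_tY distrib_right flip: mult.assoc)
  then show ?thesis by (simp add: right_diff_distrib mult.assoc)
qed

lemma vertical_comm_tY: "vertical k Q \<Longrightarrow> vertical (k - 1) (Q * tY j - tY j * Q)"
proof (induction rule: vertical.induct)
  case (polyX a)
  show ?case by (simp add: tY_polyX vertical.zero)
next
  case (dT k Q i)
  have "vertical k (dT i * (Q * tY j - tY j * Q))"
    by (rule vertical_dTI[OF dT.IH dT.hyps]) simp
  with dT.hyps show ?case unfolding dT_comm_tY by (auto intro!: vertical.add vertical_zero)
next
  case (add k Q R)
  have "(Q + R) * tY j - tY j * (Q + R) = (Q * tY j - tY j * Q) + (R * tY j - tY j * R)"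
    by (simp add: algebra_simps)
  with vertical.add[OF add.IH] show ?case by simp
next
  case (mono k Q)
  show ?case unfolding diff_Suc_1 by (rule vertical_monoI[OF mono.IH mono.hyps]) simp
qed (simp_all add: vertical.zero)

text \<open>The counterpart of \<open>euler\<close> for operators with constant coefficients in \<open>t\<close>: it multiplies
  \<open>\<partial>\<^sub>t^\<beta>\<close> by \<open>|\<beta>|\<close>.\<close>

definition t_euler :: "('n, 'r::finite) dy \<Rightarrow> ('n, 'r) dy"
  where "t_euler Q = (\<Sum>j\<in>UNIV. (Q * tY j - tY j * Q) * dT j)"

lemma vertical_euler: "vertical k Q \<Longrightarrow> vertical (k - 1) (t_euler Q - of_nat (k - 1) * Q)"
proof (induction rule: vertical.induct)
  case (polyX a)
  show ?case by (simp add: t_euler_def tY_polyX vertical.zero)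
next
  case (dT k Q i)
  have "(dT i * Q * tY j - tY j * (dT i * Q)) * dT j =
      dT i * ((Q * tY j - tY j * Q) * dT j) + (if i = j then dT i * Q else 0)" for j
    unfolding dT_comm_tY by (simp add: distrib_right vertical_dT_commute[OF dT.hyps] mult.assoc)
  then have E: "t_euler (dT i * Q) = dT i * t_euler Q + dT i * Q"
    by (simp add: t_euler_def sum.distrib sum_distrib_left)
  show ?case
  proof (cases k)
    case 0
    with vertical_0[OF dT.hyps] show ?thesis by (simp add: t_euler_def vertical.zero)
  next
    case (Suc l)
    have "t_euler (dT i * Q) - of_nat (Suc l) * (dT i * Q) = dT i * (t_euler Q - of_nat l * Q)"
      unfolding E by (simp add: algebra_simps mult_of_nat_commute)
    with vertical.dT[OF dT.IH, of i] show ?thesis by (simp add: Suc del: of_nat_Suc)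
  qed
next
  case (add k Q R)
  have "t_euler (Q + R) - of_nat (k - 1) * (Q + R) =
      (t_euler Q - of_nat (k - 1) * Q) + (t_euler R - of_nat (k - 1) * R)"
    by (simp add: t_euler_def algebra_simps sum.distrib sum_subtractf)
  with vertical.add[OF add.IH] show ?case by simp
next
  case (mono k Q)
  show ?case
  proof (cases k)
    case 0
    with vertical_0[OF mono.hyps] show ?thesis by (simp add: t_euler_def vertical.zero)
  next
    case (Suc l)
    have eq: "t_euler Q - of_nat (Suc l) * Q = (t_euler Q - of_nat l * Q) - Q"
      by (simp add: algebra_simps)
    show ?thesis
      using vertical_diff[OF vertical.mono[OF mono.IH] vertical_mono[OF mono.hyps]]
      unfolding Suc diff_Suc_1 eq by simp
  qed
qed (simp_all add: t_euler_def vertical.zero)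

lemma left_ideal_I_tilde: "left_ideal (I_tilde f)"
  by (simp add: I_tilde_def left_ideal_hull)

lemma I_tilde_generators:
  "tY i - polyX (f i) \<in> I_tilde f"
  "dX j + (\<Sum>i\<in>UNIV. polyX (mderiv j (f i)) * dT i) \<in> I_tilde f"
  unfolding I_tilde_def by (rule hull_inc; blast)+

text \<open>Modulo \<^const>\<open>I_tilde\<close> a rightmost \<open>t\<^sub>j\<close> may be replaced by \<open>f\<^sub>j\<close> and a rightmost \<open>\<partial>\<^sub>x\<^sub>i\<close> by
  \<open>- \<Sum>\<^sub>l (\<partial>\<^sub>x\<^sub>i f\<^sub>l) \<partial>\<^sub>t\<^sub>l\<close>.  A generator multiplied from the left to a normal form is first commuted to
  the right end, which produces only normal forms.\<close>

lemma vertical_mod_I_tilde: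
  fixes P :: "('n::finite, 'r::finite) dy"
  shows "\<exists>k Q. vertical k Q \<and> P - Q \<in> I_tilde f"
proof -
  note I = left_idealD[OF left_ideal_I_tilde[of f]]
  define red :: "('n, 'r) dy \<Rightarrow> bool" where "red = (\<lambda>P. \<exists>k Q. vertical k Q \<and> P - Q \<in> I_tilde f)"
  have red_add: "red (P + R)" if "red P" "red R" for P R
  proof -
    obtain k Q l S where "vertical k Q" "P - Q \<in> I_tilde f" "vertical l S" "R - S \<in> I_tilde f"
      using \<open>red P\<close> \<open>red R\<close> unfolding red_def by blast
    then have "vertical (max k l) Q" "vertical (max k l) S" "(P - Q) + (R - S) \<in> I_tilde f"
      by (auto intro: vertical_mono I)
    then have "vertical (max k l) (Q + S)" "(P - Q) + (R - S) \<in> I_tilde f"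
      by (auto intro: vertical.add)
    moreover have "(P - Q) + (R - S) = P + R - (Q + S)" by simp
    ultimately show ?thesis unfolding red_def by metis
  qed
  have redI: "red P" if "vertical k Q" "P - Q \<in> I_tilde f" for P k Q
    using that unfolding red_def by blast
  have "\<forall>S. red S \<longrightarrow> red (P * S)"
  proof (induction P rule: dy_induct)
    case (polyX p)
    have "red (polyX p * S)" if "vertical k Q" "S - Q \<in> I_tilde f" for k Q S
    proof (rule redI[OF vertical_polyX_mult[OF that(1)]])
      show "polyX p * S - polyX p * Q \<in> I_tilde f"
        using I(3)[OF that(2)] by (simp add: right_diff_distrib)
    qed
    then show ?case unfolding red_def by blast
  next
    case (dX i)
    have "red (dX i * S)" if Q: "vertical k Q" and S: "S - Q \<in> I_tilde f" for k Q S
    proof -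
      let ?R = "\<Sum>l\<in>UNIV. polyX (mderiv i (f l)) * (dT l * Q)"
      have R: "vertical (Suc k) ?R"
        by (intro vertical_sum vertical_polyX_mult vertical.dT Q)
      have "Q * (\<Sum>l\<in>UNIV. polyX (mderiv i (f l)) * dT l) = ?R"
        unfolding sum_distrib_left
        by (intro sum.cong refl) (metis vertical_polyX_commute[OF Q] vertical_dT_commute[OF Q] mult.assoc)
      then have "dX i * S - ((dX i * Q - Q * dX i) - ?R) =
          dX i * (S - Q) + Q * (dX i + (\<Sum>l\<in>UNIV. polyX (mderiv i (f l)) * dT l))"
        by (simp add: algebra_simps)
      also have "\<dots> \<in> I_tilde f" by (rule I(2)[OF I(3)[OF S] I(3)[OF I_tilde_generators(2)]])
      finally show ?thesis
        using redI vertical_diff[OF vertical.mono[OF vertical_comm_dX[OF Q]] R] by blast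
    qed
    then show ?case unfolding red_def by blast
  next
    case (tY j)
    have "red (tY j * S)" if Q: "vertical k Q" and S: "S - Q \<in> I_tilde f" for k Q S
    proof -
      have "tY j * S - (polyX (f j) * Q - (Q * tY j - tY j * Q)) =
          tY j * (S - Q) + Q * (tY j - polyX (f j))"
        by (simp add: algebra_simps vertical_polyX_commute[OF Q])
      also have "\<dots> \<in> I_tilde f" by (rule I(2)[OF I(3)[OF S] I(3)[OF I_tilde_generators(1)]])
      finally show ?thesis
        using redI vertical_diff[OF vertical_polyX_mult[OF Q] vertical_mono[OF vertical_comm_tY[OF Q]]]
        by (metis diff_le_self)
    qed
    then show ?case unfolding red_def by blast
  next
    case (dT j)
    have "red (dT j * S)" if "vertical k Q" "S - Q \<in> I_tilde f" for k Q S
    proof (rule redI[OF vertical.dT[OF that(1)]])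
      show "dT j * S - dT j * Q \<in> I_tilde f"
        using I(3)[OF that(2)] by (simp add: right_diff_distrib)
    qed
    then show ?case unfolding red_def by blast
  next
    case (add P R)
    then show ?case by (simp add: distrib_right red_add)
  next
    case (mult P R)
    then show ?case by (simp add: mult.assoc)
  qed
  moreover have "red 1"
    using redI[OF vertical.polyX[of 1], of 1] I(1) by simp
  ultimately show ?thesis unfolding red_def by (metis mult_1_right)
qed

abbreviation emb :: "'n::linorder cpoly \<Rightarrow> ('n, 'r) smod"
  where "emb p \<equiv> mconst (to_fract p)"

context
  fixes f :: "'r::finite \<Rightarrow> 'n::{finite,linorder} cpoly"
  assumes f_nonzero: "\<And>i. f i \<noteq> 0"
begin

lemma N_action: "is_N_action f (N_act f)"
  by (rule is_N_action_N_act) (rule f_nonzero)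

lemma emb_in_N_mod: "emb p \<in> N_mod f"
  using f_nonzero by (rule N_mod_mconst) (rule to_fract_in_localization)

lemma N_act_hom:
  assumes "h \<in> N_mod f"
  shows "N_act f P h \<in> N_mod f" "h' \<in> N_mod f \<Longrightarrow> N_act f P (h + h') = N_act f P h + N_act f P h'"
    "N_act f (P + Q) h = N_act f P h + N_act f Q h" "N_act f (P * Q) h = N_act f P (N_act f Q h)"
    "N_act f (polyX p) h = emb p * h"
  using N_action assms unfolding is_N_action_def by blast+

lemma N_act_0 [simp]: "N_act f P 0 = 0"
  using N_act_hom(2)[of 0 0 P] N_mod_0[of f] f_nonzero by simp

lemma N_act_zero [simp]: "h \<in> N_mod f \<Longrightarrow> N_act f 0 h = 0"
  using N_act_hom(3)[of h 0 0] by simp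

lemma N_act_diff: "h \<in> N_mod f \<Longrightarrow> N_act f (P - Q) h = N_act f P h - N_act f Q h"
  using N_act_hom(3)[of h "P - Q" Q] by simp

lemma N_act_sum: "h \<in> N_mod f \<Longrightarrow> N_act f (sum P S) h = (\<Sum>i\<in>S. N_act f (P i) h)"
  by (induction S rule: infinite_finite_induct) (simp_all add: N_act_hom)

lemma N_act_polyX_emb: "N_act f (polyX p) (emb q) = emb (p * q)"
  by (simp add: N_act_hom emb_in_N_mod mconst_mult)

lemma N_act_tY_emb: "N_act f (tY j) (emb p) = emb (p * f j)"
proof -
  have "N_act f (tY j) (emb p) = s_shift j 1 (emb p) * emb (f j)"
    using N_action emb_in_N_mod unfolding is_N_action_def by blast
  then show ?thesis by (simp add: mconst_mult)
qed

lemma I_tilde_annihilates: "P \<in> I_tilde f \<Longrightarrow> N_act f P (emb 1) = 0"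
proof -
  let ?J = "{P. N_act f P (emb 1) = 0}"
  have "left_ideal ?J"
    unfolding left_ideal_def using emb_in_N_mod by (auto simp: N_act_hom simp del: to_fract_1 mconst_1)
  moreover have "N_act f (tY i - polyX (f i)) (emb 1) = 0" for i
    using N_act_tY_emb[of i 1] N_act_polyX_emb[of "f i" 1] emb_in_N_mod[of 1] by (simp add: N_act_diff)
  moreover have "N_act f (dX j + (\<Sum>i\<in>UNIV. polyX (mderiv j (f i)) * dT i)) (emb 1) = 0" for j
  proof -
    have "N_act f (dX j) (emb 1) = Poly_Mapping.map (fract_deriv j) (emb 1) +
        emb 1 * (\<Sum>k\<in>UNIV. mvar k * mconst (to_fract (mderiv j (f k)) / to_fract (f k)))"
      using N_action emb_in_N_mod[of 1] unfolding is_N_action_def by blast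
    also have "Poly_Mapping.map (fract_deriv j) (emb 1) = 0"
      using sderiv_mconst[of j 1] by (simp add: sderiv_def)
    finally have dx: "N_act f (dX j) (emb 1) =
        (\<Sum>k\<in>UNIV. mvar k * mconst (to_fract (mderiv j (f k)) / to_fract (f k)))" by simp
    have dt: "N_act f (dT i) (emb 1) = - (mvar i * s_shift i (- 1) (emb 1) * mconst (inverse (to_fract (f i))))" for i
      using N_action emb_in_N_mod[of 1] unfolding is_N_action_def by blast
    have "N_act f (polyX (mderiv j (f i)) * dT i) (emb 1) =
        - (mvar i * mconst (to_fract (mderiv j (f i)) / to_fract (f i)))" for i
    proof -
      have "N_act f (polyX (mderiv j (f i)) * dT i) (emb 1) = emb (mderiv j (f i)) * N_act f (dT i) (emb 1)"
        by (simp only: N_act_hom emb_in_N_mod)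
      then show ?thesis unfolding dt by (simp add: divide_inverse mconst_mult mult_ac)
    qed
    with dx show ?thesis
      using emb_in_N_mod[of 1] by (simp add: N_act_hom N_act_sum sum_negf)
  qed
  ultimately have "I_tilde f \<subseteq> ?J"
    unfolding I_tilde_def by (intro hull_minimal) auto
  then show "P \<in> I_tilde f \<Longrightarrow> N_act f P (emb 1) = 0" by blast
qed

text \<open>If \<open>Q\<close> kills \<open>u\<close>, then so does \<open>[Q, t\<^sub>j]\<close>, because \<open>Q t\<^sub>j u = Q f\<^sub>j u = f\<^sub>j Q u = 0\<close>.  By induction on
  the order these commutators are zero, so \<open>t_euler Q = 0\<close> and \<open>Q\<close> has lower order than assumed.  In
  order zero \<open>Q u = 0\<close> means that a polynomial vanishes.\<close>

lemma vertical_faithful: "vertical k Q \<Longrightarrow> N_act f Q (emb 1) = 0 \<Longrightarrow> Q = 0"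
proof (induction k arbitrary: Q rule: less_induct)
  case (less k)
  consider "k = 0" | "k = Suc 0" | l where "k = Suc (Suc l)"
    by (metis not0_implies_Suc)
  then show ?case
  proof cases
    case 1
    with vertical_0 less.prems show ?thesis by blast
  next
    case 2
    with vertical_1 less.prems obtain a where "Q = polyX a" by blast
    with less.prems N_act_polyX_emb[of a 1] have "(emb a :: ('n, 'r) smod) = mconst 0" by simp
    then have "a = 0" unfolding mconst_eq_iff by simp
    with \<open>Q = polyX a\<close> show ?thesis by simp
  next
    case (3 l)
    have "Q * tY j - tY j * Q = 0" for j
    proof (rule less.IH)
      show "vertical (k - 1) (Q * tY j - tY j * Q)" using vertical_comm_tY less.prems(1) .
      have "N_act f (Q * tY j) (emb 1) = N_act f (Q * polyX (f j)) (emb 1)"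
        using N_act_hom(4)[OF emb_in_N_mod[of 1]] N_act_tY_emb[of j 1] N_act_polyX_emb[of "f j" 1] by simp
      also have "\<dots> = N_act f (polyX (f j) * Q) (emb 1)"
        by (simp only: vertical_polyX_commute[OF less.prems(1)])
      finally show "N_act f (Q * tY j - tY j * Q) (emb 1) = 0"
        using N_act_hom(4)[OF emb_in_N_mod[of 1]] less.prems(2) N_act_diff[OF emb_in_N_mod[of 1]] by simp
    qed (simp add: 3)
    then have "t_euler Q = 0" by (simp add: t_euler_def)
    with vertical_euler[OF less.prems(1)] have "vertical (Suc l) (- (of_nat (Suc l) * Q))"
      by (simp add: 3)
    from vertical_polyX_mult[OF vertical_uminus[OF this], of "mconst (1 / of_nat (Suc l))"]
    have "vertical (Suc l) (wconst (1 / of_nat (Suc l)) * (wconst (of_nat (Suc l)) * Q))"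
      unfolding wconst_of_nat by simp
    moreover have "wconst (1 / of_nat (Suc l)) * wconst (of_nat (Suc l)) = (1 :: ('n, 'r) dy)"
      unfolding weyl_poly_mult[symmetric] mconst_mult[symmetric] by (simp del: of_nat_Suc)
    ultimately have "vertical (Suc l) Q" by (simp flip: mult.assoc)
    with less.IH[of "Suc l"] less.prems(2) 3 show ?thesis by simp
  qed
qed

text \<open>The generators of \<^const>\<open>I_tilde\<close> kill \<open>u\<close>, and no nonzero normal form does.\<close>

theorem I_tilde_iff_annihilates: "P \<in> I_tilde f \<longleftrightarrow> N_act f P (emb 1) = 0"
proof
  assume P: "N_act f P (emb 1) = 0"
  obtain k Q where Q: "vertical k Q" "P - Q \<in> I_tilde f" using vertical_mod_I_tilde by blast
  from I_tilde_annihilates[OF Q(2)] P have "N_act f Q (emb 1) = 0"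
    using N_act_diff[OF emb_in_N_mod[of 1]] by simp
  with vertical_faithful Q(1) have "Q = 0" by blast
  with Q(2) show "P \<in> I_tilde f" by simp
qed (rule I_tilde_annihilates)

end

section \<open>The grading\<close>

lemma \<sigma>_polyX: "\<sigma> * polyX p = (polyX p * \<sigma> :: ('n::finite, 'r::finite) dy)"
proof -
  have "dT j * tY j * polyX p = polyX p * (dT j * tY j)" for j :: 'r
    by (metis dT_polyX mult.assoc tY_polyX)
  then show ?thesis by (simp add: \<sigma>_def sum_distrib_left sum_distrib_right)
qed

lemma \<sigma>_dX: "\<sigma> * dX i = (dX i * \<sigma> :: ('n, 'r::finite) dy)"
proof -
  have "dT j * tY j * dX i = dX i * (dT j * tY j)" for j :: 'r
    by (metis dX_dT dX_tY mult.assoc)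
  then show ?thesis by (simp add: \<sigma>_def sum_distrib_left sum_distrib_right)
qed

lemma \<sigma>_tY: "\<sigma> * tY j - tY j * \<sigma> = (- tY j :: ('n, 'r::finite) dy)"
proof -
  have "dT i * tY i * tY j = (tY j * (dT i * tY i) + (if i = j then tY j else 0) :: ('n, 'r) dy)" for i
  proof -
    have "dT i * tY i * tY j = ((dT i * tY j) * tY i :: ('n, 'r) dy)" by (metis mult.assoc tY_tY)
    then show ?thesis unfolding dT_tY[of i j] by (cases "i = j") (simp_all add: distrib_right mult.assoc)
  qed
  then show ?thesis
    by (simp add: \<sigma>_def sum_distrib_left sum_distrib_right sum.distrib)
qed

lemma \<sigma>_dT: "\<sigma> * dT j - dT j * \<sigma> = (dT j :: ('n, 'r::finite) dy)"
proof -
  have "dT j * (dT i * tY i) = (dT i * tY i * dT j + (if i = j then dT j else 0) :: ('n, 'r) dy)" for i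
  proof -
    have "dT j * (dT i * tY i) = (dT i * (dT j * tY i) :: ('n, 'r) dy)" by (metis mult.assoc dT_dT)
    then show ?thesis unfolding dT_tY[of j i] by (cases "i = j") (simp_all add: distrib_left mult.assoc)
  qed
  then show ?thesis
    by (simp add: \<sigma>_def sum_distrib_left sum_distrib_right sum.distrib)
qed

text \<open>Up to sign and a constant, \<open>\<sigma>\<close> is the Euler operator \<open>\<Sum>\<^sub>j t\<^sub>j \<partial>\<^sub>t\<^sub>j\<close>, so its commutator measures the
  degree.\<close>

lemma graded_piece_commutator: "graded_piece m P \<Longrightarrow> \<sigma> * P - P * \<sigma> = of_int m * P"
proof (induction rule: graded_piece.induct)
  case (add m P Q)
  then show ?case by (simp add: algebra_simps)
next
  case (mult m P k Q)
  have "\<sigma> * (P * Q) - P * Q * \<sigma> = (\<sigma> * P - P * \<sigma>) * Q + P * (\<sigma> * Q - Q * \<sigma>)"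
    by (simp add: algebra_simps)
  also have "\<dots> = of_int (m + k) * (P * Q)"
  proof -
    have "P * (of_int k * Q) = of_int k * (P * Q)" by (metis mult.assoc mult_of_int_commute)
    then show ?thesis unfolding mult.IH by (simp add: distrib_right mult.assoc)
  qed
  finally show ?case .
qed (simp_all add: \<sigma>_polyX \<sigma>_dX \<sigma>_tY \<sigma>_dT)

lemma graded_piece_uminus: "graded_piece m P \<Longrightarrow> graded_piece m (- P)"
  using graded_piece.mult[OF graded_piece.poly[of "- 1"], of m P] by (simp add: polyX_uminus)

lemma graded_piece_diff: "graded_piece m P \<Longrightarrow> graded_piece m Q \<Longrightarrow> graded_piece m (P - Q)"
  using graded_piece.add[OF _ graded_piece_uminus] by fastforce

lemma graded_piece_sum: "(\<And>i. i \<in> S \<Longrightarrow> graded_piece m (P i)) \<Longrightarrow> graded_piece m (sum P S)"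
  by (induction S rule: infinite_finite_induct) (auto intro: graded_piece.zero graded_piece.add)

text \<open>Eigenvectors for distinct eigenvalues are independent: applying \<open>[\<sigma>, _] - k\<close> to a relation removes
  the term of degree \<open>k\<close> and multiplies the others by nonzero integers.\<close>

lemma eigen_independent:
  assumes "finite S" "\<And>m. m \<in> S \<Longrightarrow> \<sigma> * c m - c m * \<sigma> = of_int m * c m" "sum c S = 0" "m \<in> S"
  shows "c m = (0 :: ('n::finite, 'r::finite) dy)"
  using assms
proof (induction S arbitrary: c m rule: finite_induct)
  case (insert k S)
  have comm: "\<sigma> * c l - c l * \<sigma> = of_int l * c l" if "l \<in> insert k S" for l
    using insert.prems(1) that .
  have "(\<Sum>l\<in>insert k S. of_int (l - k) * c l) =
      \<sigma> * sum c (insert k S) - sum c (insert k S) * \<sigma> - of_int k * sum c (insert k S)"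
    unfolding sum_distrib_left sum_distrib_right sum_subtractf[symmetric]
    by (intro sum.cong refl) (simp add: comm left_diff_distrib)
  also have "\<dots> = 0" unfolding insert.prems(2) by simp
  finally have S: "(\<Sum>l\<in>S. of_int (l - k) * c l) = 0"
    using insert.hyps by simp
  have zero: "c l = 0" if "l \<in> S" for l
  proof -
    have "of_int (l - k) * c l = 0"
    proof (rule insert.IH[OF _ S that])
      fix m assume "m \<in> S"
      have "\<sigma> * (of_int (m - k) * c m) = of_int (m - k) * (\<sigma> * c m)"
        by (metis mult.assoc mult_of_int_commute)
      then have "\<sigma> * (of_int (m - k) * c m) - of_int (m - k) * c m * \<sigma> = of_int (m - k) * (\<sigma> * c m - c m * \<sigma>)"
        by (simp only: right_diff_distrib mult.assoc)
      also have "\<dots> = of_int m * (of_int (m - k) * c m)"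
        using comm[of m] \<open>m \<in> S\<close> by (simp only: insertI2 mult.assoc[symmetric] of_int_mult[symmetric] mult.commute)
      finally show "\<sigma> * (of_int (m - k) * c m) - of_int (m - k) * c m * \<sigma> = of_int m * (of_int (m - k) * c m)" .
    qed
    then show ?thesis using of_int_mult_cancel that insert.hyps by (metis right_minus_eq)
  qed
  moreover have "sum c S = 0" using zero by simp
  then have "c k = 0" using insert.prems(2) insert.hyps by simp
  ultimately show ?case using insert.prems(3) by auto
qed simp

text \<open>Sums of homogeneous elements form a subring, which contains the generators.\<close>

lemma graded_decomposition:
  fixes P :: "('n::finite, 'r::finite) dy"
  shows "\<exists>S c. finite S \<and> (\<forall>m. graded_piece m (c m)) \<and> P = sum c S"
proof -
  define G :: "('n, 'r) dy \<Rightarrow> bool"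
    where "G P \<longleftrightarrow> (\<exists>S c. finite S \<and> (\<forall>m. graded_piece m (c m)) \<and> P = sum c S)" for P
  have homog: "G P" if "graded_piece m P" for m P
    unfolding G_def
    by (rule exI[of _ "{m}"], rule exI[of _ "\<lambda>k. if k = m then P else 0"])
      (use that in \<open>auto intro: graded_piece.zero\<close>)
  have add: "G (P + Q)" if "G P" "G Q" for P Q
  proof -
    from that(1) obtain S c where 1: "finite S" "\<forall>m. graded_piece m (c m)" "P = sum c S"
      unfolding G_def by (elim exE conjE)
    from that(2) obtain T d where 2: "finite T" "\<forall>m. graded_piece m (d m)" "Q = sum d T"
      unfolding G_def by (elim exE conjE)
    let ?e = "\<lambda>m. (if m \<in> S then c m else 0) + (if m \<in> T then d m else 0)"
    have "(\<Sum>m\<in>S \<union> T. if m \<in> S then c m else 0) = P" "(\<Sum>m\<in>S \<union> T. if m \<in> T then d m else 0) = Q"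
      unfolding 1(3) 2(3) using 1(1) 2(1) by (intro sum.mono_neutral_cong_right; auto)+
    then have "P + Q = sum ?e (S \<union> T)"
      by (simp only: sum.distrib)
    moreover have "graded_piece m (?e m)" for m
      by (rule graded_piece.add) (use 1(2) 2(2) in \<open>simp_all add: graded_piece.zero\<close>)
    ultimately show ?thesis
      unfolding G_def using 1(1) 2(1) by (intro exI[of _ "S \<union> T"] exI[of _ ?e] conjI allI finite_UnI)
  qed
  have sum: "G (sum P A)" if "\<And>a. a \<in> A \<Longrightarrow> G (P a)" for P and A :: "int set"
    using that
  proof (induction A rule: infinite_finite_induct)
    case (insert a A)
    have "G (P a + sum P A)" by (rule add) (use insert in simp_all)
    with insert.hyps show ?case by simp
  qed (use homog[OF graded_piece.zero] in simp_all)
  have "G P"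
  proof (induction P rule: dy_induct)
    case (mult P Q)
    from mult(1) obtain S c where 1: "finite S" "\<forall>m. graded_piece m (c m)" "P = sum c S"
      unfolding G_def by (elim exE conjE)
    from mult(2) obtain T d where 2: "finite T" "\<forall>m. graded_piece m (d m)" "Q = sum d T"
      unfolding G_def by (elim exE conjE)
    have *: "P * Q = (\<Sum>a\<in>S. \<Sum>b\<in>T. c a * d b)"
      by (simp add: 1(3) 2(3) sum_product)
    show ?case
      unfolding * by (rule sum, rule sum) (rule homog[OF graded_piece.mult[OF 1(2)[rule_format] 2(2)[rule_format]]])
  qed (use homog[OF graded_piece.poly] homog[OF graded_piece.dX] homog[OF graded_piece.t]
      homog[OF graded_piece.dT] add in blast)+
  then show ?thesis unfolding G_def .
qed

definition hcomp :: "int \<Rightarrow> ('n::finite, 'r::finite) dy \<Rightarrow> ('n, 'r) dy"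
  where "hcomp m P = Poly_Mapping.lookup (graded_parts P) m"

lemma graded_parts_eq:
  fixes c :: "int \<Rightarrow>\<^sub>0 ('n::finite, 'r::finite) dy"
  assumes "\<And>m. graded_piece m (Poly_Mapping.lookup c m)"
    and "P = (\<Sum>m\<in>Poly_Mapping.keys c. Poly_Mapping.lookup c m)"
  shows "graded_parts P = c"
  unfolding graded_parts_def
proof (rule the_equality)
  fix d :: "int \<Rightarrow>\<^sub>0 ('n::finite, 'r::finite) dy"
  assume d: "(\<forall>m. graded_piece m (Poly_Mapping.lookup d m)) \<and>
    P = (\<Sum>m\<in>Poly_Mapping.keys d. Poly_Mapping.lookup d m)"
  let ?S = "Poly_Mapping.keys c \<union> Poly_Mapping.keys d"
  let ?e = "\<lambda>m. Poly_Mapping.lookup d m - Poly_Mapping.lookup c m"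
  have "(\<Sum>m\<in>Poly_Mapping.keys c. Poly_Mapping.lookup c m) = (\<Sum>m\<in>?S. Poly_Mapping.lookup c m)"
    by (rule sum.mono_neutral_left) (simp_all add: in_keys_iff)
  moreover have "(\<Sum>m\<in>Poly_Mapping.keys d. Poly_Mapping.lookup d m) = (\<Sum>m\<in>?S. Poly_Mapping.lookup d m)"
    by (rule sum.mono_neutral_left) (simp_all add: in_keys_iff)
  ultimately have "sum ?e ?S = 0"
    unfolding sum_subtractf using assms(2) d[THEN conjunct2] by (simp only: diff_self)
  moreover have "\<sigma> * ?e m - ?e m * \<sigma> = of_int m * ?e m" for m
    using assms(1) d by (intro graded_piece_commutator graded_piece_diff) auto
  ultimately have "?e m = 0" if "m \<in> ?S" for m
    using eigen_independent[of ?S ?e m] that by simp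
  then have "Poly_Mapping.lookup d m = Poly_Mapping.lookup c m" for m
    by (cases "m \<in> ?S") (auto simp: in_keys_iff)
  then show "d = c" by (rule poly_mapping_eqI)
qed (use assms in blast)

lemma hcomp_eqI:
  assumes "finite S" "\<And>m. graded_piece m (c m)" "P = sum c S"
  shows "hcomp m P = (if m \<in> S then c m else 0)"
proof -
  let ?d = "Abs_poly_mapping (\<lambda>m. if m \<in> S then c m else 0)"
  have look: "Poly_Mapping.lookup ?d m = (if m \<in> S then c m else 0)" for m
    using assms(1) by (subst lookup_Abs_poly_mapping) (auto elim: rev_finite_subset)
  have "sum c S = (\<Sum>m\<in>Poly_Mapping.keys ?d. Poly_Mapping.lookup ?d m)"
    using assms(1) by (intro sum.mono_neutral_cong_right) (auto simp: in_keys_iff look split: if_splits)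
  with assms have "graded_parts P = ?d"
    by (intro graded_parts_eq) (auto simp: look intro: graded_piece.zero)
  then show ?thesis by (simp add: hcomp_def look)
qed

lemma graded_piece_hcomp: "graded_piece m (hcomp m P)"
proof -
  obtain S c where *: "finite S" "\<And>m. graded_piece m (c m)" "P = sum c S"
    using graded_decomposition[of P] by auto
  then show ?thesis using hcomp_eqI[OF *] by (auto intro: graded_piece.zero)
qed

lemma finite_hcomp: "finite {m. hcomp m P \<noteq> 0}"
  unfolding hcomp_def by simp

lemma sum_hcomp: "P = (\<Sum>m | hcomp m P \<noteq> 0. hcomp m P)"
proof -
  obtain S c where *: "finite S" "\<And>m. graded_piece m (c m)" "P = sum c S"
    using graded_decomposition[of P] by auto
  have "sum c S = (\<Sum>m\<in>S. hcomp m P)"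
    using hcomp_eqI[OF *] by simp
  also have "\<dots> = (\<Sum>m | hcomp m P \<noteq> 0. hcomp m P)"
    using hcomp_eqI[OF *] *(1) by (intro sum.mono_neutral_right) auto
  finally show ?thesis using *(3) by simp
qed

lemma hcomp_homogeneous:
  assumes "graded_piece m P"
  shows "hcomp k P = (if k = m then P else 0)"
proof -
  have "graded_piece l (if l = m then P else 0)" for l
    using assms by (auto intro: graded_piece.zero)
  from hcomp_eqI[of "{m}", OF _ this] show ?thesis by auto
qed

lemma hcomp_0 [simp]: "hcomp m 0 = 0"
  using hcomp_homogeneous[OF graded_piece.zero[of m]] by auto

lemma hcomp_add: "hcomp m (P + Q) = hcomp m P + hcomp m Q"
proof -
  let ?S = "{m. hcomp m P \<noteq> 0} \<union> {m. hcomp m Q \<noteq> 0}"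
  have "P = (\<Sum>m\<in>?S. hcomp m P)" "Q = (\<Sum>m\<in>?S. hcomp m Q)"
    by (subst sum_hcomp, rule sum.mono_neutral_left; use finite_hcomp[of P] finite_hcomp[of Q] in auto)+
  then have "P + Q = (\<Sum>m\<in>?S. hcomp m P + hcomp m Q)"
    by (simp only: sum.distrib)
  then have "hcomp m (P + Q) = (if m \<in> ?S then hcomp m P + hcomp m Q else 0)"
    using finite_hcomp[of P] finite_hcomp[of Q]
    by (intro hcomp_eqI[of _ "\<lambda>m. hcomp m P + hcomp m Q"] graded_piece.add graded_piece_hcomp) auto
  then show ?thesis by auto
qed

lemma hcomp_uminus: "hcomp m (- P) = - hcomp m P"
  using hcomp_add[of m P "- P"] by (simp add: add_eq_0_iff)

lemma hcomp_diff: "hcomp m (P - Q) = hcomp m P - hcomp m Q"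
  using hcomp_add[of m P "- Q"] by (simp add: hcomp_uminus)

lemma hcomp_sum: "hcomp m (sum P S) = (\<Sum>i\<in>S. hcomp m (P i))"
  by (induction S rule: infinite_finite_induct) (simp_all add: hcomp_add)

lemma hcomp_mult_left:
  assumes "graded_piece k R"
  shows "hcomp m (R * P) = R * hcomp (m - k) P"
proof -
  have "R * P = (\<Sum>l\<in>{l. hcomp l P \<noteq> 0}. R * hcomp l P)"
    by (subst sum_hcomp[of P]) (simp add: sum_distrib_left)
  then have "hcomp m (R * P) = (\<Sum>l\<in>{l. hcomp l P \<noteq> 0}. hcomp m (R * hcomp l P))"
    by (simp only: hcomp_sum)
  also have "\<dots> = (\<Sum>l\<in>{l. hcomp l P \<noteq> 0}. if m - k = l then R * hcomp (m - k) P else 0)"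
    using hcomp_homogeneous[OF graded_piece.mult[OF assms graded_piece_hcomp]] by (intro sum.cong refl) auto
  also have "\<dots> = R * hcomp (m - k) P"
    using finite_hcomp[of P] by (simp add: sum.delta')
  finally show ?thesis .
qed

lemma hcomp_mult_right:
  assumes "graded_piece k R"
  shows "hcomp m (P * R) = hcomp (m - k) P * R"
proof -
  have "P * R = (\<Sum>l\<in>{l. hcomp l P \<noteq> 0}. hcomp l P * R)"
    by (subst sum_hcomp[of P]) (simp add: sum_distrib_right)
  then have "hcomp m (P * R) = (\<Sum>l\<in>{l. hcomp l P \<noteq> 0}. hcomp m (hcomp l P * R))"
    by (simp only: hcomp_sum)
  also have "\<dots> = (\<Sum>l\<in>{l. hcomp l P \<noteq> 0}. if m - k = l then hcomp (m - k) P * R else 0)"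
    using hcomp_homogeneous[OF graded_piece.mult[OF graded_piece_hcomp assms]] by (intro sum.cong refl) auto
  also have "\<dots> = hcomp (m - k) P * R"
    using finite_hcomp[of P] by (simp add: sum.delta')
  finally show ?thesis .
qed

section \<open>Initial ideals\<close>

lemma left_ideal_initial_ideal: "left_ideal (initial_ideal I)"
  by (simp add: initial_ideal_def left_ideal_hull)

lemma hcomp_in_initial_ideal:
  assumes "P \<in> I" "\<And>k. k > m \<Longrightarrow> hcomp k P = 0"
  shows "hcomp m P \<in> initial_ideal I"
proof (cases "hcomp m P = 0")
  case True
  then show ?thesis using left_idealD(1)[OF left_ideal_initial_ideal] by simp
next
  case False
  have "Max (Poly_Mapping.keys (graded_parts P)) = m"
    using assms(2) False unfolding hcomp_def
    by (intro Max_eqI) (auto simp: in_keys_iff not_less[symmetric])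
  then have "hcomp m P = initial_form P"
    by (simp add: initial_form_def hcomp_def Let_def)
  moreover have "P \<noteq> 0" using False by auto
  ultimately show ?thesis unfolding initial_ideal_def using assms(1) by (intro hull_inc) auto
qed

text \<open>Each homogeneous component of an element of the initial ideal is the leading component, or zero, of
  an element of \<open>I\<close>.  The elements \<open>Z\<close> with this property form a left ideal: sums are clear since
  the degree \<open>m\<close> is prescribed, and multiplication by a homogeneous \<open>R\<close> only shifts degrees.\<close>

lemma initial_ideal_lift:
  assumes I: "left_ideal I" and "Z \<in> initial_ideal I"
  shows "\<exists>P\<in>I. hcomp m P = hcomp m Z \<and> (\<forall>k>m. hcomp k P = 0)"
proof -
  note I = left_idealD[OF I]
  define good where "good Z m \<longleftrightarrow> (\<exists>P\<in>I. hcomp m P = hcomp m Z \<and> (\<forall>k>m. hcomp k P = 0))" for Z m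
  have goodI: "good Z m" if "P \<in> I" "hcomp m P = hcomp m Z" "\<And>k. k > m \<Longrightarrow> hcomp k P = 0" for Z m P
    using that unfolding good_def by (intro bexI[of _ P] conjI allI impI)
  have goodE: "\<exists>P. P \<in> I \<and> hcomp m P = hcomp m Z \<and> (\<forall>k>m. hcomp k P = 0)" if "good Z m" for Z m
    using that unfolding good_def Bex_def .
  let ?L = "{Z. \<forall>m. good Z m}"
  have add: "Z + W \<in> ?L" if ZW: "Z \<in> ?L" "W \<in> ?L" for Z W
  proof (intro CollectI allI)
    fix m
    from goodE[of Z m] ZW(1) obtain P where P: "P \<in> I" "hcomp m P = hcomp m Z" "\<forall>k>m. hcomp k P = 0" by auto
    from goodE[of W m] ZW(2) obtain Q where Q: "Q \<in> I" "hcomp m Q = hcomp m W" "\<forall>k>m. hcomp k Q = 0" by auto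
    show "good (Z + W) m"
      by (rule goodI[of "P + Q"]) (use P Q in \<open>simp_all add: hcomp_add I(2)\<close>)
  qed
  have homog: "R * Z \<in> ?L" if R: "graded_piece d R" and Z: "Z \<in> ?L" for d R Z
  proof (intro CollectI allI)
    fix m
    from goodE[of Z "m - d"] Z obtain P where
      P: "P \<in> I" "hcomp (m - d) P = hcomp (m - d) Z" "\<forall>k>m - d. hcomp k P = 0" by auto
    show "good (R * Z) m"
      by (rule goodI[of "R * P"]) (use P in \<open>simp_all add: hcomp_mult_left[OF R] I(3)\<close>)
  qed
  have zero: "0 \<in> ?L" by (intro CollectI allI goodI[OF I(1)]) simp_all
  have mult: "R * Z \<in> ?L" if "Z \<in> ?L" for R Z
  proof -
    have "R * Z = (\<Sum>m | hcomp m R \<noteq> 0. hcomp m R * Z)"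
      by (subst sum_hcomp[of R]) (simp add: sum_distrib_right)
    moreover have "(\<Sum>m\<in>S. hcomp m R * Z) \<in> ?L" for S
    proof (induction S rule: infinite_finite_induct)
      case (insert a S)
      have "hcomp a R * Z + (\<Sum>m\<in>S. hcomp m R * Z) \<in> ?L"
        using insert.IH by (rule add[OF homog[OF graded_piece_hcomp that]])
      then show ?case using insert.hyps by simp
    qed (use zero in simp_all)
    ultimately show ?thesis by (simp only:)
  qed
  have "left_ideal ?L"
    unfolding left_ideal_def by (intro conjI ballI allI zero add mult)
  moreover have "initial_form P \<in> ?L" if "P \<in> I" "P \<noteq> 0" for P
  proof -
    define m0 where "m0 = Max (Poly_Mapping.keys (graded_parts P))"
    have form: "initial_form P = hcomp m0 P"
      by (simp add: initial_form_def hcomp_def Let_def m0_def)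
    have top: "hcomp k P = 0" if "k > m0" for k
      using that unfolding m0_def hcomp_def by (metis Max_ge finite_keys in_keys_iff not_less)
    show ?thesis
    proof (intro CollectI allI)
      fix m
      show "good (initial_form P) m"
      proof (cases "m = m0")
        case True
        show ?thesis unfolding form
          by (rule goodI[OF that(1)]) (use True top hcomp_homogeneous[OF graded_piece_hcomp[of m0 P]] in simp_all)
      next
        case False
        show ?thesis unfolding form
          by (rule goodI[OF I(1)]) (use False hcomp_homogeneous[OF graded_piece_hcomp[of m0 P]] in simp_all)
      qed
    qed
  qed
  ultimately have "initial_ideal I \<subseteq> ?L"
    unfolding initial_ideal_def by (intro hull_minimal) auto
  with assms(2) have "good Z m" by blast
  then show ?thesis unfolding good_def .
qed

lemma initial_ideal_homogeneous_iff:
  assumes "left_ideal I" "graded_piece m Z"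
  shows "Z \<in> initial_ideal I \<longleftrightarrow> (\<exists>P\<in>I. hcomp m P = Z \<and> (\<forall>k>m. hcomp k P = 0))"
proof
  assume "Z \<in> initial_ideal I"
  from initial_ideal_lift[OF assms(1) this, of m]
  show "\<exists>P\<in>I. hcomp m P = Z \<and> (\<forall>k>m. hcomp k P = 0)"
    using hcomp_homogeneous[OF assms(2), of m] by simp
next
  assume "\<exists>P\<in>I. hcomp m P = Z \<and> (\<forall>k>m. hcomp k P = 0)"
  then obtain P where "P \<in> I" "hcomp m P = Z" "\<forall>k>m. hcomp k P = 0" by (elim bexE conjE)
  then show "Z \<in> initial_ideal I" using hcomp_in_initial_ideal[of P I m] by simp
qed

text \<open>For a leading form \<open>Z\<close> of degree \<open>m\<close> one has \<open>Z \<sigma> = (\<sigma> - m) Z\<close>.\<close>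

lemma initial_ideal_\<sigma>:
  assumes "Z \<in> initial_ideal I"
  shows "Z * \<sigma> \<in> initial_ideal I"
proof -
  note J = left_idealD[OF left_ideal_initial_ideal[of I]]
  let ?L = "{Z. Z * \<sigma> \<in> initial_ideal I}"
  have "left_ideal ?L" unfolding left_ideal_def by (auto simp: distrib_right mult.assoc J)
  moreover have "initial_form P \<in> ?L" if "P \<in> I" "P \<noteq> 0" for P
  proof -
    define m where "m = Max (Poly_Mapping.keys (graded_parts P))"
    have "graded_piece m (initial_form P)"
      using graded_piece_hcomp[of m P] by (simp add: initial_form_def hcomp_def Let_def m_def)
    from graded_piece_commutator[OF this]
    have "initial_form P * \<sigma> = \<sigma> * initial_form P - of_int m * initial_form P" by (simp add: algebra_simps)
    moreover have "initial_form P \<in> initial_ideal I"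
      unfolding initial_ideal_def using that by (intro hull_inc) auto
    ultimately show ?thesis by (simp add: J)
  qed
  ultimately have "initial_ideal I \<subseteq> ?L"
    unfolding initial_ideal_def[of I] by (intro hull_minimal) (auto simp: initial_ideal_def)
  with assms show ?thesis by blast
qed

section \<open>Elements of nonpositive degree\<close>

text \<open>The coefficients \<open>P\<^sub>j\<close> in the functional equation range over this subalgebra.  It turns out to be the
  whole degree \<open>0\<close> part of \<open>D\<^sub>Y\<close> (\<open>graded_piece_A0\<close> and \<open>graded_piece_nonpos\<close>).\<close>

definition A0 :: "('n::finite, 'r) dy set"
  where "A0 = subalgebra hull (DX \<union> {- (dT j * tY k) | j k. True})"

lemma subalgebra_hull: "subalgebra (subalgebra hull S)"
  by (rule hull_in) (auto simp: subalgebra_def)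

lemma A0_const: "wconst c \<in> A0"
  and A0_add: "P \<in> A0 \<Longrightarrow> Q \<in> A0 \<Longrightarrow> P + Q \<in> A0"
  and A0_mult: "P \<in> A0 \<Longrightarrow> Q \<in> A0 \<Longrightarrow> P * Q \<in> A0"
  using subalgebra_hull unfolding A0_def subalgebra_def by blast+

lemma A0_uminus: "P \<in> A0 \<Longrightarrow> - P \<in> A0"
  using A0_mult[OF A0_const[of "- 1"]] by (fastforce simp: mconst_uminus weyl_poly_uminus)

lemma A0_0: "0 \<in> A0"
  using A0_const[of 0] by simp

lemma DX_subset_A0: "DX \<subseteq> A0"
  unfolding A0_def by (rule subset_trans[OF _ hull_subset]) blast

lemma A0_polyX: "polyX p \<in> A0"
  by (rule subsetD[OF DX_subset_A0], unfold DX_def, rule hull_inc) simp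

lemma A0_dX: "dX i \<in> A0"
  by (rule subsetD[OF DX_subset_A0], unfold DX_def, rule hull_inc) simp

lemma A0_dT_tY: "dT j * tY k \<in> A0"
proof -
  have "- (dT j * tY k) \<in> A0" unfolding A0_def by (rule hull_inc) blast
  from A0_uminus[OF this] show ?thesis by simp
qed

lemma A0_sum: "(\<And>i. i \<in> S \<Longrightarrow> P i \<in> A0) \<Longrightarrow> sum P S \<in> A0"
  by (induction S rule: infinite_finite_induct) (auto simp: A0_0 A0_add)

lemma A0_tY_dT: "tY j * dT k \<in> A0"
proof -
  have "tY j * dT k = dT k * tY j + - (if k = j then 1 else 0)"
    by (simp add: dT_tY)
  moreover have "- (if k = j then 1 else 0) \<in> A0"
    using A0_const[of "- 1"] A0_0 by (auto simp: mconst_uminus weyl_poly_uminus)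
  ultimately show ?thesis using A0_add[OF A0_dT_tY] by metis
qed

lemma graded_piece_A0: "P \<in> A0 \<Longrightarrow> graded_piece 0 P"
proof -
  have sub: "subalgebra {P. graded_piece 0 P}"
    unfolding subalgebra_def
    using graded_piece.add[of 0] graded_piece.mult[of 0 _ 0] graded_piece.poly[of "mconst _"] by auto
  then have "(DX :: ('a, 'b) dy set) \<subseteq> {P. graded_piece 0 P}"
    unfolding DX_def by (intro hull_minimal) (auto intro: graded_piece.poly graded_piece.dX)
  moreover have "graded_piece 0 (- (dT j * tY k))" for j k
    using graded_piece_uminus[OF graded_piece.mult[OF graded_piece.dT graded_piece.t]] by fastforce
  ultimately have "(A0 :: ('a, 'b) dy set) \<subseteq> {P. graded_piece 0 P}"
    unfolding A0_def using sub by (intro hull_minimal) auto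
  then show "P \<in> A0 \<Longrightarrow> graded_piece 0 P" by blast
qed

text \<open>Sums of words of length \<open>k\<close> in the \<open>z\<^sub>j\<close>, with coefficients in \<^const>\<open>A0\<close> on the left.  It is used
  for \<open>z = tY\<close> and \<open>z = dT\<close>.\<close>

primrec A0_words :: "('r::finite \<Rightarrow> ('n::finite, 'r) dy) \<Rightarrow> nat \<Rightarrow> ('n, 'r) dy set"
  where
    "A0_words z 0 = A0"
  | "A0_words z (Suc k) = {\<Sum>j\<in>UNIV. R j * z j | R. \<forall>j. R j \<in> A0_words z k}"

lemma A0_words_0: "0 \<in> A0_words z k"
proof (induction k)
  case (Suc k)
  then show ?case by (auto intro!: exI[of _ "\<lambda>_. 0"])
qed (simp add: A0_0)

lemma A0_words_add: "P \<in> A0_words z k \<Longrightarrow> Q \<in> A0_words z k \<Longrightarrow> P + Q \<in> A0_words z k"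
proof (induction k arbitrary: P Q)
  case (Suc k)
  obtain R S where "P = (\<Sum>j\<in>UNIV. R j * z j)" "Q = (\<Sum>j\<in>UNIV. S j * z j)"
    "\<forall>j. R j \<in> A0_words z k" "\<forall>j. S j \<in> A0_words z k"
    using Suc.prems by auto
  then have "P + Q = (\<Sum>j\<in>UNIV. (R j + S j) * z j)" "\<forall>j. R j + S j \<in> A0_words z k"
    using Suc.IH by (auto simp: distrib_right sum.distrib)
  then show ?case by (auto intro!: exI[of _ "\<lambda>j. R j + S j"])
qed (simp add: A0_add)

lemma A0_words_sum: "(\<And>i. i \<in> S \<Longrightarrow> P i \<in> A0_words z k) \<Longrightarrow> sum P S \<in> A0_words z k"
  by (induction S rule: infinite_finite_induct) (auto simp: A0_words_0 A0_words_add)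

lemma A0_words_mult_A0:
  assumes "W \<in> A0" "\<And>j. z j * W = W * z j" "P \<in> A0_words z k"
  shows "P * W \<in> A0_words z k"
  using assms(3)
proof (induction k arbitrary: P)
  case (Suc k)
  then obtain R where R: "P = (\<Sum>j\<in>UNIV. R j * z j)" "\<forall>j. R j \<in> A0_words z k" by auto
  have "P * W = (\<Sum>j\<in>UNIV. R j * W * z j)"
    by (simp add: R(1) sum_distrib_right mult.assoc assms(2))
  with R(2) Suc.IH show ?case by (auto intro!: exI[of _ "\<lambda>j. R j * W"])
qed (simp add: A0_mult assms(1))

lemma A0_words_snoc:
  assumes "P \<in> A0_words z k"
  shows "P * z j \<in> A0_words z (Suc k)"
proof -
  have "P * z j = (\<Sum>i\<in>UNIV. (if i = j then P else 0) * z i)"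
    by (simp add: if_distrib[of "\<lambda>x. x * _"] cong: if_cong)
  moreover have "\<forall>i. (if i = j then P else 0) \<in> A0_words z k" using assms A0_words_0 by auto
  ultimately show ?thesis by auto
qed

text \<open>Here \<open>y\<close> is dual to \<open>z\<close>, so that \<open>z\<^sub>i y\<^sub>j\<close> has degree \<open>0\<close>.  A letter \<open>y\<^sub>j\<close> on the right moves through
  a word in the \<open>z\<^sub>i\<close>, losing one letter in each commutator, until it meets the first letter and the
  product falls into \<^const>\<open>A0\<close>.\<close>

lemma A0_words_cancel:
  assumes A0: "\<And>i. z i * y j \<in> A0"
    and comm: "\<And>i. z i * y j = y j * z i + (if i = j then wconst c else 0)"
    and "P \<in> A0_words z (Suc k)"
  shows "P * y j \<in> A0_words z k"
  using assms(3)
proof (induction k arbitrary: P)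
  case 0
  then obtain R where "P = (\<Sum>i\<in>UNIV. R i * z i)" "\<forall>i. R i \<in> A0" by auto
  then show ?case
    by (simp add: sum_distrib_right mult.assoc) (intro A0_sum A0_mult A0, simp)
next
  case (Suc k)
  then obtain R where R: "P = (\<Sum>i\<in>UNIV. R i * z i)" "\<And>i. R i \<in> A0_words z (Suc k)" by auto
  have const: "Q * wconst c \<in> A0_words z l" if "Q \<in> A0_words z l" for Q l
    using that by (intro A0_words_mult_A0 A0_const) (simp_all add: wconst_central)
  have "R i * z i * y j = R i * y j * z i + (if i = j then R i * wconst c else 0)" for i
    by (simp add: mult.assoc comm distrib_left)
  then have "P * y j = (\<Sum>i\<in>UNIV. R i * y j * z i + (if i = j then R i * wconst c else 0))"
    by (simp add: R(1) sum_distrib_right)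
  also have "\<dots> \<in> A0_words z (Suc k)"
    using A0_words_snoc[OF Suc.IH[OF R(2)]] const[OF R(2)] A0_words_0[of z "Suc k"]
    by (intro A0_words_sum A0_words_add) auto
  finally show ?case .
qed

definition A0_degree :: "int \<Rightarrow> ('n::finite, 'r::finite) dy set"
  where "A0_degree m = (if m \<le> 0 then A0_words tY (nat (- m)) else A0_words dT (nat m))"

lemma A0_degree_add: "P \<in> A0_degree m \<Longrightarrow> Q \<in> A0_degree m \<Longrightarrow> P + Q \<in> A0_degree m"
  by (cases "m \<le> 0") (simp_all add: A0_degree_def A0_words_add)

text \<open>Right multiplication by the generators respects the description of the homogeneous parts by words
  in the \<open>t\<^sub>j\<close> (negative degree) and in the \<open>\<partial>\<^sub>t\<^sub>j\<close> (positive degree).  Multiplying \<open>1\<close> by an arbitrary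
  homogeneous element then shows that this element has such a form.\<close>

lemma A0_degree_mult:
  fixes P :: "('n::finite, 'r::finite) dy"
  assumes "graded_piece k Q" "P \<in> A0_degree m"
  shows "P * Q \<in> A0_degree (m + k)"
  using assms
proof (induction arbitrary: P m rule: graded_piece.induct)
  case (poly p)
  then show ?case
    by (auto simp: A0_degree_def split: if_splits intro!: A0_words_mult_A0 A0_polyX tY_polyX dT_polyX)
next
  case (dX i)
  then show ?case
    by (auto simp: A0_degree_def split: if_splits intro!: A0_words_mult_A0 A0_dX dX_tY[symmetric] dX_dT[symmetric])
next
  case (t j)
  show ?case
  proof (cases "m \<le> 0")
    case True
    then have "nat (- (m + - 1)) = Suc (nat (- m))" by simp
    with t True A0_words_snoc[of P tY "nat (- m)" j] show ?thesis by (simp add: A0_degree_def)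
  next
    case False
    define l where "l = nat (m - 1)"
    with False have l: "m = 1 + int l" by simp
    have "P * tY j \<in> A0_words dT l"
    proof (rule A0_words_cancel[where c = 1])
      show "P \<in> A0_words dT (Suc l)" using t l by (simp add: A0_degree_def nat_add_distrib)
      show "dT i * tY j \<in> A0" for i by (rule A0_dT_tY)
    qed (simp add: dT_tY)
    moreover have "m + - 1 = int l" by (simp add: l)
    ultimately show ?thesis by (auto simp: A0_degree_def)
  qed
next
  case (dT j)
  show ?case
  proof (cases "m < 0")
    case False
    then have "nat (m + 1) = Suc (nat m)" by simp
    moreover have "P \<in> A0_words dT (nat m)" using dT False by (auto simp: A0_degree_def split: if_splits)
    ultimately show ?thesis using False A0_words_snoc[of P dT "nat m" j] by (simp add: A0_degree_def)
  next
    case True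
    define l where "l = nat (- m - 1)"
    with True have l: "m = - (1 + int l)" by simp
    have "P * dT j \<in> A0_words tY l"
    proof (rule A0_words_cancel[where c = "- 1"])
      show "P \<in> A0_words tY (Suc l)" using dT l by (simp add: A0_degree_def nat_add_distrib)
      show "tY i * dT j \<in> A0" for i by (rule A0_tY_dT)
    qed (auto simp: dT_tY mconst_uminus weyl_poly_uminus)
    moreover have "m + 1 = - int l" by (simp add: l)
    ultimately show ?thesis by (simp add: A0_degree_def)
  qed
next
  case (zero k)
  then show ?case by (simp add: A0_degree_def A0_words_0)
next
  case (add k Q R)
  then have "P * Q + P * R \<in> A0_degree (m + k)"
    by (intro A0_degree_add)
  then show ?case by (simp add: distrib_left)
next
  case (mult k Q l R)
  from mult.IH(2)[OF mult.IH(1)[OF mult.prems]] show ?case by (simp only: mult.assoc add.assoc)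
qed

lemma graded_piece_nonpos:
  assumes "graded_piece m Q" "m \<le> 0"
  shows "Q \<in> A0_words tY (nat (- m))"
proof -
  have "1 \<in> A0_degree 0" using A0_const[of 1] by (simp add: A0_degree_def)
  from A0_degree_mult[OF assms(1) this] assms(2) show ?thesis by (simp add: A0_degree_def)
qed

section \<open>Elimination of a central variable\<close>

text \<open>The variable is evaluated with all coefficients on the left.  For \<open>z\<close> that is not central, such as
  \<open>\<sigma>\<close>, this is only a homomorphism of left modules.\<close>

definition eval_cvar :: "'d::ring_1 \<Rightarrow> (nat \<Rightarrow>\<^sub>0 'd) \<Rightarrow> 'd"
  where "eval_cvar z F = (\<Sum>k\<in>Poly_Mapping.keys F. Poly_Mapping.lookup F k * z ^ k)"

lemma eval_cvar_superset:
  "finite S \<Longrightarrow> Poly_Mapping.keys F \<subseteq> S \<Longrightarrow> eval_cvar z F = (\<Sum>k\<in>S. Poly_Mapping.lookup F k * z ^ k)"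
  unfolding eval_cvar_def by (rule sum.mono_neutral_left) (auto simp: in_keys_iff)

lemma eval_cvar_0 [simp]: "eval_cvar z 0 = 0"
  by (simp add: eval_cvar_def)

lemma eval_cvar_add: "eval_cvar z (F + G) = eval_cvar z F + eval_cvar z G"
proof -
  let ?S = "Poly_Mapping.keys F \<union> Poly_Mapping.keys G"
  have "Poly_Mapping.keys (F + G) \<subseteq> ?S" by (rule Poly_Mapping.keys_add)
  then show ?thesis
    by (simp add: eval_cvar_superset[of ?S] lookup_add distrib_right sum.distrib)
qed

lemma eval_cvar_uminus: "eval_cvar z (- F) = - eval_cvar z F"
  using eval_cvar_add[of z F "- F"] by (simp add: add_eq_0_iff)

lemma eval_cvar_diff: "eval_cvar z (F - G) = eval_cvar z F - eval_cvar z G"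
  using eval_cvar_add[of z F "- G"] by (simp add: eval_cvar_uminus)

lemma eval_cvar_sum: "eval_cvar z (sum F S) = (\<Sum>k\<in>S. eval_cvar z (F k))"
  by (induction S rule: infinite_finite_induct) (simp_all add: eval_cvar_add)

lemma eval_cvar_single [simp]: "eval_cvar z (Poly_Mapping.single k r) = r * z ^ k"
  by (simp add: eval_cvar_superset[of "{k}"])

lemma eval_cvar_cconst [simp]: "eval_cvar z (cconst P) = P"
  by (simp add: cconst_def)

lemma eval_cvar_single_mult: "eval_cvar z (Poly_Mapping.single k r * F) = r * eval_cvar z F * z ^ k"
proof (induction F rule: mpoly_induct)
  case (add F m a)
  have "z ^ (k + m) = z ^ m * z ^ k" by (metis add.commute power_add)
  with add show ?case
    by (simp add: distrib_left distrib_right eval_cvar_add mult_single mult.assoc)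
qed simp

text \<open>A term \<open>r s^k\<close> multiplied from the left acts on values as \<open>v \<mapsto> r v z^k\<close>, so stability of \<open>J\<close> under
  right multiplication by \<open>z\<close> is what replaces centrality of \<open>z\<close>.\<close>

lemma left_ideal_eval_cvar:
  assumes J: "left_ideal J" and z: "\<And>P. P \<in> J \<Longrightarrow> P * z \<in> J"
  shows "left_ideal {F. eval_cvar z F \<in> J}"
proof -
  note J' = left_idealD[OF J]
  have pow: "P * z ^ k \<in> J" if "P \<in> J" for P k
    by (induction k) (use that z in \<open>auto simp: power_Suc2 simp flip: mult.assoc simp del: power_Suc\<close>)
  have "eval_cvar z (R * F) \<in> J" if "eval_cvar z F \<in> J" for R F
  proof (induction R rule: mpoly_induct)
    case (add R k r)
    then show ?case
      by (simp add: distrib_right eval_cvar_add eval_cvar_single_mult pow J' that)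
  qed (simp add: J')
  then show ?thesis unfolding left_ideal_def by (auto simp: eval_cvar_add J')
qed

lemma cvar_cconst: "cvar * cconst P = Poly_Mapping.single 1 (P :: 'd::ring_1)"
  by (simp add: cvar_def cconst_def mult_single)

lemma cvar_power: "cvar ^ k = Poly_Mapping.single k (1 :: 'd::ring_1)"
  by (induction k) (simp_all add: cvar_def mult_single)

lemma cconst_cvar_power: "cconst P * cvar ^ k = Poly_Mapping.single k (P :: 'd::ring_1)"
  by (simp add: cvar_power cconst_def mult_single)

lemma cvar_commute: "cvar * F = F * (cvar :: nat \<Rightarrow>\<^sub>0 'd::ring_1)"
  by (induction F rule: mpoly_induct) (simp_all add: distrib_left distrib_right cvar_def mult_single add.commute)

lemma cconst_mult: "cconst (P * Q :: 'd::ring_1) = cconst P * cconst Q"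
  by (simp add: cconst_def mult_single)

lemma cconst_add: "cconst (P + Q :: 'd::ring_1) = cconst P + cconst Q"
  by (simp add: cconst_def single_add)

lemma left_ideal_hull_singleton: "left_ideal hull {a :: 'a::ring_1} = range (\<lambda>r. r * a)"
proof (rule hull_unique)
  show "{a} \<subseteq> range (\<lambda>r. r * a)" by (auto intro: range_eqI[of _ _ 1])
  show "left_ideal (range (\<lambda>r. r * a))"
    unfolding left_ideal_def by (auto simp: image_iff intro: exI[of _ 0] simp flip: distrib_right mult.assoc)
  show "range (\<lambda>r. r * a) \<subseteq> J" if "{a} \<subseteq> J" "left_ideal J" for J
    using that left_idealD(3) by auto
qed

text \<open>The intersection of \<open>I\<close> and \<open>J\<close> is obtained by eliminating a central variable \<open>v\<close> from
  \<open>v I + (1 - v) J\<close>: one direction is \<open>P = v P + (1 - v) P\<close>, the other one evaluates \<open>v\<close> at \<open>1\<close>, which leaves \<open>I\<close>, and at \<open>0\<close>, which leaves \<open>J\<close>.\<close>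

theorem I0_eq_I0_elim: "I0 f g = I0_elim f g"
proof (intro equalityI subsetI)
  let ?G = "{cvar * cconst Q | Q. Q \<in> I_tilde f} \<union> {(1 - cvar) * cconst (polyX g)}"
  note H = left_idealD[OF left_ideal_hull[of ?G]]
  fix P assume "P \<in> I0 f g"
  then obtain Q where P: "P \<in> I_tilde f" "P = Q * polyX g"
    unfolding I0_def left_ideal_hull_singleton by blast
  have "cconst P = cvar * cconst P + cconst Q * ((1 - cvar) * cconst (polyX g))"
  proof -
    have "cconst Q * ((1 - cvar) * cconst (polyX g)) = (1 - cvar) * cconst P"
      unfolding P(2) cconst_mult
      by (simp add: left_diff_distrib right_diff_distrib cvar_commute[of "cconst Q"] flip: mult.assoc)
    then show ?thesis by (simp add: left_diff_distrib)
  qed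
  also have "\<dots> \<in> left_ideal hull ?G"
    by (intro H(2) H(3) hull_inc) (use P(1) in blast)+
  finally show "P \<in> I0_elim f g" unfolding I0_elim_def by simp
next
  let ?G = "{cvar * cconst Q | Q. Q \<in> I_tilde f} \<union> {(1 - cvar) * cconst (polyX g)}"
  fix P assume "P \<in> I0_elim f g"
  then have P: "cconst P \<in> left_ideal hull ?G" unfolding I0_elim_def by simp
  note I = left_ideal_I_tilde[of f]
  have g: "(1 - cvar) * cconst (polyX g) = cconst (polyX g) - Poly_Mapping.single 1 (polyX g)"
    by (simp only: left_diff_distrib mult_1_left cvar_cconst)
  have "left_ideal hull ?G \<subseteq> {F. eval_cvar 1 F \<in> I_tilde f}"
    by (rule hull_minimal) (auto simp: g cvar_cconst eval_cvar_diff left_idealD[OF I] intro!: left_ideal_eval_cvar I)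
  with P have 1: "P \<in> I_tilde f" by auto
  have "left_ideal hull ?G \<subseteq> {F. eval_cvar 0 F \<in> left_ideal hull {polyX g}}"
    by (rule hull_minimal)
      (auto simp: g cvar_cconst eval_cvar_diff left_idealD[OF left_ideal_hull] hull_inc
        intro!: left_ideal_eval_cvar left_ideal_hull)
  with P have "P \<in> left_ideal hull {polyX g}" by auto
  with 1 show "P \<in> I0 f g" unfolding I0_def by blast
qed

lemma left_ideal_I0: "left_ideal (I0 f g)"
  using left_idealD[OF left_ideal_I_tilde[of f]] left_idealD[OF left_ideal_hull[of "{polyX g}"]]
  unfolding I0_def left_ideal_def by auto

text \<open>Modulo \<open>s - \<sigma>\<close> every \<open>r s^k\<close> is congruent to \<open>r \<sigma>^k\<close>, so each \<open>F\<close> is congruent to its value.  The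
  other direction uses that initial ideals are stable under right multiplication by \<open>\<sigma>\<close>.\<close>

lemma eval_cvar_\<sigma>_iff:
  "F \<in> left_ideal hull (cconst ` initial_ideal I \<union> {cvar - cconst \<sigma>}) \<longleftrightarrow> eval_cvar \<sigma> F \<in> initial_ideal I"
    (is "F \<in> left_ideal hull ?G \<longleftrightarrow> _")
proof
  assume F: "F \<in> left_ideal hull ?G"
  have "left_ideal {F. eval_cvar \<sigma> F \<in> initial_ideal I}"
    by (intro left_ideal_eval_cvar left_ideal_initial_ideal initial_ideal_\<sigma>)
  moreover have "eval_cvar \<sigma> (cvar - cconst \<sigma>) = (0 :: ('a, 'b) dy)"
    by (simp add: cvar_def eval_cvar_diff)
  ultimately have "left_ideal hull ?G \<subseteq> {F. eval_cvar \<sigma> F \<in> initial_ideal I}"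
    by (intro hull_minimal) (auto simp: left_idealD[OF left_ideal_initial_ideal])
  with F show "eval_cvar \<sigma> F \<in> initial_ideal I" by blast
next
  note H = left_idealD[OF left_ideal_hull[of ?G]]
  assume F: "eval_cvar \<sigma> F \<in> initial_ideal I"
  have pow: "cvar ^ k - cconst (\<sigma> ^ k) \<in> left_ideal hull ?G" for k
  proof (induction k)
    case 0
    have "cvar ^ 0 - cconst (\<sigma> ^ 0 :: ('a, 'b) dy) = 0" by (simp add: cconst_def)
    then show ?case using H(1) by (simp only:)
  next
    case (Suc k)
    have "cvar ^ Suc k - cconst (\<sigma> ^ Suc k) =
        cvar * (cvar ^ k - cconst (\<sigma> ^ k)) + cconst (\<sigma> ^ k) * (cvar - cconst \<sigma> :: nat \<Rightarrow>\<^sub>0 ('a, 'b) dy)"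
      by (simp add: right_diff_distrib cvar_commute[of "cconst (\<sigma> ^ k)"] power_commutes flip: cconst_mult)
    also have "\<dots> \<in> left_ideal hull ?G"
      using Suc by (intro H(2) H(3)) (auto intro!: hull_inc)
    finally show ?case .
  qed
  have "F - cconst (eval_cvar \<sigma> F) \<in> left_ideal hull ?G"
  proof (induction F rule: mpoly_induct)
    case zero
    show ?case using H(1) by (simp add: cconst_def)
  next
    case (add F k r)
    have "F + Poly_Mapping.single k r - cconst (eval_cvar \<sigma> (F + Poly_Mapping.single k r)) =
        (F - cconst (eval_cvar \<sigma> F)) + cconst r * (cvar ^ k - cconst (\<sigma> ^ k))"
      by (simp add: eval_cvar_add cconst_add right_diff_distrib cconst_cvar_power cconst_mult)
    also have "\<dots> \<in> left_ideal hull ?G" by (intro H(2) H(3) add pow)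
    finally show ?case .
  qed
  moreover have "cconst (eval_cvar \<sigma> F) \<in> left_ideal hull ?G" using F by (intro hull_inc) simp
  ultimately have "F - cconst (eval_cvar \<sigma> F) + cconst (eval_cvar \<sigma> F) \<in> left_ideal hull ?G" by (rule H(2))
  then show "F \<in> left_ideal hull ?G" by simp
qed

section \<open>Evaluation at \<open>\<sigma>\<close> and divisibility by g\<close>

definition at_\<sigma> :: "'n::finite cpoly poly \<Rightarrow> ('n, 'r::finite) dy"
  where "at_\<sigma> p = (\<Sum>k\<le>degree p. polyX (coeff p k) * \<sigma> ^ k)"

lemma at_\<sigma>_bound:
  assumes "degree p \<le> n"
  shows "at_\<sigma> p = (\<Sum>k\<le>n. polyX (coeff p k) * \<sigma> ^ k)"
  unfolding at_\<sigma>_def using assms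
  by (intro sum.mono_neutral_left) (auto simp: coeff_eq_0)

lemma I2_iff: "p \<in> I2 (f :: 'r::finite \<Rightarrow> 'n::finite cpoly) g \<longleftrightarrow> (at_\<sigma> p :: ('n, 'r) dy) \<in> I1 f g"
proof -
  have "eval_cvar \<sigma> (polyXs p) = (at_\<sigma> p :: ('n, 'r) dy)"
    by (simp add: polyXs_def at_\<sigma>_def eval_cvar_sum cconst_cvar_power)
  then show ?thesis unfolding I2_def I1_def mem_Collect_eq eval_cvar_\<sigma>_iff by simp
qed

lemma \<sigma>_in_A0: "\<sigma> \<in> A0"
  unfolding \<sigma>_def by (intro A0_uminus A0_sum A0_dT_tY)

lemma A0_power: "P \<in> A0 \<Longrightarrow> P ^ k \<in> A0"
  by (induction k) (use A0_const[of 1] in \<open>simp_all add: A0_mult\<close>)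

lemma at_\<sigma>_in_A0: "at_\<sigma> p \<in> A0"
  unfolding at_\<sigma>_def by (intro A0_sum A0_mult A0_polyX A0_power \<sigma>_in_A0)

lemma poly_weyl_bound:
  assumes "degree b \<le> n"
  shows "poly_weyl b P = (\<Sum>k\<le>n. wconst (coeff b k) * P ^ k)"
  unfolding poly_weyl_def using assms
  by (intro sum.mono_neutral_left) (auto simp: coeff_eq_0)

lemma poly_weyl_0 [simp]: "poly_weyl 0 P = 0"
  by (simp add: poly_weyl_def)

lemma poly_weyl_add: "poly_weyl (b + c) P = poly_weyl b P + poly_weyl c P"
proof -
  have "degree (b + c) \<le> max (degree b) (degree c)" by (rule degree_add_le_max)
  then show ?thesis
    by (simp add: poly_weyl_bound[of _ "max (degree b) (degree c)"] mconst_add weyl_poly_add distrib_right sum.distrib)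
qed

lemma poly_weyl_smult: "poly_weyl (smult a b) P = wconst a * poly_weyl b P"
  by (simp add: poly_weyl_bound[of _ "degree b"] degree_smult_le mconst_mult weyl_poly_mult sum_distrib_left mult.assoc)

lemma poly_weyl_pCons_0: "poly_weyl (pCons 0 b) P = P * poly_weyl b P"
proof -
  have "poly_weyl (pCons 0 b) P = (\<Sum>k\<le>Suc (degree b). wconst (coeff (pCons 0 b) k) * P ^ k)"
    by (rule poly_weyl_bound) (rule degree_pCons_le)
  also have "\<dots> = (\<Sum>k\<le>degree b. wconst (coeff b k) * P ^ Suc k)"
    by (simp add: sum.atMost_Suc_shift del: sum.atMost_Suc power_Suc)
  also have "\<dots> = P * poly_weyl b P"
    unfolding poly_weyl_def sum_distrib_left
    by (intro sum.cong refl) (metis mult.assoc power_Suc wconst_central)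
  finally show ?thesis .
qed

lemma poly_weyl_const: "poly_weyl [:a:] P = wconst a"
  by (simp add: poly_weyl_def)

lemma poly_weyl_mult: "poly_weyl (b * c) P = poly_weyl b P * poly_weyl c P"
proof (induction b)
  case (pCons a b)
  have "poly_weyl (pCons a b) P = wconst a + P * poly_weyl b P"
    using poly_weyl_add[of "[:a:]" "pCons 0 b" P] by (simp add: poly_weyl_const poly_weyl_pCons_0)
  with pCons.IH show ?case
    by (simp add: poly_weyl_add poly_weyl_smult poly_weyl_pCons_0 distrib_right mult.assoc)
qed simp

lemma poly_weyl_\<sigma>_in_A0: "poly_weyl q \<sigma> \<in> A0"
  unfolding poly_weyl_def by (intro A0_sum A0_mult A0_const A0_power \<sigma>_in_A0)

lemma at_\<sigma>_mult_const:
  "at_\<sigma> (map_poly mconst q * [:g:]) = poly_weyl q \<sigma> * (polyX g :: ('n::finite, 'r::finite) dy)"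
proof -
  have co: "coeff (map_poly mconst q * [:g:]) k = mconst (coeff q k) * g" for k
    by (simp add: coeff_map_poly mult.commute)
  then have "degree (map_poly mconst q * [:g:]) \<le> degree q"
    by (intro degree_le) (simp add: coeff_eq_0)
  then have "at_\<sigma> (map_poly mconst q * [:g:]) =
      (\<Sum>k\<le>degree q. polyX (mconst (coeff q k) * g) * (\<sigma> :: ('n, 'r) dy) ^ k)"
    by (simp only: at_\<sigma>_bound co)
  moreover have "polyX (mconst a * g) * \<sigma> ^ k = wconst a * \<sigma> ^ k * (polyX g :: ('n, 'r) dy)" for a k
  proof -
    have "(polyX g :: ('n, 'r) dy) * \<sigma> ^ k = \<sigma> ^ k * polyX g"
    proof (induction k)
      case (Suc k)
      have "polyX g * \<sigma> ^ Suc k = \<sigma> * (polyX g * \<sigma> ^ k :: ('n, 'r) dy)"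
        by (simp add: \<sigma>_polyX flip: mult.assoc)
      with Suc show ?case by (simp add: mult.assoc)
    qed simp
    then show ?thesis by (simp add: polyX_mult mult.assoc)
  qed
  ultimately show ?thesis by (simp add: poly_weyl_def sum_distrib_right)
qed

lemma I4_iff:
  "q \<in> I4 (f :: 'r::finite \<Rightarrow> 'n::finite cpoly) g \<longleftrightarrow> poly_weyl q \<sigma> * (polyX g :: ('n, 'r) dy) \<in> I1 f g"
  unfolding I4_def I3_def ideal_quotient_def mem_Collect_eq I2_iff at_\<sigma>_mult_const ..

lemma left_ideal_I4: "left_ideal (I4 f g)"
  using left_idealD[OF left_ideal_initial_ideal[of "I0 f g"]]
  unfolding left_ideal_def Ball_def I4_iff I1_def
  by (auto simp: poly_weyl_add poly_weyl_mult distrib_right mult.assoc)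

lemma lookup_mvar_mult:
  "Poly_Mapping.lookup (mvar j * p) (m + Poly_Mapping.single j 1) =
    (Poly_Mapping.lookup p m :: 'a::comm_semiring_1)"
proof (induction p rule: mpoly_induct)
  case (add p k a)
  then show ?case
    by (simp add: distrib_left lookup_add mvar_def mult_single lookup_single when_def add.commute)
qed simp

lemma lookup_mvar_mult_0:
  assumes "Poly_Mapping.lookup m j = 0"
  shows "Poly_Mapping.lookup (mvar j * p) m = (0 :: 'a::comm_semiring_1)"
proof (induction p rule: mpoly_induct)
  case (add p k a)
  have "Poly_Mapping.single j (1 :: nat) + k \<noteq> m"
  proof
    assume "Poly_Mapping.single j (1 :: nat) + k = m"
    then have "Poly_Mapping.lookup (Poly_Mapping.single j (1 :: nat) + k) j = 0" using assms by simp
    then show False by (simp add: lookup_add)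
  qed
  with add show ?case
    by (simp add: distrib_left lookup_add mvar_def mult_single lookup_single when_def)
qed simp

text \<open>This makes the powers of \<open>s\<^sub>1 + \<dots> + s\<^sub>r\<close> visible separately, at pure powers of a single variable.\<close>

lemma lookup_sum_mvar_power:
  "Poly_Mapping.lookup ((\<Sum>i\<in>UNIV. mvar i) ^ k :: ('v::finite \<Rightarrow>\<^sub>0 nat) \<Rightarrow>\<^sub>0 'a::comm_semiring_1)
    (Poly_Mapping.single j l) = (if k = l then 1 else 0)"
proof (induction k arbitrary: l)
  case 0
  have "Poly_Mapping.single j l = 0 \<longleftrightarrow> l = 0" by (metis lookup_single_eq lookup_zero single_zero)
  then show ?case by (simp add: lookup_one when_def)
next
  case (Suc k)
  let ?S = "(\<Sum>i\<in>UNIV. mvar i) :: ('v \<Rightarrow>\<^sub>0 nat) \<Rightarrow>\<^sub>0 'a"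
  have "Poly_Mapping.lookup (mvar i * ?S ^ k) (Poly_Mapping.single j l) =
      (if i = j then (if Suc k = l then 1 else 0) else 0)" for i
  proof (cases "i = j \<and> l \<noteq> 0")
    case True
    then obtain l' where l: "l = Suc l'" by (cases l) auto
    then have "Poly_Mapping.single j l = Poly_Mapping.single j l' + Poly_Mapping.single j 1"
      by (simp flip: single_add)
    with True lookup_mvar_mult[of j "?S ^ k" "Poly_Mapping.single j l'"] Suc.IH[of l'] show ?thesis
      by (simp add: l)
  next
    case False
    then have "Poly_Mapping.lookup (Poly_Mapping.single j l) i = 0" by (auto simp: lookup_single when_def)
    from lookup_mvar_mult_0[OF this] False show ?thesis by auto
  qed
  then show ?case by (simp add: sum_distrib_right lookup_sum)
qed

lemma graded_piece_I1_iff: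
  fixes Z :: "('n::finite, 'r::finite) dy"
  assumes "graded_piece 0 Z"
  shows "Z \<in> I1 f g \<longleftrightarrow>
    (\<exists>P. P * polyX g \<in> I_tilde f \<and> hcomp 0 P * polyX g = Z \<and> (\<forall>k>0. hcomp k P * polyX g = 0))"
proof -
  have *: "hcomp k (P * polyX g) = hcomp k P * polyX g" for k and P :: "('n, 'r) dy"
    using hcomp_mult_right[OF graded_piece.poly] by simp
  have "(\<exists>P\<in>J \<inter> range (\<lambda>r. r * polyX g). Q P) \<longleftrightarrow> (\<exists>r. r * polyX g \<in> J \<and> Q (r * polyX g))"
    for J and Q :: "('n, 'r) dy \<Rightarrow> bool" by blast
  then show ?thesis
    unfolding I1_def initial_ideal_homogeneous_iff[OF left_ideal_I0 assms]
    unfolding I0_def left_ideal_hull_singleton by (simp only: *)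
qed

text \<open>For \<open>h\<close> in \<^const>\<open>I2\<close> one has \<open>h(x, \<sigma>) = Q g\<close> for some operator \<open>Q\<close>.  Let both sides act on \<open>1 / g\<close> in the
  module that belongs to \<open>f = (1, \<dots>, 1)\<close>, extended to the fraction field.  There \<open>\<sigma>\<close> acts as
  multiplication by \<open>S = s\<^sub>1 + \<dots> + s\<^sub>r\<close>, and elements without denominators are stable, so
  \<open>\<Sum>\<^sub>k (h\<^sub>k / g) S^k = Q 1\<close> has polynomial coefficients.\<close>

lemma I2_imp_dvd:
  fixes f :: "'r::finite \<Rightarrow> 'n::{finite,linorder} cpoly"
  assumes "g \<noteq> 0" and h: "h \<in> I2 f g"
  shows "[:g:] dvd h"
proof -
  have "(at_\<sigma> h :: ('n, 'r) dy) \<in> I1 f g" using h by (simp add: I2_iff)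
  then obtain Q :: "('n, 'r) dy" where Q: "at_\<sigma> h = Q * polyX g"
    using graded_piece_I1_iff[OF graded_piece_A0[OF at_\<sigma>_in_A0]] by metis
  define one :: "'r \<Rightarrow> 'n cpoly" where "one = (\<lambda>_. 1)"
  have one: "one i \<noteq> 0" for i by (simp add: one_def)
  obtain \<Phi> :: "('n, 'r) dy \<Rightarrow> ('n, 'r) smod \<Rightarrow> ('n, 'r) smod" where
    \<Phi>: "\<And>P h h'. \<Phi> P (h + h') = \<Phi> P h + \<Phi> P h'"
    "\<And>P Q h. \<Phi> (P + Q) h = \<Phi> P h + \<Phi> Q h" "\<And>P Q h. \<Phi> (P * Q) h = \<Phi> P (\<Phi> Q h)"
    "\<And>p h. \<Phi> (polyX p) h = mconst (to_fract p) * h" "\<And>i h. \<Phi> (dX i) h = act_dx one i h"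
    "\<And>j h. \<Phi> (tY j) h = act_t one j h" "\<And>j h. \<Phi> (dT j) h = act_dt one j h"
    "\<And>P h. h \<in> N_mod one \<Longrightarrow> \<Phi> P h \<in> N_mod one"
    by (rule action_exists[of one, OF one]) (rule that)
  have zero: "\<Phi> 0 h = 0" for h using \<Phi>(2)[of 0 0 h] by simp
  have sum: "\<Phi> (sum P S) h = (\<Sum>i\<in>S. \<Phi> (P i) h)" for P h and S :: "'z set"
    by (induction S rule: infinite_finite_induct) (simp_all add: zero \<Phi>)
  have uminus: "\<Phi> (- P) h = - \<Phi> P h" for P h
    using \<Phi>(2)[of P "- P" h] by (simp add: zero add_eq_0_iff)
  have "\<Phi> (dT j * tY j) h = - (mvar j * h)" for j h
    by (simp add: \<Phi> act_t_def[of one, OF one] act_dt_def[of one, OF one] s_shift_mult s_shift_shift)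
      (simp add: one_def)
  then have \<sigma>: "\<Phi> \<sigma> h = (\<Sum>j\<in>UNIV. mvar j) * h" for h
    by (simp add: \<sigma>_def uminus sum sum_negf sum_distrib_right)
  have "\<Phi> 1 h = h" for h using \<Phi>(4)[of 1 h] by simp
  then have pow: "\<Phi> (\<sigma> ^ k) h = (\<Sum>j\<in>UNIV. mvar j) ^ k * h" for k h
    by (induction k) (simp_all add: \<Phi>(3) \<sigma> mult.assoc)
  let ?u = "mconst (inverse (to_fract g)) :: ('n, 'r) smod"
  have "\<Phi> (at_\<sigma> h) ?u = \<Phi> Q (mconst 1)"
    using \<open>g \<noteq> 0\<close> by (simp add: Q \<Phi>(3,4) del: mconst_1 flip: mconst_mult)
  also have "\<dots> \<in> N_mod one"
    using to_fract_in_localization[of 1 one] by (intro \<Phi>(8) N_mod_mconst[of one, OF one]) simp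
  finally have N: "(\<Sum>k\<le>degree h. mconst (to_fract (coeff h k)) * ((\<Sum>j\<in>UNIV. mvar j) ^ k * ?u)) \<in> N_mod one"
    by (simp add: at_\<sigma>_def sum \<Phi>(3,4) pow)
  have "g dvd coeff h k" for k
  proof (cases "k \<le> degree h")
    case True
    fix j :: 'r
    let ?m = "Poly_Mapping.single j k"
    have "Poly_Mapping.lookup (mconst (to_fract (coeff h l)) * ((\<Sum>j\<in>UNIV. mvar j) ^ l * ?u)) ?m =
        (if l = k then to_fract (coeff h l) / to_fract g else 0)" for l
      by (simp add: mult.commute[of _ ?u] lookup_sum_mvar_power divide_inverse)
    with True have "Poly_Mapping.lookup
        (\<Sum>l\<le>degree h. mconst (to_fract (coeff h l)) * ((\<Sum>j\<in>UNIV. mvar j) ^ l * ?u)) ?m =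
        to_fract (coeff h k) / to_fract g"
      by (simp add: lookup_sum)
    with N have "to_fract (coeff h k) / to_fract g \<in> localization one"
      unfolding N_mod_def by (metis (no_types, lifting) mem_Collect_eq)
    then obtain p where "to_fract (coeff h k) / to_fract g = to_fract p"
      unfolding localization_def one_def by auto
    then have "to_fract (coeff h k) = to_fract (p * g)"
      using \<open>g \<noteq> 0\<close> by (simp add: divide_eq_eq)
    then show ?thesis by (simp del: to_fract_mult)
  qed (simp add: coeff_eq_0)
  then show ?thesis by (simp add: const_poly_dvd_iff)
qed

section \<open>The functional equation\<close>

context
  fixes f :: "'r::finite \<Rightarrow> 'n::{finite,linorder} cpoly"
  assumes f_nonzero: "\<And>i. f i \<noteq> 0"
begin

lemmas act_hom = N_act_hom[of f, OF f_nonzero emb_in_N_mod[of f, OF f_nonzero]]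
lemmas act_sum = N_act_sum[of f, OF f_nonzero emb_in_N_mod[of f, OF f_nonzero]]
lemmas act_diff = N_act_diff[of f, OF f_nonzero emb_in_N_mod[of f, OF f_nonzero]]
lemmas act_zero = N_act_zero[of f, OF f_nonzero emb_in_N_mod[of f, OF f_nonzero]]
lemmas act_polyX_emb = N_act_polyX_emb[of f, OF f_nonzero]
lemmas act_tY_emb = N_act_tY_emb[of f, OF f_nonzero]

lemma act_uminus: "N_act f (- Q) (emb h) = - N_act f Q (emb h)"
  using act_diff[of 0 Q] act_zero by simp

text \<open>On \<open>h u\<close>, with \<open>h\<close> a polynomial in \<open>x\<close>, a rightmost \<open>t\<^sub>j\<close> acts as multiplication by \<open>f\<^sub>j\<close>, which has
  degree \<open>0\<close>.\<close>

lemma A0_words_act: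
  "R \<in> A0_words tY k \<Longrightarrow> \<exists>R'\<in>A0. \<forall>h. N_act f R (emb h) = N_act f R' (emb h)"
proof (induction k arbitrary: R)
  case (Suc k)
  then obtain S where S: "R = (\<Sum>j\<in>UNIV. S j * tY j)" "\<And>j. S j \<in> A0_words tY k" by auto
  have "\<forall>j. \<exists>T. T \<in> A0 \<and> (\<forall>h. N_act f (S j) (emb h) = N_act f T (emb h))"
    using Suc.IH[OF S(2)] unfolding Bex_def by (rule allI)
  from choice[OF this] obtain T where
    T: "\<And>j. T j \<in> A0" "\<And>j h. N_act f (S j) (emb h) = N_act f (T j) (emb h)" by auto
  have "N_act f R (emb h) = N_act f (\<Sum>j\<in>UNIV. T j * polyX (f j)) (emb h)" for h
    by (simp add: S(1) act_sum act_hom(4) act_tY_emb act_polyX_emb T(2) mult.commute del: to_fract_mult)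
  moreover have "(\<Sum>j\<in>UNIV. T j * polyX (f j)) \<in> A0"
    by (intro A0_sum A0_mult A0_polyX T(1))
  ultimately show ?case by blast
qed auto

text \<open>The right-hand side of the functional equation, for an operator \<open>R\<close> in place of \<open>b(\<sigma>)\<close>.\<close>

definition shifts_into_f :: "'n cpoly \<Rightarrow> ('n, 'r) dy \<Rightarrow> bool"
  where "shifts_into_f g R \<longleftrightarrow>
    (\<exists>P. (\<forall>j. P j \<in> A0) \<and> N_act f R (emb g) = (\<Sum>j\<in>UNIV. N_act f (P j) (emb (g * f j))))"

lemma shifts_into_f_add:
  assumes "shifts_into_f g R" "shifts_into_f g S"
  shows "shifts_into_f g (R + S)"
proof -
  from assms(1) obtain P where
    P: "\<forall>j. P j \<in> A0" "N_act f R (emb g) = (\<Sum>j\<in>UNIV. N_act f (P j) (emb (g * f j)))"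
    unfolding shifts_into_f_def by (elim exE conjE)
  from assms(2) obtain Q where
    Q: "\<forall>j. Q j \<in> A0" "N_act f S (emb g) = (\<Sum>j\<in>UNIV. N_act f (Q j) (emb (g * f j)))"
    unfolding shifts_into_f_def by (elim exE conjE)
  from P Q show ?thesis
    unfolding shifts_into_f_def
    by (intro exI[of _ "\<lambda>j. P j + Q j"]) (simp add: A0_add act_hom(3) sum.distrib del: to_fract_mult)
qed

lemma shifts_into_f_uminus:
  assumes "shifts_into_f g R"
  shows "shifts_into_f g (- R)"
proof -
  from assms obtain P where
    "\<forall>j. P j \<in> A0" "N_act f R (emb g) = (\<Sum>j\<in>UNIV. N_act f (P j) (emb (g * f j)))"
    unfolding shifts_into_f_def by (elim exE conjE)
  then show ?thesis
    unfolding shifts_into_f_def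
    by (intro exI[of _ "\<lambda>j. - P j"]) (simp add: A0_uminus act_uminus sum_negf del: to_fract_mult)
qed

lemma shifts_into_f_0: "shifts_into_f g 0"
  unfolding shifts_into_f_def by (rule exI[of _ "\<lambda>_. 0"]) (simp add: A0_0 act_zero del: to_fract_mult)

lemma shifts_into_f_sum:
  "(\<And>i. i \<in> S \<Longrightarrow> shifts_into_f g (R i)) \<Longrightarrow> shifts_into_f g (sum R S)"
proof (induction S rule: infinite_finite_induct)
  case (insert i S)
  then show ?case by (simp add: shifts_into_f_add)
qed (simp_all add: shifts_into_f_0)

text \<open>The last letter \<open>t\<^sub>j\<close> of each word supplies the factor \<open>f\<^sub>j\<close>; \<open>A0_words_act\<close> absorbs the others.\<close>

lemma shifts_into_f_negative:
  assumes "graded_piece m R" "m < 0"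
  shows "shifts_into_f g R"
proof -
  have "nat (- m) = Suc (nat (- m - 1))" using assms(2) by simp
  with graded_piece_nonpos[OF assms(1)] assms(2) have "R \<in> A0_words tY (Suc (nat (- m - 1)))" by simp
  then obtain S where S: "R = (\<Sum>j\<in>UNIV. S j * tY j)" "\<And>j. S j \<in> A0_words tY (nat (- m - 1))" by auto
  have "\<forall>j. \<exists>T. T \<in> A0 \<and> (\<forall>h. N_act f (S j) (emb h) = N_act f T (emb h))"
    using A0_words_act[OF S(2)] unfolding Bex_def by (rule allI)
  from choice[OF this] obtain T where
    T: "\<And>j. T j \<in> A0" "\<And>j h. N_act f (S j) (emb h) = N_act f (T j) (emb h)" by auto
  have "N_act f R (emb g) = (\<Sum>j\<in>UNIV. N_act f (T j) (emb (g * f j)))"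
    by (simp add: S(1) act_sum act_hom(4) act_tY_emb T(2) del: to_fract_mult)
  with T(1) show ?thesis unfolding shifts_into_f_def by blast
qed

text \<open>An element of \<^const>\<open>I0\<close> with leading part \<open>b(\<sigma>) g\<close> in degree \<open>0\<close> is the same as a functional equation:
  its terms of negative degree, brought to the other side, act on \<open>u\<close> like \<open>\<Sum>\<^sub>j P\<^sub>j t\<^sub>j g\<close>.\<close>

theorem I4_iff_bs_equation: "q \<in> I4 f g \<longleftrightarrow> bs_equation f g q"
proof -
  let ?b = "poly_weyl q \<sigma> :: ('n, 'r) dy"
  have b: "graded_piece 0 ?b" by (intro graded_piece_A0 poly_weyl_\<sigma>_in_A0)
  then have bg: "graded_piece 0 (?b * polyX g)"
    using graded_piece.mult[OF b graded_piece.poly] by simp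
  have ann: "P * polyX g \<in> I_tilde f \<longleftrightarrow> N_act f P (emb g) = 0" for P
    unfolding I_tilde_iff_annihilates[of f, OF f_nonzero] act_hom(4) act_polyX_emb by simp
  have bs: "bs_equation f g q \<longleftrightarrow> shifts_into_f g ?b"
    unfolding bs_equation_def shifts_into_f_def A0_def by simp
  show ?thesis
  proof
    assume "q \<in> I4 f g"
    then obtain P where P: "P * polyX g \<in> I_tilde f" "hcomp 0 P * polyX g = ?b * polyX g"
        "\<forall>k>0. hcomp k P * polyX g = 0"
      unfolding I4_iff graded_piece_I1_iff[OF bg] by (elim exE conjE)
    \<comment> \<open>The components of \<open>P\<close> of positive degree are known to vanish after multiplication by \<open>g\<close>, hence on \<open>g u\<close>.\<close>
    have act_g: "N_act f S (emb g) = N_act f (S * polyX g) (emb 1)" for S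
      by (simp only: act_hom(4) act_polyX_emb mult_1_right)
    have pos: "N_act f (hcomp m P) (emb g) = 0" if "m > 0" for m
      unfolding act_g P(3)[rule_format, OF that] by (rule act_zero)
    let ?M = "{m. hcomp m P \<noteq> 0}"
    have "P = (\<Sum>m\<in>?M. hcomp m P)" by (rule sum_hcomp)
    also have "\<dots> = (\<Sum>m\<in>insert 0 ?M. hcomp m P)"
      using finite_hcomp[of P] by (intro sum.mono_neutral_left) auto
    finally have "N_act f P (emb g) = N_act f (\<Sum>m\<in>insert 0 ?M. hcomp m P) (emb g)"
      by (rule arg_cong)
    also have "\<dots> = (\<Sum>m\<in>insert 0 ?M. N_act f (hcomp m P) (emb g))"
      by (rule act_sum)
    also have "\<dots> = N_act f (hcomp 0 P) (emb g) + (\<Sum>m\<in>?M - {0}. N_act f (hcomp m P) (emb g))"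
      using finite_hcomp[of P] by (simp add: sum.insert_remove)
    also have "N_act f (hcomp 0 P) (emb g) = N_act f ?b (emb g)"
      unfolding act_g P(2) ..
    also have "(\<Sum>m\<in>?M - {0}. N_act f (hcomp m P) (emb g)) =
        (\<Sum>m\<in>?M - {0} - {0<..}. N_act f (hcomp m P) (emb g))"
      using finite_hcomp[of P] by (intro sum.mono_neutral_right) (auto simp: pos)
    also have "\<dots> = N_act f (\<Sum>m\<in>?M - {0} - {0<..}. hcomp m P) (emb g)"
      by (rule act_sum[symmetric])
    finally have eq: "N_act f ?b (emb g) = N_act f (- (\<Sum>m\<in>?M - {0} - {0<..}. hcomp m P)) (emb g)"
      using P(1) by (simp add: ann act_uminus eq_neg_iff_add_eq_0 del: to_fract_mult)
    have "shifts_into_f g (- (\<Sum>m\<in>?M - {0} - {0<..}. hcomp m P))"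
      by (intro shifts_into_f_uminus shifts_into_f_sum shifts_into_f_negative[OF graded_piece_hcomp]) auto
    then show "bs_equation f g q"
      unfolding bs shifts_into_f_def eq .
  next
    assume "bs_equation f g q"
    then obtain P where P: "\<forall>j. P j \<in> A0"
      "N_act f ?b (emb g) = (\<Sum>j\<in>UNIV. N_act f (P j) (emb (g * f j)))"
      unfolding bs shifts_into_f_def by (elim exE conjE)
    let ?R = "\<Sum>j\<in>UNIV. P j * tY j"
    have R: "graded_piece (- 1) ?R"
      by (intro graded_piece_sum) (use graded_piece.mult[OF graded_piece_A0[OF P(1)[rule_format]] graded_piece.t] in simp)
    have "N_act f (?b - ?R) (emb g) = 0"
      by (simp add: act_diff act_sum act_hom(4) act_tY_emb P(2) del: to_fract_mult)
    then have "(?b - ?R) * polyX g \<in> I_tilde f" by (simp add: ann)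
    moreover have "hcomp k (?b - ?R) = (if k = 0 then ?b else if k = - 1 then - ?R else 0)" for k
      by (simp add: hcomp_diff hcomp_homogeneous[OF b] hcomp_homogeneous[OF R])
    ultimately show "q \<in> I4 f g"
      unfolding I4_iff graded_piece_I1_iff[OF bg] by (intro exI[of _ "?b - ?R"]) simp
  qed
qed

end

section \<open>Generators of ideals of the polynomial ring\<close>

lemma minimal_monic_iff_generator:
  fixes J :: "'a::field poly set"
  assumes J: "left_ideal J" and monic: "lead_coeff b = 1"
  shows "b \<in> J \<and> (\<forall>c\<in>J. lead_coeff c = 1 \<longrightarrow> degree b \<le> degree c) \<longleftrightarrow> J = left_ideal hull {b}"
proof
  note J = left_idealD[OF J]
  have b: "b \<noteq> 0" using monic by auto
  assume min: "b \<in> J \<and> (\<forall>c\<in>J. lead_coeff c = 1 \<longrightarrow> degree b \<le> degree c)"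
  have "q \<in> range (\<lambda>r. r * b)" if "q \<in> J" for q
  proof -
    let ?r = "q mod b"
    have "?r = q - q div b * b" by (simp add: minus_div_mult_eq_mod)
    with min that have r: "?r \<in> J" by (simp add: J)
    have "?r = 0"
    proof (rule ccontr)
      assume "?r \<noteq> 0"
      let ?c = "[:inverse (lead_coeff ?r):] * ?r"
      have "?c \<in> J" using r by (rule J(3))
      moreover have "lead_coeff ?c = 1" "degree ?c = degree ?r" using \<open>?r \<noteq> 0\<close> by simp_all
      ultimately have "degree b \<le> degree ?r" using min by metis
      with degree_mod_less[OF b, of q] \<open>?r \<noteq> 0\<close> show False by simp
    qed
    then have "q = q div b * b" by (metis add.right_neutral div_mult_mod_eq)
    then show ?thesis by blast
  qed
  then show "J = left_ideal hull {b}"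
    unfolding left_ideal_hull_singleton using min J(3) by blast
next
  assume gen: "J = left_ideal hull {b}"
  then have "b \<in> J" by (simp add: hull_inc)
  moreover have "degree b \<le> degree c" if "c \<in> J" "lead_coeff c = 1" for c
  proof -
    have "b dvd c" "c \<noteq> 0" using that gen unfolding left_ideal_hull_singleton by auto
    then show ?thesis by (rule dvd_imp_degree_le)
  qed
  ultimately show "b \<in> J \<and> (\<forall>c\<in>J. lead_coeff c = 1 \<longrightarrow> degree b \<le> degree c)" by blast
qed

theorem theorem3p5:
  fixes f :: "'r::finite \<Rightarrow> 'n::{finite,linorder} cpoly"
    and g :: "'n cpoly" and b :: "complex poly"
  assumes "\<And>i. f i \<noteq> 0" and "g \<noteq> 0"
  shows "I0 f g = I0_elim f g
    \<and> to_fract ` I3 f g = (\<lambda>h. to_fract h / to_fract [:g:]) ` I2 f g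
    \<and> (is_bernstein_sato f g b \<longleftrightarrow> lead_coeff b = 1 \<and> I4 f g = left_ideal hull {b})"
proof (intro conjI)
  show "I0 f g = I0_elim f g" by (rule I0_eq_I0_elim)
  have g: "to_fract [:g:] \<noteq> 0" using assms(2) by simp
  show "to_fract ` I3 f g = (\<lambda>h. to_fract h / to_fract [:g:]) ` I2 f g"
  proof (intro equalityI subsetI)
    fix x assume "x \<in> to_fract ` I3 f g"
    then obtain h where h: "h * [:g:] \<in> I2 f g" "x = to_fract h"
      unfolding I3_def ideal_quotient_def by blast
    moreover have "x = to_fract (h * [:g:]) / to_fract [:g:]"
      unfolding h(2) to_fract_mult using g by simp
    ultimately show "x \<in> (\<lambda>h. to_fract h / to_fract [:g:]) ` I2 f g" by (intro image_eqI)
  next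
    fix x assume "x \<in> (\<lambda>h. to_fract h / to_fract [:g:]) ` I2 f g"
    then obtain h where h: "h \<in> I2 f g" "x = to_fract h / to_fract [:g:]" by blast
    from I2_imp_dvd[OF assms(2) h(1)] obtain k where k: "h = k * [:g:]" by (metis dvdE mult.commute)
    have "k \<in> I3 f g" using h(1) unfolding k I3_def ideal_quotient_def by simp
    moreover have "x = to_fract k"
      unfolding h(2) k to_fract_mult using g by simp
    ultimately show "x \<in> to_fract ` I3 f g" by blast
  qed
  have "bs_equation f g q \<longleftrightarrow> q \<in> I4 f g" for q
    using I4_iff_bs_equation[of f q g, OF assms(1)] by simp
  then show "is_bernstein_sato f g b \<longleftrightarrow> lead_coeff b = 1 \<and> I4 f g = left_ideal hull {b}"
    unfolding is_bernstein_sato_def using minimal_monic_iff_generator[OF left_ideal_I4, of b f g] by auto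
qed

end
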